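(* Let $\mathcal{P}_\ell=\{A_{\ell,j}: j=1,2,\ldots,m_\ell\}$, $\ell=1,2,\ldots$, be a sequence of partitions of $\mathcal{R}^d$ into Borel sets such that: (a) the sequence is nested, i.e. any cell of $\mathcal{P}_{\ell+1}$ is a subset of a cell of $\mathcal{P}_\ell$, $\ell=1,2,\ldots$; (b) each partition $\mathcal{P}_\ell$ is finite; (c) with $\mathrm{diam}(A)=\sup_{x,y\in A}\|x-y\|$, for each sphere $S$ centered at the origin, $\displaystyle\lim_{\ell\to\infty}\ \max_{j:\,A_{\ell,j}\cap S\neq\emptyset}\mathrm{diam}(A_{\ell,j})=0$. Let $g$ be the pattern recognition scheme built from $(\mathcal{P}_\ell)_{\ell\ge1}$ as defined in the context. Then for any stationary and ergodic process $\{(X_n,Y_n)\}_{n=-\infty}^{\infty}$ with values in $\mathcal{R}^d\times\{0,1\}$, with randomizing variables $U_1,U_2,\ldots$ that are i.i.d. uniform on $[0,1]$ and independent of $\{(X_n,Y_n)\}$, $$\lim_{n\to\infty}R_1^n(g)=R^*\quad\text{almost surely},$$ where $R_1^n(g)=\frac1n\sum_{i=1}^n I_{\{g_i(Y_1^{i-1},X_1^i,U_i)\neq Y_i\}}$ and $$R^*=\mathbf{E}\left[\min\left(\mathbf{P}\{Y_0=1\mid Y_{-\infty}^{-1},X_{-\infty}^0\},\ \mathbf{P}\{Y_0=0\mid Y_{-\infty}^{-1},X_{-\infty}^0\}\right)\right].$$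
   Context: Notation: $\mathcal{R}^d$ is $d$-dimensional Euclidean space; $y_a^b=(y_a,\ldots,y_b)$ and similarly for $x$; $y_1^0$ is the empty string; $Y_{-\infty}^{-1}=(\ldots,Y_{-2},Y_{-1})$, $X_{-\infty}^0=(\ldots,X_{-1},X_0)$; $I$ is the indicator function. A prediction strategy is a sequence of functions $g_i:\{0,1\}^{i-1}\times(\mathcal{R}^d)^i\times[0,1]\to\{0,1\}$, predicting $y_i$ at time $i$ by $g_i(y_1^{i-1},x_1^i,U_i)$. Quantizers. $G_\ell(x)=j$ if $x\in A_{\ell,j}$; $G_\ell$ is applied to strings coordinatewise. Experts. For integers $k,\ell\ge1$, $n\ge 1$, $s\in\{0,1\}^k$, $z\in\{1,\ldots,m_\ell\}^{k+1}$, $y\in\{0,1\}$ define, for $n>k+1$, $$\widehat P_n^{(k,\ell)}(y,y_1^{n-1},x_1^n,s,z)=\frac{|\{k<i<n:\ y_{i-k}^{i-1}=s,\ G_\ell(x_{i-k}^i)=z,\ y_i=y\}|}{|\{k<i<n:\ y_{i-k}^{i-1}=s,\ G_\ell(x_{i-k}^i)=z\}|},$$ with $0/0:=1/2$; for $n\le k+1$ set $\widehat P_n^{(k,\ell)}(y,y_1^{n-1},x_1^n,s,z)=1/2$. The expert $h^{(k,\ell)}$ is $$h_n^{(k,\ell)}(y_1^{n-1},x_1^n)=\begin{cases}0&\text{if }\widehat P_n^{(k,\ell)}(0,y_1^{n-1},x_1^n,y_{n-k}^{n-1},G_\ell(x_{n-k}^n))>\tfrac12,\\1&\text{otherwise},\end{cases}\qquad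 n=1,2,\ldots$$ (when $n\le k+1$ the estimate is $1/2$, so the prediction is $1$). Losses of experts: for $a\le b$, $R_a^b(h^{(k,\ell)})=\frac1{b-a+1}\sum_{i=a}^bI_{\{h_i^{(k,\ell)}(y_1^{i-1},x_1^i)\neq y_i\}}$. The scheme $g$. For each integer $m\ge0$ and each $n$ with $2^m\le n<2^{m+1}$, $$g_n(y_1^{n-1},x_1^n,u)=\begin{cases}0&\text{if }u>\dfrac{\sum_{k,\ell\le2^{m+1}}h_n^{(k,\ell)}(y_1^{n-1},x_1^n)\,w_n(k,\ell)}{\sum_{k,\ell\le2^{m+1}}w_n(k,\ell)},\\1&\text{otherwise},\end{cases}$$ where the sums range over integers $1\le k,\ell\le 2^{m+1}$, $w_{2^m}(k,\ell)=1$ and $w_n(k,\ell)=e^{-\eta_m(n-2^m)R_{2^m}^{n-1}(h^{(k,\ell)})}$ for $2^m<n<2^{m+1}$, with $\eta_m=\sqrt{8\ln\left((2^{m+1})^2\right)/2^m}$. *)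

theory Defs
  imports "HOL-Probability.Probability"
begin

text \<open>The label set \<open>{0, 1}\<close> is the type \<^typ>\<open>bool\<close>, with \<^const>\<open>False\<close> for 0 and \<^const>\<open>True\<close>
  for 1. Finite strings are lists; positions in them are counted from 1, as in
  \<open>y\<^sub>1, \<dots>, y\<^sub>n\<close>.\<close>

text \<open>The library constant \<^const>\<open>diameter\<close> is real-valued and carries no information on unbounded
  sets, whereas a finite partition of Euclidean space always has an unbounded cell.\<close>

definition ediam :: "'a::real_normed_vector set \<Rightarrow> ennreal" where
  "ediam S = (SUP x\<in>S. SUP y\<in>S. ennreal (norm (x - y)))"

definition quantizer :: "(nat \<Rightarrow> nat \<Rightarrow> 'a set) \<Rightarrow> (nat \<Rightarrow> nat) \<Rightarrow> nat \<Rightarrow> 'a \<Rightarrow> nat" where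
  "quantizer A m l x = (THE j. j \<in> {1..m l} \<and> x \<in> A l j)"

definition segment :: "(nat \<Rightarrow> 'c) \<Rightarrow> nat \<Rightarrow> nat \<Rightarrow> 'c list" where
  "segment f a b = map f [a..<Suc b]"

definition letter :: "'c list \<Rightarrow> nat \<Rightarrow> 'c" where
  "letter w i = w ! (i - 1)"

definition substr :: "'c list \<Rightarrow> nat \<Rightarrow> nat \<Rightarrow> 'c list" where
  "substr w a b = segment (letter w) a b"

text \<open>In the following, \<open>G l\<close> is the quantizer of level \<open>l\<close>, and \<open>ys\<close>, \<open>xs\<close> are the strings
  \<open>y\<^sub>1, \<dots>, y\<^sub>n\<^sub>-\<^sub>1\<close> and \<open>x\<^sub>1, \<dots>, x\<^sub>n\<close>.\<close>

definition P_hat ::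
  "(nat \<Rightarrow> 'a \<Rightarrow> nat) \<Rightarrow> nat \<Rightarrow> nat \<Rightarrow> nat \<Rightarrow> bool \<Rightarrow> bool list \<Rightarrow> 'a list \<Rightarrow> bool list \<Rightarrow> nat list \<Rightarrow> real"
where
  "P_hat G k l n y ys xs s z =
    (if n \<le> k + 1 then 1/2
     else let D = {i. k < i \<and> i < n \<and> substr ys (i - k) (i - 1) = s
                      \<and> map (G l) (substr xs (i - k) i) = z}
          in if D = {} then 1/2
             else real (card {i\<in>D. letter ys i = y}) / real (card D))"

definition expert ::
  "(nat \<Rightarrow> 'a \<Rightarrow> nat) \<Rightarrow> nat \<Rightarrow> nat \<Rightarrow> nat \<Rightarrow> bool list \<Rightarrow> 'a list \<Rightarrow> bool"
where
  "expert G k l n ys xs =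
    (if P_hat G k l n False ys xs (substr ys (n - k) (n - 1)) (map (G l) (substr xs (n - k) n)) > 1/2
     then False else True)"

definition expert_loss ::
  "(nat \<Rightarrow> 'a \<Rightarrow> nat) \<Rightarrow> nat \<Rightarrow> nat \<Rightarrow> nat \<Rightarrow> nat \<Rightarrow> bool list \<Rightarrow> 'a list \<Rightarrow> real"
where
  "expert_loss G k l a b ys xs =
    (\<Sum>i=a..b. of_bool (expert G k l i (substr ys 1 (i - 1)) (substr xs 1 i) \<noteq> letter ys i))
      / (real b - real a + 1)"

definition eta :: "nat \<Rightarrow> real" where
  "eta m = sqrt (8 * ln ((2 ^ (m + 1))\<^sup>2) / 2 ^ m)"

definition weight ::
  "(nat \<Rightarrow> 'a \<Rightarrow> nat) \<Rightarrow> nat \<Rightarrow> nat \<Rightarrow> bool list \<Rightarrow> 'a list \<Rightarrow> nat \<Rightarrow> nat \<Rightarrow> real"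
where
  "weight G m n ys xs k l =
    (if n = 2 ^ m then 1
     else exp (- eta m * (real n - 2 ^ m) * expert_loss G k l (2 ^ m) (n - 1) ys xs))"

definition block :: "nat \<Rightarrow> nat" where
  "block n = (THE m. 2 ^ m \<le> n \<and> n < 2 ^ (m + 1))"

text \<open>A strategy maps \<open>n\<close>, \<open>y\<^sub>1, \<dots>, y\<^sub>n\<^sub>-\<^sub>1\<close>, \<open>x\<^sub>1, \<dots>, x\<^sub>n\<close> and the randomization \<open>u\<close> to a prediction
  of \<open>y\<^sub>n\<close>.\<close>

type_synonym 'a strategy = "nat \<Rightarrow> bool list \<Rightarrow> 'a list \<Rightarrow> real \<Rightarrow> bool"

definition scheme :: "(nat \<Rightarrow> 'a \<Rightarrow> nat) \<Rightarrow> 'a strategy" where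
  "scheme G n ys xs u =
    (let m = block n;
         K = {1..2 ^ (m + 1)} \<times> {1..2 ^ (m + 1)}
     in if u > (\<Sum>(k, l)\<in>K. of_bool (expert G k l n ys xs) * weight G m n ys xs k l)
                 / (\<Sum>(k, l)\<in>K. weight G m n ys xs k l)
        then False else True)"

definition average_loss ::
  "'a strategy \<Rightarrow> (nat \<Rightarrow> 'a) \<Rightarrow> (nat \<Rightarrow> bool) \<Rightarrow> (nat \<Rightarrow> real) \<Rightarrow> nat \<Rightarrow> real"
where
  "average_loss g x y u n =
    (\<Sum>i=1..n. of_bool (g i (segment y 1 (i - 1)) (segment x 1 i) (u i) \<noteq> y i)) / real n"

definition path_space :: "'b measure \<Rightarrow> (int \<Rightarrow> 'b) measure" where
  "path_space N = Pi\<^sub>M UNIV (\<lambda>_. N)"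

definition path_law :: "'w measure \<Rightarrow> 'b measure \<Rightarrow> (int \<Rightarrow> 'w \<Rightarrow> 'b) \<Rightarrow> (int \<Rightarrow> 'b) measure" where
  "path_law M N Z = distr M (path_space N) (\<lambda>\<omega> i. Z i \<omega>)"

definition shift :: "(int \<Rightarrow> 'b) \<Rightarrow> int \<Rightarrow> 'b" where
  "shift z = (\<lambda>i. z (i + 1))"

definition stationary_process :: "'w measure \<Rightarrow> 'b measure \<Rightarrow> (int \<Rightarrow> 'w \<Rightarrow> 'b) \<Rightarrow> bool" where
  "stationary_process M N Z \<longleftrightarrow>
    (\<forall>i. Z i \<in> measurable M N) \<and>
    distr (path_law M N Z) (path_space N) shift = path_law M N Z"

definition ergodic_process :: "'w measure \<Rightarrow> 'b measure \<Rightarrow> (int \<Rightarrow> 'w \<Rightarrow> 'b) \<Rightarrow> bool" where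
  "ergodic_process M N Z \<longleftrightarrow>
    (\<forall>B\<in>sets (path_space N). shift -` B \<inter> space (path_space N) = B \<longrightarrow>
       measure (path_law M N Z) B = 0 \<or> measure (path_law M N Z) B = 1)"

definition past_algebra ::
  "'w measure \<Rightarrow> (int \<Rightarrow> 'w \<Rightarrow> 'a::topological_space) \<Rightarrow> (int \<Rightarrow> 'w \<Rightarrow> bool) \<Rightarrow> 'w measure"
where
  "past_algebra M X Y =
    vimage_algebra (space M) (\<lambda>\<omega>. (\<lambda>i\<in>{..<0}. Y i \<omega>, \<lambda>i\<in>{..0}. X i \<omega>))
      (Pi\<^sub>M {..<0} (\<lambda>_. count_space UNIV) \<Otimes>\<^sub>M Pi\<^sub>M {..0} (\<lambda>_. borel))"

definition cond_prob_label ::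
  "'w measure \<Rightarrow> (int \<Rightarrow> 'w \<Rightarrow> 'a::topological_space) \<Rightarrow> (int \<Rightarrow> 'w \<Rightarrow> bool) \<Rightarrow> bool \<Rightarrow> 'w \<Rightarrow> real"
where
  "cond_prob_label M X Y b =
    real_cond_exp M (past_algebra M X Y) (indicator {\<omega>\<in>space M. Y 0 \<omega> = b})"

definition optimal_loss ::
  "'w measure \<Rightarrow> (int \<Rightarrow> 'w \<Rightarrow> 'a::topological_space) \<Rightarrow> (int \<Rightarrow> 'w \<Rightarrow> bool) \<Rightarrow> real"
where
  "optimal_loss M X Y =
    (\<integral>\<omega>. min (cond_prob_label M X Y True \<omega>) (cond_prob_label M X Y False \<omega>) \<partial>M)"

end

theory Submission
  imports Defs "HOL-Real_Asymp.Real_Asymp"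
begin

text \<open>
  Let \<open>\<F>\<^sub>i\<close> be the \<open>\<sigma>\<close>-algebra of the full past available when \<open>Y\<^sub>i\<close> is predicted, that is, of all
  labels before time \<open>i\<close> and all observations up to time \<open>i\<close>, and let
  \<open>p\<^sub>i = P(Y\<^sub>i = 1 | \<F>\<^sub>i)\<close> (\<open>label_prob\<close>, composed with the shift). A predictor that votes for label
  1 with an \<open>\<F>\<^sub>i\<close>-measurable weight \<open>v\<^sub>i\<close> has mixed loss
  \<open>\<bar>Y\<^sub>i - v\<^sub>i\<bar> = v\<^sub>i (1 - p\<^sub>i) + (1 - v\<^sub>i) p\<^sub>i + (1 - 2 v\<^sub>i) (Y\<^sub>i - p\<^sub>i)\<close>. The last term is
  uncorrelated over time and averages out almost surely (\<open>noise_average\<close>). The rest is at least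
  \<open>min p\<^sub>i (1 - p\<^sub>i)\<close>, whose averages tend to the optimal loss by the ergodic theorem
  (\<open>birkhoff_bounded\<close>). So no such predictor does better than the optimal loss.

  For the matching upper bound, the exponentially weighted vote does asymptotically as well as
  any fixed expert: the regret within the block \<open>2\<^sup>m \<le> n < 2\<^sup>m\<^sup>+\<^sup>1\<close> is at most of order
  \<open>sqrt (m 2\<^sup>m)\<close>, hence \<open>o(n)\<close> in total (\<open>regret_bound\<close>). An expert is a plug-in classifier: it
  thresholds at \<open>1/2\<close> an empirical estimate \<open>\<rho>\<^sub>i\<close> of the conditional probability of label 1 given
  the finite quantized context. Thresholding \<open>\<rho>\<^sub>i\<close> costs at most \<open>2 \<bar>p\<^sub>i - \<rho>\<^sub>i\<bar>\<close> over
  \<open>min p\<^sub>i (1 - p\<^sub>i)\<close>. By the ergodic theorem \<open>\<rho>\<^sub>i\<close> approaches the true conditional probability given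
  the context, so the average loss of the expert \<open>(k, l)\<close> is asymptotically at most the optimal loss
  plus twice the \<open>L\<^sup>1\<close> distance between the conditional probabilities given the context and given
  the full past (\<open>expert_average_upper\<close>). The comparison is made between estimates rather than
  decisions because the decisions of an expert may oscillate forever, even unfavourably, when the
  conditional probability given a context is exactly \<open>1/2\<close>. The nested
  partitions generate the Borel sets, so finite contexts approximate the past, and that distance is
  arbitrarily small for suitable \<open>(k, l)\<close> (\<open>cond_label_approx\<close>).

  Finally, given the path of the process, the randomized decisions are independent, and their
  average loss differs from the average mixed loss by a null sequence (\<open>randomization_average\<close>).
\<close>

section \<open>Averages of real sequences and of uncorrelated variables\<close>

lemma cesaro_null:
  fixes f :: "nat \<Rightarrow> real"
  assumes "f \<longlonglongrightarrow> 0"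
  shows "(\<lambda>n. (\<Sum>i=1..n. f i) / real n) \<longlonglongrightarrow> 0"
proof (rule LIMSEQ_I)
  fix e :: real assume e: "0 < e"
  obtain n0 where n0: "\<And>n. n \<ge> n0 \<Longrightarrow> \<bar>f n\<bar> < e / 2"
    using LIMSEQ_D[OF assms, of "e / 2"] e by auto
  define C where "C = (\<Sum>i\<le>n0. \<bar>f i\<bar>)"
  have bound: "\<bar>\<Sum>i=1..n. f i\<bar> \<le> C + real n * (e / 2)" for n
  proof -
    have "\<bar>\<Sum>i=1..n. f i\<bar> \<le> (\<Sum>i=1..n. \<bar>f i\<bar>)" by (rule sum_abs)
    also have "\<dots> \<le> (\<Sum>i=1..n. (if i \<le> n0 then \<bar>f i\<bar> else 0) + e / 2)"
    proof (rule sum_mono)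
      fix i show "\<bar>f i\<bar> \<le> (if i \<le> n0 then \<bar>f i\<bar> else 0) + e / 2"
        using n0[of i] e by auto
    qed
    also have "\<dots> = (\<Sum>i\<in>{1..n} \<inter> {..n0}. \<bar>f i\<bar>) + real n * (e / 2)"
      unfolding sum.distrib by (subst sum.inter_restrict) auto
    also have "(\<Sum>i\<in>{1..n} \<inter> {..n0}. \<bar>f i\<bar>) \<le> C"
      unfolding C_def by (rule sum_mono2) auto
    finally show ?thesis by simp
  qed
  obtain N :: nat where N: "2 * C / e < real N" using reals_Archimedean2 by blast
  show "\<exists>n0. \<forall>n\<ge>n0. norm ((\<Sum>i=1..n. f i) / real n - 0) < e"
  proof (intro exI[of _ "Suc N"] allI impI)
    fix n assume n: "Suc N \<le> n"
    then have "2 * C / e < real n" using N by linarith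
    then have "C < real n * (e / 2)" using e by (simp add: field_simps)
    then have "\<bar>\<Sum>i=1..n. f i\<bar> < real n * e" using bound[of n] by (simp add: field_simps)
    then show "norm ((\<Sum>i=1..n. f i) / real n - 0) < e"
      using n by (simp add: divide_less_eq mult.commute)
  qed
qed

text \<open>Only \<open>k + 1\<close> summands are missing from the shorter sum.\<close>

lemma average_inner_interval:
  fixes g :: "nat \<Rightarrow> real"
  assumes lim: "(\<lambda>n. (\<Sum>i=1..n. g i) / real n) \<longlonglongrightarrow> L" and bound: "\<And>i. \<bar>g i\<bar> \<le> 1"
  shows "(\<lambda>n. (\<Sum>i\<in>{k<..<n}. g i) / real n) \<longlonglongrightarrow> L"
proof -
  have "(\<lambda>n. (\<Sum>i\<in>{k<..<n}. g i) / real n - (\<Sum>i=1..n. g i) / real n) \<longlonglongrightarrow> 0"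
  proof (rule Lim_null_comparison)
    have "(\<lambda>n. real (Suc k) * (1 / real n)) \<longlonglongrightarrow> real (Suc k) * 0"
      by (intro tendsto_intros lim_1_over_n)
    then show "(\<lambda>n. real (Suc k) * (1 / real n)) \<longlonglongrightarrow> 0" by simp
    have "\<bar>(\<Sum>i\<in>{k<..<n}. g i) - (\<Sum>i=1..n. g i)\<bar> \<le> real (Suc k)" for n
    proof -
      have "(\<Sum>i=1..n. g i) = (\<Sum>i\<in>{1..n} - {k<..<n}. g i) + (\<Sum>i\<in>{k<..<n}. g i)"
        by (rule sum.subset_diff) auto
      moreover have "\<bar>\<Sum>i\<in>{1..n} - {k<..<n}. g i\<bar> \<le> (\<Sum>i\<in>{1..n} - {k<..<n}. 1)"
        using bound by (intro order_trans[OF sum_abs] sum_mono)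
      moreover have "card ({1..n} - {k<..<n}) \<le> card (insert n {1..k})"
        by (intro card_mono) auto
      moreover have "card (insert n {1..k}) \<le> Suc k" using card_insert_le_m1[of "Suc k" "{1..k}" n] by simp
      ultimately show ?thesis by simp
    qed
    then show "\<forall>\<^sub>F n in sequentially. norm ((\<Sum>i\<in>{k<..<n}. g i) / real n - (\<Sum>i=1..n. g i) / real n)
        \<le> real (Suc k) * (1 / real n)"
      by (intro always_eventually allI)
         (simp add: diff_divide_distrib[symmetric] abs_divide divide_right_mono del: of_nat_Suc)
  qed
  from tendsto_add[OF this lim] show ?thesis by simp
qed

text \<open>The \<open>n\<close>-th partial sum has second moment at most \<open>n\<close>, so the squared averages at the times
  \<open>r\<^sup>2\<close> have summable expectations and tend to 0 almost surely. Boundedness controls the sum between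
  consecutive squares.\<close>

lemma (in prob_space) uncorrelated_SLLN:
  fixes D :: "nat \<Rightarrow> 'a \<Rightarrow> real"
  assumes meas[measurable]: "\<And>i. D i \<in> borel_measurable M"
    and bound: "\<And>i \<omega>. \<bar>D i \<omega>\<bar> \<le> 1"
    and uncor: "\<And>i j. 1 \<le> i \<Longrightarrow> i < j \<Longrightarrow> expectation (\<lambda>\<omega>. D i \<omega> * D j \<omega>) = 0"
  shows "AE \<omega> in M. (\<lambda>n. (\<Sum>i=1..n. D i \<omega>) / real n) \<longlonglongrightarrow> 0"
proof -
  define S where "S n \<omega> = (\<Sum>i=1..n. D i \<omega>)" for n \<omega>
  have [measurable]: "S n \<in> borel_measurable M" for n unfolding S_def by measurable
  have absprod: "\<bar>D i \<omega> * D j \<omega>\<bar> \<le> 1" for i j \<omega>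
    using mult_mono[OF bound[of i \<omega>] bound[of j \<omega>]] by (simp add: abs_mult)
  have int: "integrable M (\<lambda>\<omega>. D i \<omega> * D j \<omega>)" for i j
    by (rule integrable_const_bound[of _ 1]) (use absprod in auto)
  have off: "expectation (\<lambda>\<omega>. D i \<omega> * D j \<omega>) \<le> (if i = j then 1 else 0)"
    if "i \<in> {1..n}" "j \<in> {1..n}" for i j n
  proof (cases "i = j")
    case True
    have "expectation (\<lambda>\<omega>. D i \<omega> * D j \<omega>) \<le> expectation (\<lambda>_. 1)"
      by (rule integral_mono[OF int]) (use absprod in \<open>auto simp: abs_le_iff\<close>)
    then show ?thesis using True by (simp add: prob_space)
  next
    case False
    then show ?thesis using uncor[of i j] uncor[of j i] that
      by (cases "i < j") (auto simp: mult.commute)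
  qed
  have second_moment: "expectation (\<lambda>\<omega>. (S n \<omega>)\<^sup>2) \<le> real n" for n
  proof -
    have "expectation (\<lambda>\<omega>. (S n \<omega>)\<^sup>2) = (\<Sum>i=1..n. \<Sum>j=1..n. expectation (\<lambda>\<omega>. D i \<omega> * D j \<omega>))"
      unfolding S_def power2_eq_square sum_product using int by simp
    also have "\<dots> \<le> (\<Sum>i=1..n. \<Sum>j=1..n. if i = j then 1 else 0)"
      by (intro sum_mono off)
    also have "\<dots> = real n" by (simp add: sum.delta)
    finally show ?thesis .
  qed
  have Sbound: "\<bar>S n \<omega>\<bar> \<le> real n" for n \<omega>
    unfolding S_def using sum_abs[of "\<lambda>i. D i \<omega>" "{1..n}"] sum_mono[of "{1..n}" "\<lambda>i. \<bar>D i \<omega>\<bar>" "\<lambda>_. 1"] bound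
    by (auto intro: order_trans)
  define Q where "Q n \<omega> = (S ((Suc n)\<^sup>2) \<omega> / real ((Suc n)\<^sup>2))\<^sup>2" for n \<omega>
  have [measurable]: "Q n \<in> borel_measurable M" for n unfolding Q_def by measurable
  have Q01: "0 \<le> Q n \<omega>" "Q n \<omega> \<le> 1" for n \<omega>
    unfolding Q_def using Sbound[of "(Suc n)\<^sup>2" \<omega>]
    by (auto simp: abs_square_le_1 abs_divide simp del: of_nat_power of_nat_Suc power2_eq_square)
  have Qint: "integrable M (Q n)" for n
    by (rule integrable_const_bound[of _ 1]) (use Q01 in auto)
  have EQ: "expectation (Q n) \<le> 1 / real ((Suc n)\<^sup>2)" for n
  proof -
    have "expectation (Q n) = expectation (\<lambda>\<omega>. (S ((Suc n)\<^sup>2) \<omega>)\<^sup>2) / (real ((Suc n)\<^sup>2))\<^sup>2"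
      unfolding Q_def power_divide by simp
    also have "\<dots> \<le> real ((Suc n)\<^sup>2) / (real ((Suc n)\<^sup>2))\<^sup>2"
      by (intro divide_right_mono second_moment) simp
    also have "\<dots> = 1 / real ((Suc n)\<^sup>2)"
      by (simp add: power2_eq_square del: of_nat_Suc of_nat_mult)
    finally show ?thesis .
  qed
  have summ: "summable (\<lambda>n. 1 / real ((Suc n)\<^sup>2))"
    using inverse_power_summable[of 2, where ?'a = real]
      summable_Suc_iff[of "\<lambda>n. inverse ((real n)\<^sup>2)"]
    by (simp add: inverse_eq_divide del: of_nat_Suc)
  have "(\<integral>\<^sup>+\<omega>. (\<Sum>n. ennreal (Q n \<omega>)) \<partial>M) = (\<Sum>n. \<integral>\<^sup>+\<omega>. ennreal (Q n \<omega>) \<partial>M)"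
    by (rule nn_integral_suminf) measurable
  also have "\<dots> = (\<Sum>n. ennreal (expectation (Q n)))"
    by (intro suminf_cong nn_integral_eq_integral Qint) (use Q01 in auto)
  also have "\<dots> \<le> (\<Sum>n. ennreal (1 / real ((Suc n)\<^sup>2)))"
    by (intro suminf_le ennreal_leI EQ) auto
  also have "\<dots> < \<infinity>"
    using summ by (subst suminf_ennreal2) auto
  finally have fin: "(\<integral>\<^sup>+\<omega>. (\<Sum>n. ennreal (Q n \<omega>)) \<partial>M) \<noteq> \<infinity>" by simp
  have "AE \<omega> in M. (\<Sum>n. ennreal (Q n \<omega>)) \<noteq> \<infinity>"
    by (rule nn_integral_PInf_AE[OF _ fin]) measurable
  then show ?thesis
  proof eventually_elim
    case (elim \<omega>)
    have "summable (\<lambda>n. Q n \<omega>)"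
      using elim Q01 by (intro summable_suminf_not_top) auto
    then have "(\<lambda>n. Q n \<omega>) \<longlonglongrightarrow> 0" by (rule summable_LIMSEQ_zero)
    then have "(\<lambda>n. sqrt (Q n \<omega>)) \<longlonglongrightarrow> 0" by (metis tendsto_real_sqrt real_sqrt_zero)
    then have "(\<lambda>n. \<bar>S ((Suc n)\<^sup>2) \<omega>\<bar> / real ((Suc n)\<^sup>2)) \<longlonglongrightarrow> 0"
      unfolding Q_def by (simp del: of_nat_power of_nat_Suc)
    then have sq: "(\<lambda>r. \<bar>S (r\<^sup>2) \<omega>\<bar> / real (r\<^sup>2)) \<longlonglongrightarrow> 0"
      by (rule LIMSEQ_imp_Suc)
    \<comment> \<open>Compare the average at time \<open>n\<close> with the one at the largest square below \<open>n\<close>.\<close>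
    define r where "r n = nat \<lfloor>sqrt (real n)\<rfloor>" for n
    have r_top: "filterlim r at_top at_top"
      unfolding r_def
      by (intro filterlim_compose[OF filterlim_nat_sequentially]
          filterlim_compose[OF filterlim_floor_sequentially]
          filterlim_compose[OF sqrt_at_top] filterlim_real_sequentially)
    have "(\<lambda>n. 2 / real (r n)) \<longlonglongrightarrow> 0"
      by (rule real_tendsto_divide_at_top[OF tendsto_const])
         (rule filterlim_compose[OF filterlim_real_sequentially r_top])
    then have lim: "(\<lambda>n. \<bar>S ((r n)\<^sup>2) \<omega>\<bar> / real ((r n)\<^sup>2) + 2 / real (r n)) \<longlonglongrightarrow> 0"
      using tendsto_add[OF filterlim_compose[OF sq r_top]] by fastforce
    have "(\<lambda>n. S n \<omega> / real n) \<longlonglongrightarrow> 0"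
    proof (rule Lim_null_comparison[OF _ lim])
      show "\<forall>\<^sub>F n in sequentially. norm (S n \<omega> / real n)
          \<le> \<bar>S ((r n)\<^sup>2) \<omega>\<bar> / real ((r n)\<^sup>2) + 2 / real (r n)"
      proof (rule eventually_sequentiallyI[of 1])
        fix n :: nat assume n: "1 \<le> n"
        have r1: "r n \<ge> 1" using n unfolding r_def by (simp add: le_nat_floor)
        have "real (r n) \<le> sqrt (real n)" unfolding r_def by simp
        then have "(real (r n))\<^sup>2 \<le> real n"
          using power_mono[of "real (r n)" "sqrt (real n)" 2] by simp
        then have r_le: "(r n)\<^sup>2 \<le> n" by (metis of_nat_le_iff of_nat_power)
        have "sqrt (real n) < real (r n) + 1" unfolding r_def by linarith
        then have "real n < (real (r n) + 1)\<^sup>2"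
          using power_strict_mono[of "sqrt (real n)" "real (r n) + 1" 2] by simp
        then have gap: "real n - real ((r n)\<^sup>2) \<le> 2 * real (r n)"
        proof -
          have "real n < real ((r n + 1)\<^sup>2)" using \<open>real n < _\<close> by (simp add: add.commute)
          then have "n < (r n + 1)\<^sup>2" by linarith
          then have "n \<le> (r n)\<^sup>2 + 2 * r n" by (simp add: power2_eq_square)
          then have "real n \<le> real ((r n)\<^sup>2 + 2 * r n)" by (rule of_nat_mono)
          then show ?thesis by simp
        qed
        have "S n \<omega> = S ((r n)\<^sup>2) \<omega> + (\<Sum>i\<in>{(r n)\<^sup>2 <.. n}. D i \<omega>)"
          unfolding S_def using r_le
          by (subst sum.union_disjoint[symmetric]) (auto intro!: sum.cong)
        moreover have "\<bar>\<Sum>i\<in>{(r n)\<^sup>2 <.. n}. D i \<omega>\<bar> \<le> real (n - (r n)\<^sup>2)"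
          using sum_mono[of "{(r n)\<^sup>2 <.. n}" "\<lambda>i. \<bar>D i \<omega>\<bar>" "\<lambda>_. 1"] bound
          by (intro order_trans[OF sum_abs]) auto
        ultimately have "\<bar>S n \<omega>\<bar> \<le> \<bar>S ((r n)\<^sup>2) \<omega>\<bar> + 2 * real (r n)"
          using gap r_le by (auto simp: of_nat_diff)
        then have "\<bar>S n \<omega>\<bar> / real n \<le> (\<bar>S ((r n)\<^sup>2) \<omega>\<bar> + 2 * real (r n)) / real ((r n)\<^sup>2)"
          using r_le r1 by (intro frac_le) (auto simp del: of_nat_power)
        also have "\<dots> = \<bar>S ((r n)\<^sup>2) \<omega>\<bar> / real ((r n)\<^sup>2) + 2 / real (r n)"
          using r1 by (simp add: add_divide_distrib power2_eq_square)
        finally show "norm (S n \<omega> / real n) \<le> \<dots>" by (simp add: abs_divide)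
      qed
    qed
    then show ?case unfolding S_def .
  qed
qed

section \<open>The ergodic theorem for bounded functions\<close>

text \<open>Ergodicity is demanded of strictly invariant sets only, as in the definition of an ergodic
  process.\<close>

locale ergodic_system = prob_space +
  fixes T :: "'a \<Rightarrow> 'a"
  assumes T_meas [measurable]: "T \<in> measurable M M"
    and T_pres: "distr M M T = M"
    and T_ergodic: "\<And>B. B \<in> sets M \<Longrightarrow> T -` B \<inter> space M = B \<Longrightarrow> prob B = 0 \<or> prob B = 1"
begin

lemma funpow_measurable [measurable]: "(T ^^ i) \<in> measurable M M"
  by (induction i) auto

lemma integral_shift:
  fixes f :: "'a \<Rightarrow> real"
  assumes [measurable]: "f \<in> borel_measurable M"
  shows "expectation (\<lambda>x. f (T x)) = expectation f"
  using integral_distr[OF T_meas, of f] T_pres by simp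

lemma integral_funpow_shift:
  fixes f :: "'a \<Rightarrow> real"
  assumes [measurable]: "f \<in> borel_measurable M"
  shows "expectation (\<lambda>x. f ((T ^^ n) x)) = expectation f"
proof (induction n)
  case (Suc n)
  have "expectation (\<lambda>x. f ((T ^^ n) (T x))) = expectation (\<lambda>x. f ((T ^^ n) x))"
    by (rule integral_shift) measurable
  then show ?case using Suc by (simp add: funpow_swap1)
qed simp

lemma AE_funpow:
  assumes "AE x in M. Q x"
  shows "AE x in M. Q ((T ^^ n) x)"
proof (induction n)
  case (Suc n)
  have "AE x in distr M M T. Q ((T ^^ n) x)" unfolding T_pres by (rule Suc.IH)
  from AE_distrD[OF T_meas this] show ?case by (simp add: funpow_swap1)
qed (use assms in simp)

definition birkhoff_sum :: "('a \<Rightarrow> real) \<Rightarrow> nat \<Rightarrow> 'a \<Rightarrow> real" where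
  "birkhoff_sum f n x = (\<Sum>i<n. f ((T ^^ i) x))"

lemma birkhoff_sum_Suc: "birkhoff_sum f (Suc n) x = f x + birkhoff_sum f n (T x)"
  unfolding birkhoff_sum_def by (subst sum.lessThan_Suc_shift) (simp add: funpow_swap1)

lemma birkhoff_sum_measurable [measurable]:
  "f \<in> borel_measurable M \<Longrightarrow> birkhoff_sum f n \<in> borel_measurable M"
  unfolding birkhoff_sum_def
  by (intro borel_measurable_sum measurable_compose[OF funpow_measurable])

text \<open>The maximum of \<open>0\<close> and the first \<open>n\<close> Birkhoff sums. The recursion replaces the maximum over a
  set of indices, so that every property follows by induction.\<close>

fun max_sum :: "('a \<Rightarrow> real) \<Rightarrow> nat \<Rightarrow> 'a \<Rightarrow> real" where
  "max_sum f 0 x = 0"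
| "max_sum f (Suc n) x = max 0 (f x + max_sum f n (T x))"

lemma max_sum_measurable [measurable]:
  assumes [measurable]: "f \<in> borel_measurable M"
  shows "max_sum f n \<in> borel_measurable M"
proof (induction n)
  case (Suc n)
  note Suc [measurable]
  have "max_sum f (Suc n) = (\<lambda>x. max 0 (f x + max_sum f n (T x)))" by auto
  then show ?case by simp
next
  case 0
  have "max_sum f 0 = (\<lambda>x. 0)" by auto
  then show ?case by simp
qed

lemma max_sum_nonneg: "0 \<le> max_sum f n x" by (cases n) auto

lemma max_sum_mono: "max_sum f n x \<le> max_sum f (Suc n) x"
proof (induction n arbitrary: x)
  case (Suc n)
  from Suc[of "T x"] show ?case by auto
qed simp

lemma max_sum_bound: "(\<And>x. \<bar>f x\<bar> \<le> C) \<Longrightarrow> \<bar>max_sum f n x\<bar> \<le> real n * C"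
proof (induction n arbitrary: x)
  case (Suc n)
  have "\<bar>max_sum f n (T x)\<bar> \<le> real n * C" by (rule Suc.IH[OF Suc.prems])
  moreover have "real (Suc n) * C = C + real n * C" by (simp add: algebra_simps)
  ultimately show ?case using Suc.prems[of x] by (auto simp: max_def)
qed simp

lemma birkhoff_sum_le_max_sum: "birkhoff_sum f n x \<le> max_sum f n x"
proof (induction n arbitrary: x)
  case (Suc n)
  from Suc[of "T x"] show ?case by (simp add: birkhoff_sum_Suc)
qed (simp add: birkhoff_sum_def)

text \<open>Where the running maximum \<open>F\<close> is positive, the recursion gives \<open>f \<ge> F - F \<circ> T\<close>; elsewhere
  \<open>F - F \<circ> T \<le> 0\<close>. The integral of \<open>F - F \<circ> T\<close> vanishes since \<open>T\<close> preserves the measure.\<close>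

lemma maximal_ergodic:
  assumes [measurable]: "f \<in> borel_measurable M" and bound: "\<And>x. \<bar>f x\<bar> \<le> C"
  shows "0 \<le> expectation (\<lambda>x. f x * indicator {x. max_sum f n x > 0} x)"
proof (cases n)
  case (Suc k)
  have int: "integrable M (max_sum f n)"
    by (rule integrable_const_bound[of _ "real n * C"]) (use max_sum_bound[OF bound] in auto)
  have intT: "integrable M (\<lambda>x. max_sum f n (T x))"
    by (rule integrable_const_bound[of _ "real n * C"]) (use max_sum_bound[OF bound] in auto)
  have "0 = expectation (\<lambda>x. max_sum f n x - max_sum f n (T x))"
    using int intT integral_shift[of "max_sum f n"] by simp
  also have "\<dots> \<le> expectation (\<lambda>x. f x * indicator {x. max_sum f n x > 0} x)"
  proof (rule integral_mono)
    show "integrable M (\<lambda>x. max_sum f n x - max_sum f n (T x))" using int intT by simp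
    show "integrable M (\<lambda>x. f x * indicator {x. max_sum f n x > 0} x)"
      by (rule integrable_const_bound[of _ C])
         (use bound order_trans[OF abs_ge_zero bound] in \<open>auto simp: abs_mult indicator_def\<close>)
    show "max_sum f n x - max_sum f n (T x) \<le> f x * indicator {x. max_sum f n x > 0} x" for x
      using max_sum_mono[of f k "T x"] max_sum_nonneg[of f n "T x"] Suc
      by (auto simp: indicator_def max_def split: if_splits)
  qed
  finally show ?thesis .
qed simp

text \<open>The set of points with sums unbounded above is invariant because \<open>f\<close> is bounded. If it had
  full measure, the sets in the maximal inequality would exhaust the space, and \<open>f\<close> would have
  nonnegative integral.\<close>

lemma birkhoff_sum_bdd_above:
  assumes [measurable]: "f \<in> borel_measurable M" and bound: "\<And>x. \<bar>f x\<bar> \<le> C"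
    and neg: "expectation f < 0"
  shows "AE x in M. \<exists>N::nat. \<forall>n. birkhoff_sum f n x \<le> real N"
proof -
  define E where "E = {x\<in>space M. \<forall>N::nat. \<exists>n. birkhoff_sum f n x > real N}"
  have E_sets [measurable]: "E \<in> sets M" unfolding E_def by measurable
  have "T -` E \<inter> space M = E"
  proof (intro set_eqI iffI)
    fix x assume x: "x \<in> T -` E \<inter> space M"
    have "\<exists>n. birkhoff_sum f n x > real N" for N :: nat
    proof -
      obtain n where "birkhoff_sum f n (T x) > real (N + nat \<lceil>C\<rceil>)" using x unfolding E_def by blast
      then show ?thesis using bound[of x]
        by (intro exI[of _ "Suc n"]) (simp add: birkhoff_sum_Suc, linarith)
    qed
    then show "x \<in> E" using x unfolding E_def by auto
  next
    fix x assume x: "x \<in> E"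
    have "\<exists>n. birkhoff_sum f n (T x) > real N" for N :: nat
    proof -
      obtain n where n: "birkhoff_sum f n x > real (N + nat \<lceil>C\<rceil>)" using x unfolding E_def by blast
      then obtain k where "n = Suc k" by (cases n) (auto simp: birkhoff_sum_def)
      then show ?thesis using n bound[of x]
        by (intro exI[of _ k]) (simp add: birkhoff_sum_Suc, linarith)
    qed
    then show "x \<in> T -` E \<inter> space M" using x measurable_space[OF T_meas] unfolding E_def by auto
  qed
  then have "prob E = 0 \<or> prob E = 1" by (rule T_ergodic[OF E_sets])
  moreover have "prob E \<noteq> 1"
  proof
    assume "prob E = 1"
    then have "AE x in M. x \<in> E" by (simp add: prob_eq_1)
    then have pos: "AE x in M. \<exists>n. max_sum f n x > 0"
    proof eventually_elim
      case (elim x)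
      then obtain n where "birkhoff_sum f n x > real 0" unfolding E_def by blast
      then show ?case using birkhoff_sum_le_max_sum[of f n x] by (auto intro!: exI[of _ n])
    qed
    have "(\<lambda>n. expectation (\<lambda>x. f x * indicator {x. max_sum f n x > 0} x)) \<longlonglongrightarrow> expectation f"
    proof (rule integral_dominated_convergence[where w = "\<lambda>_. C"])
      show "AE x in M. (\<lambda>n. f x * indicator {x. max_sum f n x > 0} x) \<longlonglongrightarrow> f x"
        using pos
      proof eventually_elim
        case (elim x)
        then obtain n where n: "max_sum f n x > 0" by blast
        have "max_sum f n x \<le> max_sum f k x" if "n \<le> k" for k
          using that by (induction rule: dec_induct) (blast intro: order_trans[OF _ max_sum_mono])+
        then have "\<forall>\<^sub>F k in sequentially. f x * indicator {x. max_sum f k x > 0} x = f x"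
          using n by (intro eventually_sequentiallyI[of n]) (fastforce simp: indicator_def)
        then show ?case by (rule tendsto_eventually)
      qed
      show "AE x in M. norm (f x * indicator {x. max_sum f n x > 0} x) \<le> C" for n
        using bound order_trans[OF abs_ge_zero bound] by (auto simp: abs_mult indicator_def)
    qed auto
    then have "0 \<le> expectation f"
      by (rule LIMSEQ_le_const) (use maximal_ergodic[OF assms(1) bound] in auto)
    then show False using neg by simp
  qed
  ultimately have "prob E = 0" by simp
  then have "AE x in M. x \<notin> E" by (simp add: prob_eq_0)
  then show ?thesis
    by (rule AE_mp) (auto intro!: AE_I2 simp: E_def not_less)
qed

text \<open>For \<open>\<epsilon> > 0\<close> the functions \<open>f - E f - \<epsilon>\<close> and \<open>E f - f - \<epsilon>\<close> have negative integral, so their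
  sums are bounded above; hence the averages of \<open>f\<close> are eventually within \<open>2 \<epsilon>\<close> of \<open>E f\<close>.\<close>

theorem birkhoff_bounded:
  assumes [measurable]: "f \<in> borel_measurable M" and bound: "\<And>x. \<bar>f x\<bar> \<le> C"
  shows "AE x in M. (\<lambda>n. (\<Sum>i=1..n. f ((T ^^ i) x)) / real n) \<longlonglongrightarrow> expectation f"
proof -
  have int: "integrable M f"
    by (rule integrable_const_bound[of _ C]) (use bound in auto)
  define e where "e j = 1 / real (Suc j)" for j
  have up: "AE x in M. \<forall>j. \<exists>N::nat. \<forall>n. birkhoff_sum (\<lambda>x. s * (f x - expectation f) - e j) n x \<le> real N"
    if s: "s = 1 \<or> s = - 1" for s :: real
  proof (subst AE_all_countable, rule allI)
    fix j
    show "AE x in M. \<exists>N::nat. \<forall>n. birkhoff_sum (\<lambda>x. s * (f x - expectation f) - e j) n x \<le> real N"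
    proof (rule birkhoff_sum_bdd_above[where C = "C + \<bar>expectation f\<bar> + e j"])
      show "\<bar>s * (f x - expectation f) - e j\<bar> \<le> C + \<bar>expectation f\<bar> + e j" for x
      proof -
        have "0 \<le> e j" by (simp add: e_def)
        then show ?thesis using s bound[of x] by auto
      qed
      show "expectation (\<lambda>x. s * (f x - expectation f) - e j) < 0"
        using int by (simp add: prob_space e_def)
    qed simp
  qed
  show ?thesis
    using up[OF disjI1[OF refl]] up[OF disjI2[OF refl]]
  proof eventually_elim
    case (elim x)
    have sum_eq: "birkhoff_sum (\<lambda>x. s * (f x - expectation f) - e j) n x
        = s * (birkhoff_sum f n x - real n * expectation f) - real n * e j" for s j n
      unfolding birkhoff_sum_def by (simp add: sum_subtractf sum_distrib_left algebra_simps)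
    show ?case
    proof (rule LIMSEQ_I)
      fix \<epsilon> :: real assume \<epsilon>: "0 < \<epsilon>"
      obtain j where j: "e j < \<epsilon> / 2"
        using reals_Archimedean[of "\<epsilon> / 2"] \<epsilon> by (auto simp: e_def inverse_eq_divide)
      obtain N1 :: nat where N1: "\<And>n. 1 * (birkhoff_sum f n x - real n * expectation f) - real n * e j \<le> real N1"
        using elim(1) unfolding sum_eq by blast
      obtain N2 :: nat where N2: "\<And>n. (-1) * (birkhoff_sum f n x - real n * expectation f) - real n * e j \<le> real N2"
        using elim(2) unfolding sum_eq by blast
      \<comment> \<open>The sum from \<open>1\<close> to \<open>n\<close> differs from the Birkhoff sum over \<open>{..<n}\<close> in two summands.\<close>
      define K where "K = real (N1 + N2) + 2 * C"
      have shift: "(\<Sum>i=1..n. f ((T ^^ i) x)) = birkhoff_sum f n x + f ((T ^^ n) x) - f x" for n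
        by (induction n) (auto simp: birkhoff_sum_def)
      have *: "\<bar>(\<Sum>i=1..n. f ((T ^^ i) x)) - real n * expectation f\<bar> \<le> K + real n * e j" for n
        unfolding shift K_def using N1[of n] N2[of n] bound[of x] bound[of "(T ^^ n) x"] by auto
      obtain n0 :: nat where n0: "2 * K / \<epsilon> < real n0" using reals_Archimedean2 by blast
      show "\<exists>n0. \<forall>n\<ge>n0. norm ((\<Sum>i=1..n. f ((T ^^ i) x)) / real n - expectation f) < \<epsilon>"
      proof (intro exI[of _ "Suc n0"] allI impI)
        fix n assume n: "Suc n0 \<le> n"
        have "2 * K / \<epsilon> < real n" using n0 n by linarith
        then have "K < real n * (\<epsilon> / 2)" using \<epsilon> by (simp add: field_simps)
        moreover have "real n * e j < real n * (\<epsilon> / 2)" using j n by simp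
        ultimately have "\<bar>(\<Sum>i=1..n. f ((T ^^ i) x)) - real n * expectation f\<bar> < real n * \<epsilon>"
          using *[of n] by (simp add: field_simps)
        moreover have "(\<Sum>i=1..n. f ((T ^^ i) x)) / real n - expectation f
            = ((\<Sum>i=1..n. f ((T ^^ i) x)) - real n * expectation f) / real n"
          using n by (simp add: diff_divide_distrib)
        ultimately show "norm ((\<Sum>i=1..n. f ((T ^^ i) x)) / real n - expectation f) < \<epsilon>"
          using n by (simp add: abs_divide divide_less_eq mult.commute)
      qed
    qed
  qed
qed

end

section \<open>Exponential weights\<close>

text \<open>The derivative of the difference is \<open>exp (- t) - (1 - t) \<ge> 0\<close>.\<close>

lemma exp_neg_le_quadratic:
  fixes x :: real
  assumes "0 \<le> x"
  shows "exp (- x) \<le> 1 - x + x\<^sup>2 / 2"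
proof -
  let ?f = "\<lambda>x::real. 1 - x + x\<^sup>2 / 2 - exp (- x)"
  have "?f 0 \<le> ?f x"
  proof (rule DERIV_nonneg_imp_nondecreasing[OF assms])
    fix t :: real assume "0 \<le> t" "t \<le> x"
    have "(?f has_real_derivative (- 1 + t + exp (- t))) (at t)"
      by (auto intro!: derivative_eq_intros)
    moreover have "0 \<le> - 1 + t + exp (- t)" using exp_ge_add_one_self[of "- t"] by simp
    ultimately show "\<exists>y. (?f has_real_derivative y) (at t) \<and> y \<ge> 0" by blast
  qed
  then show ?thesis by simp
qed

text \<open>The total weight shrinks at each step by a factor of at most \<open>exp (- \<eta> L + \<eta>\<^sup>2 / 2)\<close>, where
  \<open>L\<close> is the mixture loss, while it never falls below the weight of the single expert \<open>k\<close>.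
  Compare logarithms. The constant \<open>1/2\<close> in front of \<open>\<eta>\<close> is not optimal, but the order is.\<close>

lemma exponential_weights_regret:
  fixes loss :: "'k \<Rightarrow> nat \<Rightarrow> real" and \<eta> :: real and a n :: nat
  defines "w i k \<equiv> exp (- \<eta> * (\<Sum>j=a..<i. loss k j))"
  assumes fin: "finite K" and k: "k \<in> K" and \<eta>: "\<eta> > 0"
    and loss: "\<And>k i. 0 \<le> loss k i" "\<And>k i. loss k i \<le> 1"
  shows "(\<Sum>i=a..<a+n. (\<Sum>k\<in>K. w i k * loss k i) / (\<Sum>k\<in>K. w i k))
    \<le> (\<Sum>i=a..<a+n. loss k i) + ln (real (card K)) / \<eta> + real n * \<eta> / 2"
proof -
  define W where "W i = (\<Sum>k\<in>K. w i k)" for i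
  define L where "L i = (\<Sum>k\<in>K. w i k * loss k i) / W i" for i
  have wpos: "w i k > 0" for i k unfolding w_def by simp
  have Wpos: "W i > 0" for i unfolding W_def using wpos k fin by (intro sum_pos) auto
  have step: "W (Suc i) \<le> W i * exp (- \<eta> * L i + \<eta>\<^sup>2 / 2)" if "a \<le> i" for i
  proof -
    have "W (Suc i) = (\<Sum>k\<in>K. w i k * exp (- (\<eta> * loss k i)))"
      unfolding W_def w_def using that by (simp add: algebra_simps exp_diff exp_minus exp_add field_simps)
    also have "\<dots> \<le> (\<Sum>k\<in>K. w i k * (1 - \<eta> * loss k i + \<eta>\<^sup>2 / 2))"
    proof (intro sum_mono mult_left_mono)
      fix k
      have "exp (- (\<eta> * loss k i)) \<le> 1 - \<eta> * loss k i + (\<eta> * loss k i)\<^sup>2 / 2"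
        using \<eta> loss by (intro exp_neg_le_quadratic) simp
      also have "(\<eta> * loss k i)\<^sup>2 \<le> \<eta>\<^sup>2"
        using \<eta> loss[of k i] by (intro power_mono) (auto intro: mult_left_le)
      finally show "exp (- (\<eta> * loss k i)) \<le> 1 - \<eta> * loss k i + \<eta>\<^sup>2 / 2" by simp
    qed (use wpos in \<open>auto intro: less_imp_le\<close>)
    also have "\<dots> = W i * (1 + (- \<eta> * L i + \<eta>\<^sup>2 / 2))"
    proof -
      have "W i * L i = (\<Sum>k\<in>K. w i k * loss k i)" using Wpos[of i] unfolding L_def by simp
      then have "W i * (1 + (- \<eta> * L i + \<eta>\<^sup>2 / 2))
          = W i - \<eta> * (\<Sum>k\<in>K. w i k * loss k i) + W i * (\<eta>\<^sup>2 / 2)"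
        by (simp add: algebra_simps)
      also have "\<dots> = (\<Sum>k\<in>K. w i k * (1 - \<eta> * loss k i + \<eta>\<^sup>2 / 2))"
        unfolding W_def sum_distrib_left sum_distrib_right sum_subtractf[symmetric] sum.distrib[symmetric]
        by (intro sum.cong refl) (simp add: algebra_simps)
      finally show ?thesis by simp
    qed
    also have "\<dots> \<le> W i * exp (- \<eta> * L i + \<eta>\<^sup>2 / 2)"
      using Wpos[of i] exp_ge_add_one_self by (intro mult_left_mono) auto
    finally show ?thesis .
  qed
  have "W (a + n) \<le> real (card K) * exp (- \<eta> * (\<Sum>i=a..<a+n. L i) + real n * \<eta>\<^sup>2 / 2)"
  proof (induction n)
    case 0
    show ?case by (simp add: W_def w_def)
  next
    case (Suc n)
    have "W (a + Suc n) \<le> W (a + n) * exp (- \<eta> * L (a + n) + \<eta>\<^sup>2 / 2)"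
      using step[of "a + n"] by simp
    also have "\<dots> \<le> real (card K) * exp (- \<eta> * (\<Sum>i=a..<a+n. L i) + real n * \<eta>\<^sup>2 / 2)
        * exp (- \<eta> * L (a + n) + \<eta>\<^sup>2 / 2)"
      using Suc by (intro mult_right_mono) auto
    also have "\<dots> = real (card K) * exp (- \<eta> * (\<Sum>i=a..<a+Suc n. L i) + real (Suc n) * \<eta>\<^sup>2 / 2)"
      by (simp add: exp_add[symmetric] mult.assoc algebra_simps add_divide_distrib)
    finally show ?case .
  qed
  moreover have "w (a + n) k \<le> W (a + n)"
    unfolding W_def using fin k wpos by (intro member_le_sum) (auto intro: less_imp_le)
  ultimately have "exp (- \<eta> * (\<Sum>i=a..<a+n. loss k i))
      \<le> real (card K) * exp (- \<eta> * (\<Sum>i=a..<a+n. L i) + real n * \<eta>\<^sup>2 / 2)"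
    unfolding w_def by linarith
  moreover have cK: "real (card K) > 0" using fin k by (auto simp: card_gt_0_iff)
  ultimately have "- \<eta> * (\<Sum>i=a..<a+n. loss k i)
      \<le> ln (real (card K)) + (- \<eta> * (\<Sum>i=a..<a+n. L i) + real n * \<eta>\<^sup>2 / 2)"
    by (metis exp_gt_zero exp_ln exp_add exp_le_cancel_iff)
  then have "\<eta> * (\<Sum>i=a..<a+n. L i) \<le> \<eta> * ((\<Sum>i=a..<a+n. loss k i) + ln (real (card K)) / \<eta> + real n * \<eta> / 2)"
    using \<eta> by (simp add: algebra_simps power2_eq_square)
  then show ?thesis using \<eta> unfolding L_def W_def by simp
qed

section \<open>Experts and scheme along a pair of infinite sequences\<close>

lemma letter_segment: "1 \<le> i \<Longrightarrow> i \<le> n \<Longrightarrow> letter (segment f 1 n) i = f i"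
  unfolding letter_def segment_def by (simp add: nth_map_upt del: upt_Suc)

lemma segment_cong: "(\<And>i. a \<le> i \<Longrightarrow> i \<le> b \<Longrightarrow> f i = g i) \<Longrightarrow> segment f a b = segment g a b"
  unfolding segment_def by auto

lemma substr_segment: "1 \<le> a \<Longrightarrow> b \<le> n \<Longrightarrow> substr (segment f 1 n) a b = segment f a b"
  unfolding substr_def by (intro segment_cong letter_segment) auto

lemma block_eq: "2 ^ m \<le> n \<Longrightarrow> n < 2 ^ (m + 1) \<Longrightarrow> block n = m"
proof -
  assume *: "2 ^ m \<le> n" "n < 2 ^ (m + 1)"
  show ?thesis unfolding block_def
  proof (rule the_equality)
    fix m' assume m': "2 ^ m' \<le> n \<and> n < 2 ^ (m' + 1)"
    have "(2::nat) ^ m < 2 ^ (m' + 1)" "(2::nat) ^ m' < 2 ^ (m + 1)" using * m' by linarith+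
    then have "m < m' + 1" "m' < m + 1"
      using power_less_imp_less_exp[of "2::nat" m "m' + 1"] power_less_imp_less_exp[of "2::nat" m' "m + 1"]
      by linarith+
    then show "m' = m" by simp
  qed (use * in simp)
qed

text \<open>The strategies are defined on strings. The following constants evaluate them along infinite
  sequences, where the strings at different times are segments of the same sequence.\<close>

definition expert_seq :: "(nat \<Rightarrow> 'a \<Rightarrow> nat) \<Rightarrow> nat \<Rightarrow> nat \<Rightarrow> (nat \<Rightarrow> 'a) \<Rightarrow> (nat \<Rightarrow> bool) \<Rightarrow> nat \<Rightarrow> bool" where
  "expert_seq G k l x y n = expert G k l n (segment y 1 (n - 1)) (segment x 1 n)"

definition expert_err :: "(nat \<Rightarrow> 'a \<Rightarrow> nat) \<Rightarrow> (nat \<Rightarrow> 'a) \<Rightarrow> (nat \<Rightarrow> bool) \<Rightarrow> nat \<times> nat \<Rightarrow> nat \<Rightarrow> real" where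
  "expert_err G x y = (\<lambda>(k, l) n. of_bool (expert_seq G k l x y n \<noteq> y n))"

text \<open>The threshold below which the randomizing variable makes the scheme predict label 1.\<close>

definition vote :: "(nat \<Rightarrow> 'a \<Rightarrow> nat) \<Rightarrow> (nat \<Rightarrow> 'a) \<Rightarrow> (nat \<Rightarrow> bool) \<Rightarrow> nat \<Rightarrow> real" where
  "vote G x y n =
    (let m = block n; K = {1..2 ^ (m + 1)} \<times> {1..2 ^ (m + 1)};
         w = (\<lambda>(k, l). weight G m n (segment y 1 (n - 1)) (segment x 1 n) k l)
     in (\<Sum>(k, l)\<in>K. of_bool (expert_seq G k l x y n) * w (k, l)) / (\<Sum>kl\<in>K. w kl))"

lemma scheme_eq_vote:
  "scheme G n (segment y 1 (n - 1)) (segment x 1 n) u \<longleftrightarrow> u \<le> vote G x y n"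
  unfolding scheme_def vote_def expert_seq_def by (auto simp: Let_def not_less)

text \<open>The probability that the randomized prediction of \<open>y n\<close> is wrong.\<close>

definition mixed_loss :: "(nat \<Rightarrow> 'a \<Rightarrow> nat) \<Rightarrow> (nat \<Rightarrow> 'a) \<Rightarrow> (nat \<Rightarrow> bool) \<Rightarrow> nat \<Rightarrow> real" where
  "mixed_loss G x y n = \<bar>of_bool (y n) - vote G x y n\<bar>"

text \<open>The normalization of the average loss of the expert cancels, which leaves the exponent of the
  standard exponentially weighted forecaster restarted at time \<open>2\<^sup>m\<close>.\<close>

lemma weight_eq_exp:
  assumes "2 ^ m \<le> n"
  shows "weight G m n (segment y 1 (n - 1)) (segment x 1 n) k l
    = exp (- eta m * (\<Sum>j=2^m..<n. expert_err G x y (k, l) j))"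
proof (cases "n = 2 ^ m")
  case False
  then have n: "2 ^ m < n" using assms by simp
  have pos: "(1::nat) \<le> 2 ^ m" by simp
  have "(\<Sum>i=2^m..n-1. of_bool (expert G k l i (substr (segment y 1 (n - 1)) 1 (i - 1))
         (substr (segment x 1 n) 1 i) \<noteq> letter (segment y 1 (n - 1)) i))
      = (\<Sum>j=2^m..n-1. expert_err G x y (k, l) j)"
  proof (rule sum.cong[OF refl])
    fix i assume "i \<in> {2^m..n-1}"
    then have i: "1 \<le> i" "i \<le> n - 1" using order_trans[OF pos, of i] by auto
    show "of_bool (expert G k l i (substr (segment y 1 (n - 1)) 1 (i - 1))
         (substr (segment x 1 n) 1 i) \<noteq> letter (segment y 1 (n - 1)) i) = expert_err G x y (k, l) i"
    proof -
      have "substr (segment y 1 (n - 1)) 1 (i - 1) = segment y 1 (i - 1)"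
        "substr (segment x 1 n) 1 i = segment x 1 i" "letter (segment y 1 (n - 1)) i = y i"
        using i by (intro substr_segment letter_segment; simp)+
      then show ?thesis by (simp only: expert_err_def expert_seq_def case_prod_conv)
    qed
  qed
  also have "\<dots> = (\<Sum>j=2^m..<n. expert_err G x y (k, l) j)"
    using n by (intro sum.cong) auto
  finally have "expert_loss G k l (2^m) (n - 1) (segment y 1 (n - 1)) (segment x 1 n)
      = (\<Sum>j=2^m..<n. expert_err G x y (k, l) j) / (real (n - 1) - real (2 ^ m) + 1)"
    unfolding expert_loss_def by (simp only:)
  also have "real (n - 1) - real (2 ^ m) + 1 = real n - 2 ^ m"
    using n by (simp add: of_nat_diff)
  finally have el: "expert_loss G k l (2^m) (n - 1) (segment y 1 (n - 1)) (segment x 1 n)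
      = (\<Sum>j=2^m..<n. expert_err G x y (k, l) j) / (real n - 2 ^ m)" .
  have "real (2 ^ m) < real n" using n by (simp only: of_nat_less_iff)
  then have "real n - 2 ^ m \<noteq> 0" by simp
  then show ?thesis unfolding weight_def el using False by simp
qed (simp add: weight_def)

lemma vote_eq:
  assumes "2 ^ m \<le> n" "n < 2 ^ (m + 1)"
  shows "vote G x y n =
    (\<Sum>(k, l)\<in>{1..2 ^ (m + 1)} \<times> {1..2 ^ (m + 1)}. of_bool (expert_seq G k l x y n)
        * exp (- eta m * (\<Sum>j=2^m..<n. expert_err G x y (k, l) j)))
    / (\<Sum>kl\<in>{1..2 ^ (m + 1)} \<times> {1..2 ^ (m + 1)}. exp (- eta m * (\<Sum>j=2^m..<n. expert_err G x y kl j)))"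
  unfolding vote_def block_eq[OF assms] Let_def weight_eq_exp[OF assms(1)]
  by (simp add: case_prod_unfold)

lemma mixed_loss_eq:
  fixes G :: "nat \<Rightarrow> 'a \<Rightarrow> nat" and x :: "nat \<Rightarrow> 'a" and y :: "nat \<Rightarrow> bool" and m n :: nat
  assumes "2 ^ m \<le> n" "n < 2 ^ (m + 1)"
  defines "K \<equiv> {1..2 ^ (m + 1)} \<times> {1..2 ^ (m + 1)}"
    and "w \<equiv> \<lambda>kl. exp (- eta m * (\<Sum>j=2^m..<n. expert_err G x y kl j))"
  shows "mixed_loss G x y n = (\<Sum>kl\<in>K. w kl * expert_err G x y kl n) / (\<Sum>kl\<in>K. w kl)"
    and "0 \<le> vote G x y n" "vote G x y n \<le> 1"
proof -
  have fin: "finite K" and ne: "K \<noteq> {}" unfolding K_def by auto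
  have W: "0 < (\<Sum>kl\<in>K. w kl)" unfolding w_def using fin ne by (intro sum_pos) auto
  have v: "vote G x y n = (\<Sum>(k, l)\<in>K. of_bool (expert_seq G k l x y n) * w (k, l)) / (\<Sum>kl\<in>K. w kl)"
    unfolding K_def w_def by (rule vote_eq[OF assms(1,2)])
  have le: "(\<Sum>(k, l)\<in>K. of_bool (expert_seq G k l x y n) * w (k, l)) \<le> (\<Sum>kl\<in>K. w kl)"
    by (intro sum_mono) (auto simp: w_def)
  show v0: "0 \<le> vote G x y n" unfolding v using W
    by (intro divide_nonneg_pos sum_nonneg) (auto simp: w_def)
  show v1: "vote G x y n \<le> 1" unfolding v using W le by simp
  show "mixed_loss G x y n = (\<Sum>kl\<in>K. w kl * expert_err G x y kl n) / (\<Sum>kl\<in>K. w kl)"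
  proof (cases "y n")
    case True
    have "mixed_loss G x y n = 1 - vote G x y n" unfolding mixed_loss_def using True v1 by simp
    also have "\<dots> = ((\<Sum>kl\<in>K. w kl) - (\<Sum>(k, l)\<in>K. of_bool (expert_seq G k l x y n) * w (k, l))) / (\<Sum>kl\<in>K. w kl)"
      unfolding v using W by (simp add: diff_divide_distrib)
    also have "(\<Sum>kl\<in>K. w kl) - (\<Sum>(k, l)\<in>K. of_bool (expert_seq G k l x y n) * w (k, l))
        = (\<Sum>kl\<in>K. w kl * expert_err G x y kl n)"
      unfolding sum_subtractf[symmetric] using True by (intro sum.cong) (auto simp: expert_err_def)
    finally show ?thesis .
  next
    case False
    have "mixed_loss G x y n = vote G x y n" unfolding mixed_loss_def using False v0 by simp
    also have "\<dots> = (\<Sum>kl\<in>K. w kl * expert_err G x y kl n) / (\<Sum>kl\<in>K. w kl)"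
      unfolding v using False by (intro arg_cong2[where f = "(/)"] sum.cong) (auto simp: expert_err_def)
    finally show ?thesis .
  qed
qed

lemma block_exists:
  fixes n :: nat
  assumes "1 \<le> n"
  obtains m where "2 ^ m \<le> n" "n < 2 ^ (m + 1)"
  using ex_power_ivl1[of 2 n, OF order_refl assms] by blast

lemma vote_bounds: "1 \<le> n \<Longrightarrow> 0 \<le> vote G x y n \<and> vote G x y n \<le> 1"
  by (rule block_exists[of n]) (auto dest: mixed_loss_eq(2,3)[of _ n G x y])

lemma eta_pos: "eta m > 0"
proof -
  have "(1::real) < (2 ^ (m + 1))\<^sup>2" by (intro one_less_power) (auto intro!: one_less_power simp del: power_Suc power_add)
  then show ?thesis unfolding eta_def by simp
qed

section \<open>Regret of the scheme against a fixed expert\<close>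

text \<open>The regret bound for exponential weights on a block of length \<open>2\<^sup>m\<close> with learning rate
  \<open>eta m\<close>.\<close>

definition block_regret :: "nat \<Rightarrow> real" where
  "block_regret m = ln (real (card ({1..(2::nat) ^ (m + 1)} \<times> {1..(2::nat) ^ (m + 1)}))) / eta m + 2 ^ m * eta m / 2"

lemma block_regret_bound:
  assumes kl: "1 \<le> k" "k \<le> 2 ^ (m + 1)" "1 \<le> l" "l \<le> 2 ^ (m + 1)" and n: "n \<le> 2 ^ m"
  shows "(\<Sum>i=2^m..<2^m+n. mixed_loss G x y i)
    \<le> (\<Sum>i=2^m..<2^m+n. expert_err G x y (k, l) i) + block_regret m"
proof -
  let ?K = "{1..(2::nat) ^ (m + 1)} \<times> {1..(2::nat) ^ (m + 1)}"
  have "(\<Sum>i=2^m..<2^m+n. mixed_loss G x y i)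
      = (\<Sum>i=2^m..<2^m+n. (\<Sum>kl\<in>?K. exp (- eta m * (\<Sum>j=2^m..<i. expert_err G x y kl j)) * expert_err G x y kl i)
          / (\<Sum>kl\<in>?K. exp (- eta m * (\<Sum>j=2^m..<i. expert_err G x y kl j))))"
    by (intro sum.cong refl mixed_loss_eq(1)) (use n in auto)
  also have "\<dots> \<le> (\<Sum>i=2^m..<2^m+n. expert_err G x y (k, l) i) + ln (real (card ?K)) / eta m + real n * eta m / 2"
    by (rule exponential_weights_regret) (use kl eta_pos in \<open>auto simp: expert_err_def\<close>)
  also have "real n * eta m / 2 \<le> 2 ^ m * eta m / 2"
  proof -
    have "real n \<le> 2 ^ m" using of_nat_mono[OF n, where ?'a = real] by simp
    then show ?thesis using eta_pos[of m] by simp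
  qed
  finally show ?thesis unfolding block_regret_def by simp
qed

lemma block_regret_eq: "block_regret m = (1 / sqrt 8 + sqrt 8 / 2) * sqrt (2 ^ m * (2 * (real m + 1) * ln 2))"
proof -
  define a b :: real where "a = sqrt (2 * (real m + 1) * ln 2)" and "b = sqrt (2 ^ m)"
  have ln_eq: "ln (((2::real) ^ (m + 1))\<^sup>2) = 2 * (real m + 1) * ln 2"
    by (simp add: ln_realpow power_mult[symmetric] algebra_simps del: power_Suc power_add)
  have a: "2 * (real m + 1) * ln 2 = a * a" "a > 0" unfolding a_def by auto
  have b: "2 ^ m = b * b" "b > 0" unfolding b_def by auto
  have c: "ln (real (card ({1..(2::nat) ^ (m + 1)} \<times> {1..(2::nat) ^ (m + 1)}))) = a * a"
    using ln_eq a(1) by (simp add: power2_eq_square)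
  have e: "eta m = sqrt 8 * a / b"
    unfolding eta_def ln_eq a_def b_def by (simp add: real_sqrt_mult real_sqrt_divide)
  have s: "sqrt (2 ^ m * (2 * (real m + 1) * ln 2)) = b * a"
    unfolding a_def b_def by (simp add: real_sqrt_mult)
  have "block_regret m = (1 / sqrt 8 + sqrt 8 / 2) * (b * a)"
    unfolding block_regret_def c e b(1) using a(2) b(2) by (simp add: field_simps)
  then show ?thesis by (simp only: s)
qed

lemma block_regret_small: "(\<lambda>m. block_regret m / 2 ^ m) \<longlonglongrightarrow> 0"
  unfolding block_regret_eq by real_asymp

text \<open>Blocks before \<open>m\<^sub>0\<close>, in which the expert may be missing from the pool or the regret may be
  large, contribute a constant. Every later block has regret at most \<open>\<delta>/2\<close> times its length, and the
  lengths of the blocks that start by time \<open>n\<close> sum to at most \<open>2 n\<close>.\<close>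

lemma regret_bound:
  assumes kl: "1 \<le> k" "1 \<le> l" and \<delta>: "0 < \<delta>"
  shows "\<exists>C. \<forall>x y n.
    (\<Sum>i=1..n. mixed_loss G x y i) \<le> (\<Sum>i=1..n. expert_err G x y (k, l) i) + C + \<delta> * real n"
proof -
  obtain m1 where m1: "\<And>m. m \<ge> m1 \<Longrightarrow> block_regret m / 2 ^ m < \<delta> / 2"
    using order_tendstoD(2)[OF block_regret_small, of "\<delta> / 2"] \<delta>
    unfolding eventually_sequentially by auto
  \<comment> \<open>From block \<open>k + l\<close> on, the expert \<open>(k, l)\<close> belongs to the pool, as \<open>k + l < 2 ^ (m + 1)\<close>.\<close>
  define m0 where "m0 = max m1 (k + l)"
  have kl_le: "k \<le> 2 ^ (m + 1)" "l \<le> 2 ^ (m + 1)" if "m \<ge> m0" for m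
  proof -
    have "m < 2 ^ m" by simp
    then have "k + l < 2 ^ (m + 1)" using that unfolding m0_def by (simp, linarith)
    then show "k \<le> 2 ^ (m + 1)" "l \<le> 2 ^ (m + 1)" by linarith+
  qed
  have blk: "(\<Sum>i=2^m..<2^m+n. mixed_loss G x y i)
      \<le> (\<Sum>i=2^m..<2^m+n. expert_err G x y (k, l) i) + \<delta> / 2 * 2 ^ m"
    if "m \<ge> m0" "n \<le> 2 ^ m" for m n x y
  proof -
    have "block_regret m \<le> \<delta> / 2 * 2 ^ m" using m1[of m] that unfolding m0_def
      by (simp add: divide_less_eq)
    then show ?thesis using block_regret_bound[OF kl(1) kl_le(1)[OF that(1)] kl(2) kl_le(2)[OF that(1)] that(2), of G x y]
      by linarith
  qed
  have ml: "mixed_loss G x y i \<le> 1" if "1 \<le> i" for x y i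
    using vote_bounds[OF that, of G x y] unfolding mixed_loss_def by (auto simp: of_bool_def)
  have init: "(\<Sum>i=1..<n. mixed_loss G x y i) \<le> (\<Sum>i=1..<n. expert_err G x y (k, l) i) + 2 ^ m0"
    if "n \<le> 2 ^ m0" for n x y
  proof -
    have "(\<Sum>i=1..<n. mixed_loss G x y i) \<le> real (card {1..<n}) * 1"
      using ml by (intro sum_bounded_above) auto
    also have "\<dots> \<le> real (2 ^ m0)" using that by (simp only: card_atLeastLessThan mult_1_right of_nat_le_iff)
    finally have "(\<Sum>i=1..<n. mixed_loss G x y i) \<le> 2 ^ m0" by simp
    moreover have "0 \<le> (\<Sum>i=1..<n. expert_err G x y (k, l) i)" by (intro sum_nonneg) (simp add: expert_err_def)
    ultimately show ?thesis by linarith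
  qed
  have full: "(\<Sum>i=1..<2^m. mixed_loss G x y i)
      \<le> (\<Sum>i=1..<2^m. expert_err G x y (k, l) i) + 2 ^ m0 + \<delta> / 2 * 2 ^ m" if "m \<ge> m0" for m x y
    using that
  proof (induction rule: dec_induct)
    case base
    have "0 \<le> \<delta> / 2 * 2 ^ m0" using \<delta> by simp
    then show ?case using init[of "2 ^ m0" x y] by simp
  next
    case (step m)
    have split: "(\<Sum>i=1..<2^Suc m. f i) = (\<Sum>i=1..<2^m. f i) + (\<Sum>i=2^m..<2^m+2^m. f i)" for f :: "nat \<Rightarrow> real"
      by (subst sum.atLeastLessThan_concat) (auto simp: mult_2)
    show ?case unfolding split using step(3) blk[OF step(1), of "2^m" x y] by (simp add: algebra_simps)
  qed
  show ?thesis
  proof (intro exI[of _ "2 ^ m0"] allI)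
    fix x y n
    have "(\<Sum>i=1..<Suc n. mixed_loss G x y i) \<le> (\<Sum>i=1..<Suc n. expert_err G x y (k, l) i) + 2 ^ m0 + \<delta> * real n"
    proof (cases "Suc n \<le> 2 ^ m0")
      case True
      have "0 \<le> \<delta> * real n" using \<delta> by simp
      then show ?thesis using init[OF True, of x y] by linarith
    next
      case False
      have "1 \<le> n" using False by (cases n) auto
      then obtain m where m: "2 ^ m \<le> n" "n < 2 ^ (m + 1)" using block_exists by blast
      have "m0 \<le> m"
      proof (rule ccontr)
        assume "\<not> m0 \<le> m"
        then have "(2::nat) ^ (m + 1) \<le> 2 ^ m0" by (intro power_increasing) auto
        then show False using m False by linarith
      qed
      have split: "(\<Sum>i=1..<Suc n. f i) = (\<Sum>i=1..<2^m. f i) + (\<Sum>i=2^m..<2^m+(Suc n - 2^m). f i)" for f :: "nat \<Rightarrow> real"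
        using m by (subst sum.atLeastLessThan_concat) auto
      have "\<delta> * 2 ^ m \<le> \<delta> * real n"
        using of_nat_mono[OF m(1), where ?'a = real] \<delta> by simp
      moreover have "Suc n - 2 ^ m \<le> 2 ^ m" using m by simp
      ultimately show ?thesis
        unfolding split using full[OF \<open>m0 \<le> m\<close>, of x y] blk[OF \<open>m0 \<le> m\<close>, of "Suc n - 2^m" x y] by linarith
    qed
    then show "(\<Sum>i=1..n. mixed_loss G x y i) \<le> (\<Sum>i=1..n. expert_err G x y (k, l) i) + 2 ^ m0 + \<delta> * real n"
      by (simp only: atLeastLessThanSuc_atLeastAtMost)
  qed
qed

section \<open>Experts as plug-in classifiers\<close>

text \<open>What the expert \<open>(k, l)\<close> looks at when predicting at time \<open>i\<close>; the value is meaningful for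
  \<open>i > k\<close>.\<close>

definition local_context :: "(nat \<Rightarrow> 'a \<Rightarrow> nat) \<Rightarrow> nat \<Rightarrow> nat \<Rightarrow> (nat \<Rightarrow> 'a) \<Rightarrow> (nat \<Rightarrow> bool) \<Rightarrow> nat \<Rightarrow> bool list \<times> nat list" where
  "local_context G k l x y i = (segment y (i - k) (i - 1), map (G l) (segment x (i - k) i))"

text \<open>The estimate \<open>P_hat\<close> of the probability of label 0, with counts written as sums so that the
  ergodic theorem applies to them.\<close>

definition false_freq :: "(nat \<Rightarrow> 'a \<Rightarrow> nat) \<Rightarrow> nat \<Rightarrow> nat \<Rightarrow> (nat \<Rightarrow> 'a) \<Rightarrow> (nat \<Rightarrow> bool) \<Rightarrow> bool list \<times> nat list \<Rightarrow> nat \<Rightarrow> real" where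
  "false_freq G k l x y c n =
    (let D = (\<Sum>i\<in>{k<..<n}. of_bool (local_context G k l x y i = c))
     in if n \<le> k + 1 \<or> D = 0 then 1/2
        else (\<Sum>i\<in>{k<..<n}. of_bool (local_context G k l x y i = c \<and> \<not> y i)) / D)"

lemma sum_of_bool_card: "finite A \<Longrightarrow> (\<Sum>i\<in>A. of_bool (P i) :: real) = real (card {i\<in>A. P i})"
  by (simp add: sum.If_cases of_bool_def Int_def)

lemma expert_seq_iff:
  "expert_seq G k l x y n \<longleftrightarrow> false_freq G k l x y (local_context G k l x y n) n \<le> 1/2"
proof (cases "n \<le> k + 1")
  case True
  then show ?thesis by (simp add: expert_seq_def expert_def P_hat_def false_freq_def Let_def)
next
  case False
  let ?ys = "segment y 1 (n - 1)" and ?xs = "segment x 1 n"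
  have ctx: "substr ?ys (i - k) (i - 1) = segment y (i - k) (i - 1)"
    "substr ?xs (i - k) i = segment x (i - k) i" if "k < i" "i \<le> n" for i
    using that by (intro substr_segment; simp)+
  have ctx_n: "(substr ?ys (n - k) (n - 1), map (G l) (substr ?xs (n - k) n)) = local_context G k l x y n"
    using ctx[of n] False unfolding local_context_def by simp
  let ?D = "\<lambda>s z. {i. k < i \<and> i < n \<and> substr ?ys (i - k) (i - 1) = s \<and> map (G l) (substr ?xs (i - k) i) = z}"
  have D: "?D s z = {i\<in>{k<..<n}. local_context G k l x y i = (s, z)}" for s z
    using ctx unfolding local_context_def by auto
  have D2: "{i\<in>?D s z. letter ?ys i = False} = {i\<in>{k<..<n}. local_context G k l x y i = (s, z) \<and> \<not> y i}" for s z
    unfolding D by (auto simp: letter_segment[of _ "n - 1", simplified])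
  have "P_hat G k l n False ?ys ?xs s z = false_freq G k l x y (s, z) n" for s z
    unfolding P_hat_def false_freq_def Let_def D2 sum_of_bool_card[OF finite_greaterThanLessThan]
    unfolding D using False by simp
  then show ?thesis
    unfolding expert_seq_def expert_def using ctx_n by (auto simp: not_less)
qed

text \<open>The prediction error with vote \<open>v\<close> for label 1 consists of its conditional mean, when 1 has
  probability \<open>p\<close>, and a multiple of the innovation \<open>y - p\<close>.\<close>

lemma mixed_loss_split:
  fixes v p :: real
  assumes "0 \<le> v" "v \<le> 1"
  shows "\<bar>of_bool y - v\<bar> = (v * (1 - p) + (1 - v) * p) + (1 - 2 * v) * (of_bool y - p)"
  using assms by (cases y) (auto simp: algebra_simps)

lemma bayes_le_mixed:
  fixes v p :: real
  assumes "0 \<le> v" "v \<le> 1"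
  shows "min p (1 - p) \<le> v * (1 - p) + (1 - v) * p"
proof -
  have "v * min p (1 - p) + (1 - v) * min p (1 - p) \<le> v * (1 - p) + (1 - v) * p"
    using assms by (intro add_mono mult_left_mono) auto
  then show ?thesis by (simp add: algebra_simps)
qed

text \<open>A wrong decision costs \<open>\<bar>1 - 2 p\<bar>\<close>, and the estimate \<open>1 - f\<close> of \<open>p\<close> then lies on the other side
  of \<open>1/2\<close>.\<close>

lemma plug_in_le_bayes:
  fixes p f :: real
  shows "of_bool (f \<le> 1/2) * (1 - p) + (1 - of_bool (f \<le> 1/2)) * p \<le> min p (1 - p) + 2 * \<bar>p - (1 - f)\<bar>"
  by (cases "f \<le> 1/2") (auto simp: min_def abs_if)

section \<open>Measurability of experts and votes\<close>

text \<open>Strings over a countable alphabet form a countable type, so experts can be handled as functions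
  of discrete random variables.\<close>

lemma measurable_map_list [measurable (raw)]:
  fixes f :: "nat \<Rightarrow> 'w \<Rightarrow> 'c::countable"
  assumes "\<And>i. i \<in> set is \<Longrightarrow> f i \<in> N \<rightarrow>\<^sub>M count_space UNIV"
  shows "(\<lambda>\<omega>. map (\<lambda>i. f i \<omega>) is) \<in> N \<rightarrow>\<^sub>M count_space UNIV"
  using assms
proof (induction "is")
  case (Cons a as)
  have tail: "(\<lambda>\<omega>. map (\<lambda>i. f i \<omega>) as) \<in> N \<rightarrow>\<^sub>M count_space UNIV"
    using Cons by simp
  have "(\<lambda>\<omega>. f a \<omega> # map (\<lambda>i. f i \<omega>) as) \<in> N \<rightarrow>\<^sub>M count_space UNIV"
  proof (rule measurable_compose_countable[where f = "\<lambda>b \<omega>. b # map (\<lambda>i. f i \<omega>) as"])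
    show "(\<lambda>\<omega>. b # map (\<lambda>i. f i \<omega>) as) \<in> N \<rightarrow>\<^sub>M count_space UNIV" for b
      by (rule measurable_compose[OF tail]) simp
  qed (use Cons.prems in auto)
  then show ?case by simp
qed simp

lemma measurable_count_space_pair:
  fixes f :: "'w \<Rightarrow> 'c::countable" and g :: "'w \<Rightarrow> 'd::countable"
  assumes "f \<in> N \<rightarrow>\<^sub>M count_space UNIV" "g \<in> N \<rightarrow>\<^sub>M count_space UNIV"
  shows "(\<lambda>\<omega>. (f \<omega>, g \<omega>)) \<in> N \<rightarrow>\<^sub>M count_space UNIV"
  by (rule measurable_compose_countable[where f = "\<lambda>b \<omega>. (b, g \<omega>)" and g = f])
     (auto intro: assms measurable_compose[OF assms(2)])

lemma local_context_measurable:
  assumes G: "G l \<in> borel \<rightarrow>\<^sub>M count_space UNIV"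
    and x: "\<And>j. 1 \<le> j \<Longrightarrow> j \<le> i \<Longrightarrow> (\<lambda>\<omega>. x \<omega> j) \<in> N \<rightarrow>\<^sub>M borel"
    and y: "\<And>j. 1 \<le> j \<Longrightarrow> j < i \<Longrightarrow> (\<lambda>\<omega>. y \<omega> j) \<in> N \<rightarrow>\<^sub>M count_space UNIV"
    and i: "k < i"
  shows "(\<lambda>\<omega>. local_context G k l (x \<omega>) (y \<omega>) i) \<in> N \<rightarrow>\<^sub>M count_space UNIV"
  unfolding local_context_def segment_def map_map comp_def
  by (intro measurable_count_space_pair measurable_map_list measurable_compose[OF x G] y) (use i in auto)

lemma false_freq_measurable:
  assumes G: "G l \<in> borel \<rightarrow>\<^sub>M count_space UNIV"
    and x: "\<And>j. 1 \<le> j \<Longrightarrow> j \<le> n \<Longrightarrow> (\<lambda>\<omega>. x \<omega> j) \<in> N \<rightarrow>\<^sub>M borel"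
    and y[measurable]: "\<And>j. 1 \<le> j \<Longrightarrow> j < n \<Longrightarrow> (\<lambda>\<omega>. y \<omega> j) \<in> N \<rightarrow>\<^sub>M count_space UNIV"
  shows "(\<lambda>\<omega>. false_freq G k l (x \<omega>) (y \<omega>) c n) \<in> borel_measurable N"
proof -
  have [measurable]: "(\<lambda>\<omega>. local_context G k l (x \<omega>) (y \<omega>) i) \<in> N \<rightarrow>\<^sub>M count_space UNIV" if "i \<in> {k<..<n}" for i
    by (rule local_context_measurable[where G = G and x = x and y = y]) (use G x y that in auto)
  have [measurable]: "(\<lambda>\<omega>. y \<omega> i) \<in> N \<rightarrow>\<^sub>M count_space UNIV" if "i \<in> {k<..<n}" for i
    by (rule y) (use that in auto)
  show ?thesis unfolding false_freq_def Let_def by measurable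
qed

lemma expert_seq_measurable:
  assumes G: "G l \<in> borel \<rightarrow>\<^sub>M count_space UNIV"
    and x: "\<And>j. 1 \<le> j \<Longrightarrow> j \<le> n \<Longrightarrow> (\<lambda>\<omega>. x \<omega> j) \<in> N \<rightarrow>\<^sub>M borel"
    and y: "\<And>j. 1 \<le> j \<Longrightarrow> j < n \<Longrightarrow> (\<lambda>\<omega>. y \<omega> j) \<in> N \<rightarrow>\<^sub>M count_space UNIV"
  shows "(\<lambda>\<omega>. expert_seq G k l (x \<omega>) (y \<omega>) n) \<in> N \<rightarrow>\<^sub>M count_space UNIV"
proof (cases "k < n")
  case True
  have [measurable]: "(\<lambda>\<omega>. false_freq G k l (x \<omega>) (y \<omega>) c n) \<in> borel_measurable N" for c
    by (rule false_freq_measurable[where G = G and x = x and y = y]) (use G x y in auto)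
  have ctx: "(\<lambda>\<omega>. local_context G k l (x \<omega>) (y \<omega>) n) \<in> N \<rightarrow>\<^sub>M count_space UNIV"
    by (rule local_context_measurable[where G = G and x = x and y = y]) (use G x y True in auto)
  show ?thesis unfolding expert_seq_iff
    by (rule measurable_compose_countable[OF _ ctx,
          where f = "\<lambda>c \<omega>. false_freq G k l (x \<omega>) (y \<omega>) c n \<le> 1/2"]) measurable
next
  case False
  then show ?thesis unfolding expert_seq_iff by (simp add: false_freq_def)
qed

text \<open>The hypotheses ask for labels only strictly before \<open>n\<close>: the vote is a function of the past, which
  makes the innovation at time \<open>n\<close> orthogonal to it.\<close>

lemma vote_measurable:
  assumes G: "\<And>l. 1 \<le> l \<Longrightarrow> G l \<in> borel \<rightarrow>\<^sub>M count_space UNIV"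
    and x: "\<And>j. 1 \<le> j \<Longrightarrow> j \<le> n \<Longrightarrow> (\<lambda>\<omega>. x \<omega> j) \<in> N \<rightarrow>\<^sub>M borel"
    and y: "\<And>j. 1 \<le> j \<Longrightarrow> j < n \<Longrightarrow> (\<lambda>\<omega>. y \<omega> j) \<in> N \<rightarrow>\<^sub>M count_space UNIV"
    and n: "1 \<le> n"
  shows "(\<lambda>\<omega>. vote G (x \<omega>) (y \<omega>) n) \<in> borel_measurable N"
proof -
  obtain m where m: "2 ^ m \<le> n" "n < 2 ^ (m + 1)" using block_exists[OF n] .
  let ?K = "{1..(2::nat) ^ (m + 1)} \<times> {1..(2::nat) ^ (m + 1)}"
  have h: "(\<lambda>\<omega>. expert_seq G k l (x \<omega>) (y \<omega>) j) \<in> N \<rightarrow>\<^sub>M count_space UNIV"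
    if "1 \<le> l" "j \<le> n" for k l j
    by (rule expert_seq_measurable[where G = G and x = x and y = y]) (use G x y that in auto)
  have e: "(\<lambda>\<omega>. expert_err G (x \<omega>) (y \<omega>) kl j) \<in> borel_measurable N"
    if kl_in: "kl \<in> ?K" and j_in: "j \<in> {2^m..<n}" for kl j
  proof -
    obtain k l where kl: "kl = (k, l)" "1 \<le> l" using kl_in by (cases kl) auto
    have "(1::nat) \<le> 2 ^ m" by simp
    moreover have "2 ^ m \<le> j" "j < n" using j_in by auto
    ultimately have j: "1 \<le> j" "j < n" by (blast intro: order_trans)+
    note [measurable] = h[OF kl(2) less_imp_le[OF j(2)], of k] y[OF j]
    show ?thesis unfolding expert_err_def kl case_prod_conv by measurable
  qed
  have h': "(\<lambda>\<omega>. of_bool (expert_seq G (fst kl) (snd kl) (x \<omega>) (y \<omega>) n) :: real) \<in> borel_measurable N"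
    if "kl \<in> ?K" for kl
  proof -
    have [measurable]: "(\<lambda>\<omega>. expert_seq G (fst kl) (snd kl) (x \<omega>) (y \<omega>) n) \<in> N \<rightarrow>\<^sub>M count_space UNIV"
      using h[of "snd kl" n "fst kl"] that by (cases kl) auto
    show ?thesis by measurable
  qed
  have w: "(\<lambda>\<omega>. exp (- eta m * (\<Sum>j=2^m..<n. expert_err G (x \<omega>) (y \<omega>) kl j))) \<in> borel_measurable N"
    if "kl \<in> ?K" for kl
    by (intro measurable_compose[OF _ borel_measurable_exp] borel_measurable_times
        borel_measurable_const borel_measurable_sum e that)
  show ?thesis unfolding vote_eq[OF m] case_prod_unfold prod.collapse
    by (intro borel_measurable_divide borel_measurable_sum borel_measurable_times h' w)
qed

section \<open>The path space of the process\<close>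

text \<open>The inverse of the shift, iterated. A function of the past at time \<open>n\<close>, composed with \<open>unshift n\<close>,
  is a function of the past at time 0.\<close>

definition unshift :: "nat \<Rightarrow> (int \<Rightarrow> 'b) \<Rightarrow> int \<Rightarrow> 'b" where
  "unshift n z = (\<lambda>i. z (i - int n))"

lemma funpow_shift: "(shift ^^ n) z = (\<lambda>i. z (i + int n))"
  by (induction n arbitrary: z) (auto simp: shift_def algebra_simps)

lemma funpow_shift_unshift: "m \<le> n \<Longrightarrow> (shift ^^ m) (unshift n z) = unshift (n - m) z"
  by (auto simp: funpow_shift unshift_def of_nat_diff algebra_simps intro!: ext arg_cong[where f = z])

lemma unshift_funpow_shift: "unshift n ((shift ^^ n) z) = z"
  by (auto simp: funpow_shift unshift_def)

abbreviation (input) obs_algebra :: "('a::topological_space \<times> bool) measure" where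
  "obs_algebra \<equiv> borel \<Otimes>\<^sub>M count_space UNIV"

lemma space_path_space [simp]: "space (path_space obs_algebra) = UNIV"
  by (auto simp: path_space_def space_PiM space_pair_measure)

lemma shift_measurable: "shift \<in> path_space N \<rightarrow>\<^sub>M path_space N"
  unfolding shift_def path_space_def by (rule measurable_PiM_single') (auto simp: space_PiM)

text \<open>The law of the process as a measure on two-sided paths. There the shift is an ergodic system,
  and time \<open>i\<close> is time 0 seen after \<open>i\<close> shifts.\<close>

locale ergodic_path = prob_space P for P :: "(int \<Rightarrow> 'a::topological_space \<times> bool) measure" +
  assumes sets_P: "sets P = sets (path_space obs_algebra)"
    and shift_pres: "distr P P shift = P"
    and shift_ergodic: "\<And>B. B \<in> sets P \<Longrightarrow> shift -` B = B \<Longrightarrow> prob B = 0 \<or> prob B = 1"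
begin

lemma space_P [simp]: "space P = UNIV"
  using sets_eq_imp_space_eq[OF sets_P] by simp

lemma measurable_P_cong: "measurable P N = measurable (path_space obs_algebra) N"
  by (rule measurable_cong_sets[OF sets_P refl])

sublocale ergodic_system P shift
proof
  show "shift \<in> P \<rightarrow>\<^sub>M P"
    using shift_measurable sets_P by (simp cong: measurable_cong_sets)
qed (use shift_pres shift_ergodic in auto)

lemma coord_measurable [measurable]: "(\<lambda>z. z i) \<in> P \<rightarrow>\<^sub>M obs_algebra"
  unfolding measurable_P_cong path_space_def by simp

lemma fst_coord_measurable [measurable]: "(\<lambda>z. fst (z i)) \<in> P \<rightarrow>\<^sub>M borel"
  by (rule measurable_compose[OF coord_measurable measurable_fst])

lemma snd_coord_measurable [measurable]: "(\<lambda>z. snd (z i)) \<in> P \<rightarrow>\<^sub>M count_space UNIV"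
  by (rule measurable_compose[OF coord_measurable measurable_snd])

definition past :: "(int \<Rightarrow> 'a \<times> bool) measure" where
  "past = past_algebra P (\<lambda>i z. fst (z i)) (\<lambda>i z. snd (z i))"

lemma space_past [simp]: "space past = UNIV"
  unfolding past_def past_algebra_def by simp

lemma measurable_into_past:
  assumes "\<And>i. i < 0 \<Longrightarrow> (\<lambda>x. snd (f x i)) \<in> N \<rightarrow>\<^sub>M count_space UNIV"
    and "\<And>i. i \<le> 0 \<Longrightarrow> (\<lambda>x. fst (f x i)) \<in> N \<rightarrow>\<^sub>M borel"
  shows "f \<in> N \<rightarrow>\<^sub>M past"
  unfolding past_def past_algebra_def
  by (intro measurable_vimage_algebra2 measurable_Pair measurable_restrict) (use assms in auto)

lemma past_map_measurable:
  "(\<lambda>z. (\<lambda>i\<in>{..<0}. snd (z i), \<lambda>i\<in>{..0}. fst (z i))) \<in> past \<rightarrow>\<^sub>M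
    Pi\<^sub>M {..<0::int} (\<lambda>_. count_space UNIV) \<Otimes>\<^sub>M Pi\<^sub>M {..0} (\<lambda>_. borel)"
  unfolding past_def past_algebra_def
  by (rule measurable_vimage_algebra1) (auto simp: space_pair_measure space_PiM)

lemma snd_past: "i < 0 \<Longrightarrow> (\<lambda>z. snd (z i)) \<in> past \<rightarrow>\<^sub>M count_space UNIV"
  using measurable_compose[OF measurable_compose[OF past_map_measurable measurable_fst]
      measurable_component_singleton[of i]] by simp

lemma fst_past: "i \<le> 0 \<Longrightarrow> (\<lambda>z. fst (z i)) \<in> past \<rightarrow>\<^sub>M borel"
  using measurable_compose[OF measurable_compose[OF past_map_measurable measurable_snd]
      measurable_component_singleton[of i]] by simp

lemma subalgebra_past: "subalgebra P past"
proof -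
  have "(\<lambda>z. z) \<in> P \<rightarrow>\<^sub>M past" by (intro measurable_into_past) measurable
  from measurable_sets[OF this] show ?thesis by (auto simp: subalgebra_def)
qed

sublocale past: finite_measure_subalgebra P past
  by unfold_locales (rule subalgebra_past)

lemma past_imp_P: "f \<in> past \<rightarrow>\<^sub>M N \<Longrightarrow> f \<in> P \<rightarrow>\<^sub>M N"
  by (rule measurable_from_subalg[OF subalgebra_past])

lemma unshift_past: "unshift n \<in> past \<rightarrow>\<^sub>M past"
  by (intro measurable_into_past) (auto simp: unshift_def intro!: snd_past fst_past)

text \<open>A version of \<open>P(Y\<^sub>0 = 1 | past)\<close>. Clipping to \<open>[0, 1]\<close> changes it on a null set only and gives
  bounds that hold everywhere.\<close>

definition label_prob :: "(int \<Rightarrow> 'a \<times> bool) \<Rightarrow> real" where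
  "label_prob z = max 0 (min 1 (cond_prob_label P (\<lambda>i z. fst (z i)) (\<lambda>i z. snd (z i)) True z))"

lemma label_prob_bounds: "0 \<le> label_prob z" "label_prob z \<le> 1" by (auto simp: label_prob_def)

lemma label_prob_past [measurable]: "label_prob \<in> borel_measurable past"
  unfolding label_prob_def cond_prob_label_def past_def[symmetric] by measurable

lemma label_prob_measurable [measurable]: "label_prob \<in> borel_measurable P"
  by (rule past_imp_P) measurable

lemma cond_prob_label_True:
  "cond_prob_label P (\<lambda>i z. fst (z i)) (\<lambda>i z. snd (z i)) True
    = real_cond_exp P past (\<lambda>z. of_bool (snd (z 0)))"
  unfolding cond_prob_label_def past_def[symmetric]
  by (rule arg_cong[where f = "real_cond_exp P past"]) (auto simp: indicator_def)

lemma label_integrable: "integrable P (\<lambda>z. of_bool (snd (z 0)) :: real)"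
  by (rule integrable_const_bound[of _ 1]) auto

lemma label_prob_eq_cond: "AE z in P. real_cond_exp P past (\<lambda>z. of_bool (snd (z 0))) z = label_prob z"
proof -
  have "AE z in P. 0 \<le> real_cond_exp P past (\<lambda>z. of_bool (snd (z 0))) z"
    by (rule past.real_cond_exp_ge_c[OF label_integrable]) auto
  moreover have "AE z in P. real_cond_exp P past (\<lambda>z. of_bool (snd (z 0))) z \<le> 1"
    by (rule past.real_cond_exp_le_c[OF label_integrable]) auto
  ultimately show ?thesis by eventually_elim (simp add: label_prob_def cond_prob_label_True)
qed

text \<open>The innovation \<open>Y\<^sub>0 - label_prob\<close> is orthogonal to bounded functions of the past.\<close>

lemma label_prob_integral:
  assumes f: "f \<in> borel_measurable past" and bound: "\<And>z. \<bar>f z\<bar> \<le> C"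
  shows "expectation (\<lambda>z. f z * (of_bool (snd (z 0)) - label_prob z)) = 0"
proof -
  have [measurable]: "f \<in> borel_measurable P" by (rule past_imp_P[OF f])
  have C: "0 \<le> C" using bound[of undefined] by linarith
  have int1: "integrable P (\<lambda>z. f z * of_bool (snd (z 0)))"
    by (rule integrable_const_bound[of _ C]) (use bound C in \<open>auto simp: abs_mult\<close>)
  have int2: "integrable P (\<lambda>z. f z * label_prob z)"
  proof (rule integrable_const_bound[of _ C])
    have "\<bar>f z\<bar> * label_prob z \<le> C * 1" for z using bound label_prob_bounds C by (intro mult_mono) auto
    then show "AE z in P. norm (f z * label_prob z) \<le> C" using label_prob_bounds by (auto simp: abs_mult)
  qed simp
  have "expectation (\<lambda>z. f z * of_bool (snd (z 0)))
      = expectation (\<lambda>z. f z * real_cond_exp P past (\<lambda>z. of_bool (snd (z 0))) z)"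
    by (rule past.real_cond_exp_intg(2)[OF int1 f, symmetric]) simp
  also have "\<dots> = expectation (\<lambda>z. f z * label_prob z)"
    by (rule integral_cong_AE) (use label_prob_eq_cond in auto)
  finally show ?thesis using int1 int2 by (simp add: right_diff_distrib)
qed

text \<open>For \<open>i < j\<close>, move time \<open>j\<close> to the origin: the term at time \<open>i\<close> and the factor \<open>a j\<close> become functions
  of the past, and the innovation at time \<open>j\<close> becomes the one at time 0. So the terms are uncorrelated.\<close>

theorem noise_average:
  fixes a :: "nat \<Rightarrow> (int \<Rightarrow> 'a \<times> bool) \<Rightarrow> real"
  assumes pred: "\<And>i. 1 \<le> i \<Longrightarrow> (\<lambda>z. a i (unshift i z)) \<in> borel_measurable past"
    and bound: "\<And>i z. 1 \<le> i \<Longrightarrow> \<bar>a i z\<bar> \<le> 1"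
  shows "AE z in P. (\<lambda>n. (\<Sum>i=1..n. a i z * (of_bool (snd (z (int i))) - label_prob ((shift ^^ i) z))) / real n)
    \<longlonglongrightarrow> 0"
proof -
  define e where "e z = of_bool (snd (z 0)) - label_prob z" for z
  have e_meas [measurable]: "e \<in> borel_measurable P" unfolding e_def by measurable
  have e_bound: "\<bar>e z\<bar> \<le> 1" for z using label_prob_bounds[of z] by (auto simp: e_def)
  have e_past: "(\<lambda>z. e (unshift n z)) \<in> borel_measurable past" if "1 \<le> n" for n
  proof -
    have [measurable]: "(\<lambda>z. snd (unshift n z 0)) \<in> past \<rightarrow>\<^sub>M count_space UNIV"
      unfolding unshift_def by (rule snd_past) (use that in auto)
    have [measurable]: "(\<lambda>z. label_prob (unshift n z)) \<in> borel_measurable past"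
      by (rule measurable_compose[OF unshift_past label_prob_past])
    show ?thesis unfolding e_def by measurable
  qed
  have a_meas: "a i \<in> borel_measurable P" if "1 \<le> i" for i
    using measurable_compose[OF funpow_measurable past_imp_P[OF pred[OF that]], of i]
    by (simp add: unshift_funpow_shift)
  define D where "D i z = (if i = 0 then 0 else a i z * e ((shift ^^ i) z))" for i z
  have "AE z in P. (\<lambda>n. (\<Sum>i=1..n. D i z) / real n) \<longlonglongrightarrow> 0"
  proof (rule uncorrelated_SLLN)
    show D_meas [measurable]: "D i \<in> borel_measurable P" for i
    proof (cases "i = 0")
      case False
      then have [measurable]: "a i \<in> borel_measurable P" using a_meas by simp
      show ?thesis unfolding D_def using False by simp
    next
      case True
      show ?thesis unfolding D_def using True by simp
    qed
    show "\<bar>D i z\<bar> \<le> 1" for i z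
      using mult_mono[OF bound[of i z] e_bound[of "(shift ^^ i) z"]] by (auto simp: D_def abs_mult)
    \<comment> \<open>\<open>H\<close> is everything except the innovation at time \<open>j\<close>, seen from time \<open>j\<close>.\<close>
    fix i j :: nat assume ij: "1 \<le> i" "i < j"
    define H where "H z = a i (unshift i (unshift (j - i) z)) * e (unshift (j - i) z) * a j (unshift j z)" for z
    have H_past: "H \<in> borel_measurable past"
      unfolding H_def
      by (intro borel_measurable_times measurable_compose[OF unshift_past pred[OF ij(1)]] e_past pred)
         (use ij in auto)
    have [measurable]: "H \<in> borel_measurable P" by (rule past_imp_P[OF H_past])
    have H_bound: "\<bar>H z\<bar> \<le> 1" for z
    proof -
      have "\<bar>a i (unshift i (unshift (j - i) z))\<bar> * \<bar>e (unshift (j - i) z)\<bar> * \<bar>a j (unshift j z)\<bar> \<le> 1 * 1 * 1"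
        using ij by (intro mult_mono bound e_bound) auto
      then show ?thesis by (simp add: H_def abs_mult)
    qed
    have "unshift i (unshift (j - i) z) = unshift j z" for z :: "int \<Rightarrow> 'a \<times> bool"
      using ij by (auto simp: unshift_def of_nat_diff intro!: ext arg_cong[where f = z])
    then have "D i z * D j z = H ((shift ^^ j) z) * e ((shift ^^ j) z)" for z
      using ij funpow_shift_unshift[of i j "(shift ^^ j) z"]
      by (simp add: D_def H_def unshift_funpow_shift)
    then have "expectation (\<lambda>z. D i z * D j z) = expectation (\<lambda>z. H ((shift ^^ j) z) * e ((shift ^^ j) z))"
      by simp
    also have "\<dots> = expectation (\<lambda>z. H z * e z)"
      by (rule integral_funpow_shift[of "\<lambda>z. H z * e z"]) measurable
    also have "\<dots> = 0" unfolding e_def by (rule label_prob_integral[OF H_past H_bound])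
    finally show "expectation (\<lambda>z. D i z * D j z) = 0" .
  qed
  moreover have "(\<Sum>i=1..n. D i z)
      = (\<Sum>i=1..n. a i z * (of_bool (snd (z (int i))) - label_prob ((shift ^^ i) z)))" for n z
    by (intro sum.cong) (auto simp: D_def e_def funpow_shift)
  ultimately show ?thesis by simp
qed

end

section \<open>Finite contexts and the full past\<close>

text \<open>The properties of a sequence of partitions that matter for consistency; the geometry of the
  cells enters only through the last one.\<close>

locale nested_quantizers =
  fixes G :: "nat \<Rightarrow> 'a::topological_space \<Rightarrow> nat"
  assumes G_measurable: "1 \<le> l \<Longrightarrow> G l \<in> borel \<rightarrow>\<^sub>M count_space UNIV"
    and G_finite: "1 \<le> l \<Longrightarrow> finite (range (G l))"
    and G_nested: "1 \<le> l \<Longrightarrow> G (Suc l) x = G (Suc l) x' \<Longrightarrow> G l x = G l x'"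
    and G_generates: "sets (borel :: 'a measure) \<subseteq> sigma_sets UNIV {G l -` {j} | l j. 1 \<le> l}"
begin

lemma G_refine:
  assumes "1 \<le> l" "l \<le> l'" "G l' x = G l' x'"
  shows "G l x = G l x'"
  using assms(2,3) by (induction rule: dec_induct) (use assms(1) in \<open>auto dest!: G_nested[rotated]\<close>)

end

locale quantized_ergodic_path = ergodic_path P + nested_quantizers G
  for P :: "(int \<Rightarrow> 'a::topological_space \<times> bool) measure" and G :: "nat \<Rightarrow> 'a \<Rightarrow> nat"
begin

text \<open>The context at time 0 of the expert \<open>(k, l)\<close> on a two-sided path, where it is a function of the
  past for every \<open>k\<close>.\<close>

definition ctx :: "nat \<Rightarrow> nat \<Rightarrow> (int \<Rightarrow> 'a \<times> bool) \<Rightarrow> bool list \<times> nat list" where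
  "ctx k l z = (map (\<lambda>j. snd (z (int j - int k))) [0..<k],
                map (\<lambda>j. G l (fst (z (int j - int k)))) [0..<Suc k])"

lemma local_context_eq_ctx:
  assumes "k < i"
  shows "local_context G k l (\<lambda>i. fst (z (int i))) (\<lambda>i. snd (z (int i))) i = ctx k l ((shift ^^ i) z)"
proof -
  have e: "i - k + k = i" using assms by simp
  have "segment f (i - k) (i - 1) = map (\<lambda>j. f (j + (i - k))) [0..<k]" for f :: "nat \<Rightarrow> bool"
  proof -
    have "Suc (i - 1) = k + (i - k)" using assms by simp
    then have "[i - k..<Suc (i - 1)] = map (\<lambda>j. j + (i - k)) [0..<k]"
      using map_add_upt[of "i - k" k] by metis
    then show ?thesis unfolding segment_def by (simp only: map_map comp_def)
  qed
  moreover have "segment f (i - k) i = map (\<lambda>j. f (j + (i - k))) [0..<Suc k]" for f :: "nat \<Rightarrow> 'a"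
  proof -
    have "Suc k + (i - k) = Suc i" using assms by simp
    then have "[i - k..<Suc i] = map (\<lambda>j. j + (i - k)) [0..<Suc k]"
      using map_add_upt[of "i - k" "Suc k"] by metis
    then show ?thesis unfolding segment_def by (simp only: map_map comp_def)
  qed
  ultimately show ?thesis
    using assms unfolding local_context_def ctx_def
    by (simp add: funpow_shift of_nat_diff comp_def algebra_simps del: upt_Suc)
qed

lemma ctx_measurable [measurable]: "1 \<le> l \<Longrightarrow> ctx k l \<in> P \<rightarrow>\<^sub>M count_space UNIV"
  unfolding ctx_def
  by (intro measurable_count_space_pair measurable_map_list snd_coord_measurable
      measurable_compose[OF fst_coord_measurable G_measurable])

lemma ctx_past: "1 \<le> l \<Longrightarrow> ctx k l \<in> past \<rightarrow>\<^sub>M count_space UNIV"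
  unfolding ctx_def
  by (intro measurable_count_space_pair measurable_map_list snd_past
      measurable_compose[OF fst_past G_measurable]) auto

lemma ctx_finite: "1 \<le> l \<Longrightarrow> finite (range (ctx k l))"
proof -
  assume l: "1 \<le> l"
  have "range (ctx k l) \<subseteq> {xs. set xs \<subseteq> UNIV \<and> length xs = k} \<times> {xs. set xs \<subseteq> range (G l) \<and> length xs = Suc k}"
    unfolding ctx_def by auto
  moreover have "finite \<dots>"
    by (intro finite_cartesian_product finite_lists_length_eq G_finite[OF l]) auto
  ultimately show ?thesis by (rule finite_subset)
qed

lemma ctx_refine:
  assumes "k \<le> k'" "1 \<le> l" "l \<le> l'" and eq: "ctx k' l' z = ctx k' l' z'"
  shows "ctx k l z = ctx k l z'"
proof -
  have y: "snd (z (int j - int k')) = snd (z' (int j - int k'))" if "j < k'" for j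
    using eq that unfolding ctx_def by simp
  have x: "G l' (fst (z (int j - int k'))) = G l' (fst (z' (int j - int k')))" if "j < Suc k'" for j
    using eq that unfolding ctx_def by (simp del: upt_Suc)
  have idx: "int j - int k = int (j + (k' - k)) - int k'" for j using assms(1) by simp
  have "snd (z (int j - int k)) = snd (z' (int j - int k))" if "j < k" for j
    unfolding idx using that assms(1) by (intro y) auto
  moreover have "G l (fst (z (int j - int k))) = G l (fst (z' (int j - int k)))" if "j < Suc k" for j
    unfolding idx using that assms by (intro G_refine[OF assms(2,3)] x) auto
  ultimately show ?thesis unfolding ctx_def by (auto simp del: upt_Suc)
qed

lemma ctx_function_measurable [measurable]:
  fixes \<phi> :: "bool list \<times> nat list \<Rightarrow> real"
  shows "1 \<le> l \<Longrightarrow> (\<lambda>z. \<phi> (ctx k l z)) \<in> borel_measurable P"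
  by (rule measurable_compose[OF ctx_measurable]) auto

lemma ctx_function_integrable:
  fixes \<phi> :: "bool list \<times> nat list \<Rightarrow> real"
  assumes "1 \<le> l" shows "integrable P (\<lambda>z. \<phi> (ctx k l z))"
proof (rule integrable_const_bound)
  have "finite ((\<lambda>c. \<bar>\<phi> c\<bar>) ` range (ctx k l))" using ctx_finite[OF assms] by simp
  then show "AE z in P. norm (\<phi> (ctx k l z)) \<le> Max ((\<lambda>c. \<bar>\<phi> c\<bar>) ` range (ctx k l))"
    by (intro AE_I2) (auto intro!: Max_ge)
qed (use assms in simp)

text \<open>Closure in \<open>L\<^sup>1\<close> of the functions of a finite context. The aim is to show that it contains
  \<open>label_prob\<close>; this takes the place of a martingale convergence theorem.\<close>

definition approximable :: "((int \<Rightarrow> 'a \<times> bool) \<Rightarrow> real) \<Rightarrow> bool" where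
  "approximable f \<longleftrightarrow> integrable P f \<and>
    (\<forall>e>0. \<exists>k\<ge>1. \<exists>l\<ge>1. \<exists>\<phi>. expectation (\<lambda>z. \<bar>f z - \<phi> (ctx k l z)\<bar>) \<le> e)"

lemma approximable_ctx: "1 \<le> k \<Longrightarrow> 1 \<le> l \<Longrightarrow> approximable (\<lambda>z. \<phi> (ctx k l z))"
  unfolding approximable_def
  by (intro conjI allI impI ctx_function_integrable exI[of _ k] exI[of _ l] exI[of _ \<phi>]) auto

text \<open>Two contexts have a common refinement, of which both are functions, and \<open>op\<close> is Lipschitz. This
  covers sums, differences and maxima.\<close>

lemma approximable_combine:
  assumes f: "approximable f" and g: "approximable g"
    and op: "\<And>a b a' b'. \<bar>op a b - op a' b'\<bar> \<le> \<bar>a - a'\<bar> + \<bar>b - (b'::real)\<bar>"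
    and int: "integrable P (\<lambda>z. op (f z) (g z))"
  shows "approximable (\<lambda>z. op (f z) (g z))"
  unfolding approximable_def
proof (intro conjI int allI impI)
  fix e :: real assume e: "0 < e"
  obtain k1 l1 \<phi> where 1: "1 \<le> k1" "1 \<le> l1" "expectation (\<lambda>z. \<bar>f z - \<phi> (ctx k1 l1 z)\<bar>) \<le> e / 2"
    using f e unfolding approximable_def by (meson half_gt_zero)
  obtain k2 l2 \<psi> where 2: "1 \<le> k2" "1 \<le> l2" "expectation (\<lambda>z. \<bar>g z - \<psi> (ctx k2 l2 z)\<bar>) \<le> e / 2"
    using g e unfolding approximable_def by (meson half_gt_zero)
  define k l where "k = max k1 k2" and "l = max l1 l2"
  \<comment> \<open>A function of a coarser context, read off from an arbitrary path with the given finer context.\<close>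
  have factor: "\<exists>\<phi>'. \<forall>z. \<phi>' (ctx k l z) = \<phi> (ctx k' l' z)"
    if "k' \<le> k" "1 \<le> l'" "l' \<le> l" for k' l' and \<phi> :: "bool list \<times> nat list \<Rightarrow> real"
  proof (intro exI allI)
    fix z
    have "ctx k l (SOME z'. ctx k l z' = ctx k l z) = ctx k l z" by (rule someI[of _ z]) simp
    from ctx_refine[OF that this]
    show "(\<lambda>c. \<phi> (ctx k' l' (SOME z'. ctx k l z' = c))) (ctx k l z) = \<phi> (ctx k' l' z)" by simp
  qed
  obtain \<phi>' where \<phi>': "\<And>z. \<phi>' (ctx k l z) = \<phi> (ctx k1 l1 z)"
    using factor[of k1 l1 \<phi>] 1 unfolding k_def l_def by auto
  obtain \<psi>' where \<psi>': "\<And>z. \<psi>' (ctx k l z) = \<psi> (ctx k2 l2 z)"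
    using factor[of k2 l2 \<psi>] 2 unfolding k_def l_def by auto
  have l: "1 \<le> l" "1 \<le> k" unfolding k_def l_def using 1 2 by auto
  have fi: "integrable P f" "integrable P g" using f g unfolding approximable_def by auto
  note ci = ctx_function_integrable[OF 1(2), of \<phi> k1] ctx_function_integrable[OF 2(2), of \<psi> k2]
    ctx_function_integrable[OF l(1), of "\<lambda>c. op (\<phi>' c) (\<psi>' c)" k]
  have "expectation (\<lambda>z. \<bar>op (f z) (g z) - op (\<phi>' (ctx k l z)) (\<psi>' (ctx k l z))\<bar>)
      \<le> expectation (\<lambda>z. \<bar>f z - \<phi> (ctx k1 l1 z)\<bar> + \<bar>g z - \<psi> (ctx k2 l2 z)\<bar>)"
    by (rule integral_mono) (use int fi ci op in \<open>auto simp: \<phi>' \<psi>'\<close>)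
  also have "\<dots> \<le> e" using 1(3) 2(3) fi ci by simp
  finally show "\<exists>k\<ge>1. \<exists>l\<ge>1. \<exists>\<phi>. expectation (\<lambda>z. \<bar>op (f z) (g z) - \<phi> (ctx k l z)\<bar>) \<le> e"
    using l by (intro exI[of _ k] exI[of _ l] exI[of _ "\<lambda>c. op (\<phi>' c) (\<psi>' c)"] conjI) auto
qed

lemma approximable_limit:
  assumes int: "integrable P f"
    and lim: "\<And>e. 0 < e \<Longrightarrow> \<exists>g. approximable g \<and> expectation (\<lambda>z. \<bar>f z - g z\<bar>) \<le> e"
  shows "approximable f"
  unfolding approximable_def
proof (intro conjI int allI impI)
  fix e :: real assume e: "0 < e"
  obtain g where g: "approximable g" "expectation (\<lambda>z. \<bar>f z - g z\<bar>) \<le> e / 2"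
    using lim[of "e / 2"] e by auto
  obtain k l \<phi> where kl: "1 \<le> k" "1 \<le> l" "expectation (\<lambda>z. \<bar>g z - \<phi> (ctx k l z)\<bar>) \<le> e / 2"
    using g(1) e unfolding approximable_def by (meson half_gt_zero)
  have gi: "integrable P g" using g(1) unfolding approximable_def by simp
  note ci = ctx_function_integrable[OF kl(2), of \<phi> k]
  have "expectation (\<lambda>z. \<bar>f z - \<phi> (ctx k l z)\<bar>)
      \<le> expectation (\<lambda>z. \<bar>f z - g z\<bar> + \<bar>g z - \<phi> (ctx k l z)\<bar>)"
    by (rule integral_mono) (use int gi ci in auto)
  also have "\<dots> \<le> e" using g(2) kl(3) int gi ci by simp
  finally show "\<exists>k\<ge>1. \<exists>l\<ge>1. \<exists>\<phi>. expectation (\<lambda>z. \<bar>f z - \<phi> (ctx k l z)\<bar>) \<le> e"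
    using kl by auto
qed

lemma approximable_const: "approximable (\<lambda>z. c)"
  using approximable_ctx[of 1 1 "\<lambda>_. c"] by simp

definition approx_algebra :: "(int \<Rightarrow> 'a \<times> bool) set set" where
  "approx_algebra = {B \<in> sets P. approximable (indicator B)}"

lemma indicator_integrable: "B \<in> sets P \<Longrightarrow> integrable P (indicator B :: _ \<Rightarrow> real)"
  by (rule integrable_const_bound[of _ 1]) (auto simp: indicator_def)

text \<open>Complements and finite unions are handled by \<open>approximable_combine\<close>; a countable union is the
  \<open>L\<^sup>1\<close> limit of its finite parts.\<close>

lemma approx_algebra_sigma: "sigma_algebra UNIV approx_algebra"
  unfolding sigma_algebra_iff2
proof (intro conjI ballI allI impI)
  show "approx_algebra \<subseteq> Pow UNIV" by simp
  show "{} \<in> approx_algebra"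
  proof -
    have "(indicator {} :: (int \<Rightarrow> 'a \<times> bool) \<Rightarrow> real) = (\<lambda>_. 0)" by auto
    then show ?thesis using approximable_const[of 0] by (simp add: approx_algebra_def)
  qed
next
  fix B assume B: "B \<in> approx_algebra"
  then have [measurable]: "B \<in> sets P" by (simp add: approx_algebra_def)
  have eq: "indicator (UNIV - B) = (\<lambda>z. 1 - indicator B z :: real)" by (auto simp: indicator_def)
  have "approximable (indicator (UNIV - B))"
    unfolding eq using B by (intro approximable_combine[OF approximable_const, where op = "(-)"])
      (auto simp: approx_algebra_def intro!: integrable_diff indicator_integrable)
  moreover have "UNIV - B \<in> sets P" using sets.compl_sets[of B P] by simp
  ultimately show "UNIV - B \<in> approx_algebra" unfolding approx_algebra_def by blast
next
  fix B :: "nat \<Rightarrow> _" assume B: "range B \<subseteq> approx_algebra"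
  then have [measurable]: "B n \<in> sets P" for n by (auto simp: approx_algebra_def)
  define U where "U n = (\<Union>i<n. B i)" for n
  have U_sets [measurable]: "U n \<in> sets P" for n unfolding U_def by auto
  have U_app: "approximable (indicator (U n))" for n
  proof (induction n)
    case 0
    have "(indicator (U 0) :: (int \<Rightarrow> 'a \<times> bool) \<Rightarrow> real) = (\<lambda>_. 0)" by (auto simp: U_def)
    then show ?case using approximable_const[of 0] by simp
  next
    case (Suc n)
    have eq: "indicator (U (Suc n)) = (\<lambda>z. max (indicator (U n) z) (indicator (B n) z) :: real)"
      by (auto simp: U_def indicator_def lessThan_Suc)
    have "approximable (indicator (B n))" using B by (auto simp: approx_algebra_def)
    with Suc have "approximable (\<lambda>z. max (indicator (U n) z) (indicator (B n) z))"
      by (rule approximable_combine) (auto intro!: integrable_max indicator_integrable)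
    then show ?case unfolding eq .
  qed
  have lim: "(\<lambda>n. prob (U n)) \<longlonglongrightarrow> prob (\<Union>n. B n)"
  proof -
    have "(\<lambda>n. prob (U n)) \<longlonglongrightarrow> prob (\<Union>n. U n)"
      by (rule finite_Lim_measure_incseq) (auto simp: incseq_def U_def subset_eq Bex_def intro: less_le_trans)
    also have "(\<Union>n. U n) = (\<Union>n. B n)" unfolding U_def by auto
    finally show ?thesis .
  qed
  have "approximable (indicator (\<Union>n. B n))"
  proof (rule approximable_limit)
    show "integrable P (indicator (\<Union>n. B n) :: _ \<Rightarrow> real)" by (rule indicator_integrable) auto
    fix e :: real assume "0 < e"
    then obtain n where n: "\<bar>prob (U n) - prob (\<Union>n. B n)\<bar> < e"
      using LIMSEQ_D[OF lim] by auto
    have "expectation (\<lambda>z. \<bar>indicator (\<Union>n. B n) z - indicator (U n) z\<bar>)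
        = expectation (\<lambda>z. indicator (\<Union>n. B n) z - indicator (U n) z :: real)"
      by (intro Bochner_Integration.integral_cong) (auto simp: U_def indicator_def)
    also have "\<dots> = prob (\<Union>n. B n) - prob (U n)"
      by (subst Bochner_Integration.integral_diff) (auto intro!: indicator_integrable)
    finally show "\<exists>g. approximable g \<and> expectation (\<lambda>z. \<bar>indicator (\<Union>n. B n) z - g z\<bar>) \<le> e"
      using n U_app[of n] by (intro exI[of _ "indicator (U n)"]) auto
  qed
  then show "(\<Union>n. B n) \<in> approx_algebra" by (auto simp: approx_algebra_def)
qed

text \<open>Every past coordinate is measurable for the approximable sets: labels occur in the contexts, and
  the cells that contain a past observation generate the Borel sets.\<close>

lemma past_subset_approx: "sets past \<subseteq> approx_algebra"
proof -
  define N where "N = measure_of UNIV approx_algebra (\<lambda>_. 0)"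
  have sets_N: "sets N = approx_algebra" and space_N: "space N = UNIV"
    unfolding N_def using sigma_algebra.sets_measure_of_eq[OF approx_algebra_sigma] by auto
  have ctx_sets: "{z. \<phi> (ctx k l z)} \<in> sets N" if "1 \<le> k" "1 \<le> l" for k l and \<phi> :: "_ \<Rightarrow> bool"
  proof -
    have "indicator {z. \<phi> (ctx k l z)} = (\<lambda>z. of_bool (\<phi> (ctx k l z)) :: real)"
      by (auto simp: indicator_def)
    moreover have "{z. \<phi> (ctx k l z)} \<in> sets P"
      using measurable_sets[OF ctx_measurable[OF that(2), of k], of "Collect \<phi>"] by (simp add: vimage_def)
    ultimately show ?thesis
      unfolding sets_N approx_algebra_def using approximable_ctx[OF that, of "\<lambda>c. of_bool (\<phi> c)"] by simp
  qed
  have "(\<lambda>z. z) \<in> N \<rightarrow>\<^sub>M past"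
  proof (rule measurable_into_past)
    fix i :: int assume i: "i < 0"
    have "{z. snd (z i)} = {z. fst (ctx (nat (- i)) 1 z) ! 0}"
      using i by (auto simp: ctx_def nth_append)
    moreover have "{z. fst (ctx (nat (- i)) 1 z) ! 0} \<in> sets N"
      by (rule ctx_sets) (use i in auto)
    ultimately have "{z\<in>space N. snd (z i)} \<in> sets N" by (simp add: space_N)
    then show "(\<lambda>z. snd (z i)) \<in> N \<rightarrow>\<^sub>M count_space UNIV" by (simp add: pred_def)
  next
    fix i :: int assume i: "i \<le> 0"
    show "(\<lambda>z. fst (z i)) \<in> N \<rightarrow>\<^sub>M borel"
    proof -
      have "(\<lambda>z. fst (z i)) \<in> N \<rightarrow>\<^sub>M sigma UNIV {G l -` {j} | l j. 1 \<le> l}"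
      proof (rule measurable_measure_of)
        fix B assume "B \<in> {G l -` {j} | l j. 1 \<le> l}"
        then obtain l j where B: "B = G l -` {j}" "1 \<le> l" by auto
        \<comment> \<open>With this \<open>k\<close>, coordinate \<open>i\<close> stands at position \<open>i + k = 1\<close> of the context; the successor ensures \<open>k \<ge> 1\<close>.\<close>
        define k where "k = Suc (nat (- i))"
        have "(\<lambda>z. fst (z i)) -` B \<inter> space N = {z. snd (ctx k l z) ! 1 = j}"
          using i unfolding B space_N ctx_def k_def by (auto simp del: upt_Suc)
        also have "\<dots> \<in> sets N" by (rule ctx_sets) (use B in \<open>auto simp: k_def\<close>)
        finally show "(\<lambda>z. fst (z i)) -` B \<inter> space N \<in> sets N" .
      qed auto
      then show ?thesis
      proof (rule measurable_mono[THEN subsetD, rotated -1])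
        show "sets (borel :: 'a measure) \<subseteq> sets (sigma UNIV {G l -` {j} | l j. 1 \<le> l})"
          using G_generates by simp
      qed auto
    qed
  qed
  from measurable_sets[OF this] show ?thesis
    by (auto simp: sets_N space_N)
qed

text \<open>Averaging the indicators of the level sets \<open>{label_prob \<ge> j/m}\<close>, \<open>j = 1, \<dots>, m\<close>, gives
  \<open>label_prob\<close> rounded down to a multiple of \<open>1/m\<close>.\<close>

lemma approximable_label_prob: "approximable label_prob"
proof (rule approximable_limit)
  show int: "integrable P label_prob" by (rule integrable_const_bound[of _ 1]) (use label_prob_bounds in auto)
  fix e :: real assume e: "0 < e"
  obtain n :: nat where n: "1 / real (Suc n) < e"
    using reals_Archimedean[OF e] by (auto simp: inverse_eq_divide)
  define m where "m = Suc n"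
  define B where "B j = {z. real j / real m \<le> label_prob z}" for j
  have B_past: "B j \<in> sets past" for j
  proof -
    have "{z\<in>space past. real j / real m \<le> label_prob z} \<in> sets past" by measurable
    then show ?thesis by (simp add: B_def)
  qed
  have B_sets [measurable]: "B j \<in> sets P" for j
    using B_past[of j] subalgebra_past by (auto simp: subalgebra_def)
  have B_app: "approximable (indicator (B j))" for j
    using B_past[of j] past_subset_approx by (auto simp: approx_algebra_def)
  define g where "g r z = (\<Sum>j=1..r. indicator (B j) z / real m)" for r z
  have g_int: "integrable P (g r)" for r
    unfolding g_def by (auto intro!: integrable_sum integrable_divide indicator_integrable)
  have g_app: "approximable (g r)" for r
  proof (induction r)
    case 0
    then show ?case using approximable_const[of 0] by (simp add: g_def)
  next
    case (Suc r)
    have op: "\<bar>(a + b / real m) - (a' + b' / real m)\<bar> \<le> \<bar>a - a'\<bar> + \<bar>b - b'\<bar>" for a b a' b' :: real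
    proof -
      have "\<bar>(b - b') / real m\<bar> \<le> \<bar>b - b'\<bar>"
        unfolding abs_divide m_def by (simp add: divide_le_eq mult_le_cancel_left1)
      then show ?thesis by (simp add: diff_divide_distrib)
    qed
    have eq: "g (Suc r) = (\<lambda>z. g r z + indicator (B (Suc r)) z / real m)" by (auto simp: g_def)
    show ?case unfolding eq
      by (rule approximable_combine[OF Suc B_app[of "Suc r"], where op = "\<lambda>a b. a + b / real m"])
         (use op g_int in \<open>auto intro!: indicator_integrable integrable_divide\<close>)
  qed
  have close: "\<bar>label_prob z - g m z\<bar> \<le> 1 / real m" for z
  proof -
    define q where "q = nat \<lfloor>label_prob z * real m\<rfloor>"
    have m: "0 < real m" by (simp add: m_def)
    have pm: "0 \<le> label_prob z * real m" "label_prob z * real m \<le> real m" using label_prob_bounds[of z] m by (auto simp: mult_left_le_one_le)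
    then have q: "real q \<le> label_prob z * real m" "label_prob z * real m < real q + 1" unfolding q_def by linarith+
    then have "q \<le> m" using pm by linarith
    have "indicator (B j) z = (if j \<le> q then 1 else 0 :: real)" for j
    proof -
      have "real j / real m \<le> label_prob z \<longleftrightarrow> real j \<le> label_prob z * real m" using m by (simp add: divide_le_eq)
      also have "\<dots> \<longleftrightarrow> j \<le> q"
      proof
        assume "real j \<le> label_prob z * real m"
        then have "real j < real (q + 1)" using q by simp
        then show "j \<le> q" by (simp only: of_nat_less_iff)
      next
        assume "j \<le> q"
        then have "real j \<le> real q" by simp
        then show "real j \<le> label_prob z * real m" using q by linarith
      qed
      finally show ?thesis by (auto simp: B_def)
    qed
    then have "g m z = (\<Sum>j\<in>{1..m}. if j \<le> q then 1 else 0) / real m"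
      unfolding g_def sum_divide_distrib by simp
    also have "(\<Sum>j\<in>{1..m}. if j \<le> q then 1 else 0 :: real) = (\<Sum>j\<in>{1..q}. 1)"
      using \<open>q \<le> m\<close> by (intro sum.mono_neutral_cong_right) auto
    finally have "g m z = real q / real m" by simp
    moreover have "label_prob z - real q / real m = (label_prob z * real m - real q) / real m" using m by (simp add: field_simps)
    ultimately show ?thesis using q m by (simp add: divide_right_mono)
  qed
  have "expectation (\<lambda>z. \<bar>label_prob z - g m z\<bar>) \<le> expectation (\<lambda>z. 1 / real m)"
    by (rule integral_mono) (use close int g_int in auto)
  also have "\<dots> \<le> e" using n prob_space by (simp add: m_def)
  finally show "\<exists>g. approximable g \<and> expectation (\<lambda>z. \<bar>label_prob z - g z\<bar>) \<le> e"
    using g_app[of m] by blast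
qed

definition ctx_prob :: "nat \<Rightarrow> nat \<Rightarrow> bool list \<times> nat list \<Rightarrow> real" where
  "ctx_prob k l c = prob {z. ctx k l z = c}"

text \<open>The elementary conditional probability of label 1 given the context; it is 0 for a context of
  probability 0.\<close>

definition cond_label :: "nat \<Rightarrow> nat \<Rightarrow> bool list \<times> nat list \<Rightarrow> real" where
  "cond_label k l c = expectation (\<lambda>z. of_bool (ctx k l z = c) * label_prob z) / ctx_prob k l c"

lemma ctx_prob_expectation: "1 \<le> l \<Longrightarrow> expectation (\<lambda>z. of_bool (ctx k l z = c)) = ctx_prob k l c"
proof -
  assume l: "1 \<le> l"
  have [measurable]: "{z. ctx k l z = c} \<in> sets P"
    using measurable_sets[OF ctx_measurable[OF l, of k], of "{c}"] by (simp add: vimage_def)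
  have "(\<lambda>z. of_bool (ctx k l z = c) :: real) = indicator {z. ctx k l z = c}" by (auto simp: indicator_def)
  then show ?thesis unfolding ctx_prob_def by simp
qed

lemma ctx_label_prob_integrable: "1 \<le> l \<Longrightarrow> integrable P (\<lambda>z. of_bool (ctx k l z = c) * label_prob z)"
  by (rule integrable_const_bound[of _ 1]) (use label_prob_bounds in \<open>auto simp: of_bool_def\<close>)

lemma cond_label_times:
  assumes l: "1 \<le> l"
  shows "cond_label k l c * ctx_prob k l c = expectation (\<lambda>z. of_bool (ctx k l z = c) * label_prob z)"
proof (cases "ctx_prob k l c = 0")
  case True
  have "expectation (\<lambda>z. of_bool (ctx k l z = c) * label_prob z) \<le> expectation (\<lambda>z. of_bool (ctx k l z = c))"
    by (rule integral_mono[OF ctx_label_prob_integrable[OF l] ctx_function_integrable[OF l]])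
       (use label_prob_bounds in auto)
  moreover have "0 \<le> expectation (\<lambda>z. of_bool (ctx k l z = c) * label_prob z)"
    by (rule integral_nonneg_AE) (use label_prob_bounds in auto)
  ultimately show ?thesis using True ctx_prob_expectation[OF l] by simp
qed (simp add: cond_label_def)

text \<open>On each context, the difference between \<open>cond_label\<close> and a constant is at most the average
  distance of \<open>label_prob\<close> from that constant. Hence \<open>cond_label\<close> is at most twice as far from
  \<open>label_prob\<close> in \<open>L\<^sup>1\<close> as any other function of the context.\<close>

lemma cond_label_approx:
  assumes e: "0 < e"
  shows "\<exists>k\<ge>1. \<exists>l\<ge>1. expectation (\<lambda>z. \<bar>label_prob z - cond_label k l (ctx k l z)\<bar>) \<le> e"
proof -
  obtain k l \<phi> where kl: "1 \<le> k" "1 \<le> l" and \<phi>: "expectation (\<lambda>z. \<bar>label_prob z - \<phi> (ctx k l z)\<bar>) \<le> e / 2"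
    using approximable_label_prob e unfolding approximable_def by (meson half_gt_zero)
  let ?R = "range (ctx k l)"
  have fin: "finite ?R" by (rule ctx_finite[OF kl(2)])
  have decomp: "f z = (\<Sum>c\<in>?R. of_bool (ctx k l z = c) * f z)" for f :: "_ \<Rightarrow> real" and z
    unfolding sum_distrib_right[symmetric] using fin by (simp add: of_bool_def sum.delta)
  have label_prob_int: "integrable P label_prob" by (rule integrable_const_bound[of _ 1]) (use label_prob_bounds in auto)
  note ci = ctx_function_integrable[OF kl(2), of _ k]
  \<comment> \<open>Contribution of the context \<open>c\<close> to the distance between \<open>\<phi>\<close> and the conditional probability.\<close>
  have part: "expectation (\<lambda>z. of_bool (ctx k l z = c) * \<bar>\<phi> c - cond_label k l c\<bar>)
      \<le> expectation (\<lambda>z. of_bool (ctx k l z = c) * \<bar>label_prob z - \<phi> (ctx k l z)\<bar>)" for c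
  proof -
    have ii: "integrable P (\<lambda>z. of_bool (ctx k l z = c) * label_prob z - of_bool (ctx k l z = c) * \<phi> c)"
      using ctx_label_prob_integrable[OF kl(2), of k c] ci[of "\<lambda>c'. of_bool (c' = c) * \<phi> c"] by simp
    have "expectation (\<lambda>z. of_bool (ctx k l z = c) * \<bar>\<phi> c - cond_label k l c\<bar>)
        = \<bar>\<phi> c - cond_label k l c\<bar> * ctx_prob k l c"
      using ctx_prob_expectation[OF kl(2), of k c] by simp
    also have "\<dots> = \<bar>cond_label k l c * ctx_prob k l c - \<phi> c * ctx_prob k l c\<bar>"
    proof -
      have "0 \<le> ctx_prob k l c" by (simp add: ctx_prob_def)
      then have "\<bar>\<phi> c - cond_label k l c\<bar> * ctx_prob k l c = \<bar>cond_label k l c - \<phi> c\<bar> * \<bar>ctx_prob k l c\<bar>"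
        by (simp add: abs_minus_commute)
      then show ?thesis by (simp only: abs_mult[symmetric] left_diff_distrib)
    qed
    also have "\<dots> = \<bar>expectation (\<lambda>z. of_bool (ctx k l z = c) * label_prob z - of_bool (ctx k l z = c) * \<phi> c)\<bar>"
      unfolding cond_label_times[OF kl(2)]
      using ctx_label_prob_integrable[OF kl(2), of k c] ci[of "\<lambda>c'. of_bool (c' = c) * \<phi> c"] ctx_prob_expectation[OF kl(2), of k c]
      by (simp add: mult.commute)
    also have "\<dots> \<le> expectation (\<lambda>z. \<bar>of_bool (ctx k l z = c) * label_prob z - of_bool (ctx k l z = c) * \<phi> c\<bar>)"
      by (rule integral_abs_bound)
    also have "\<dots> = expectation (\<lambda>z. of_bool (ctx k l z = c) * \<bar>label_prob z - \<phi> (ctx k l z)\<bar>)"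
      by (rule Bochner_Integration.integral_cong) auto
    finally show ?thesis .
  qed
  have "expectation (\<lambda>z. \<bar>\<phi> (ctx k l z) - cond_label k l (ctx k l z)\<bar>)
      = expectation (\<lambda>z. \<Sum>c\<in>?R. of_bool (ctx k l z = c) * \<bar>\<phi> c - cond_label k l c\<bar>)"
    by (subst decomp) (intro Bochner_Integration.integral_cong sum.cong, auto)
  also have "\<dots> = (\<Sum>c\<in>?R. expectation (\<lambda>z. of_bool (ctx k l z = c) * \<bar>\<phi> c - cond_label k l c\<bar>))"
    by (rule Bochner_Integration.integral_sum) (rule ci)
  also have "\<dots> \<le> (\<Sum>c\<in>?R. expectation (\<lambda>z. of_bool (ctx k l z = c) * \<bar>label_prob z - \<phi> (ctx k l z)\<bar>))"
    by (intro sum_mono part)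
  also have "\<dots> = expectation (\<lambda>z. \<Sum>c\<in>?R. of_bool (ctx k l z = c) * \<bar>label_prob z - \<phi> (ctx k l z)\<bar>)"
  proof (rule Bochner_Integration.integral_sum[symmetric])
    fix c
    show "integrable P (\<lambda>z. of_bool (ctx k l z = c) * \<bar>label_prob z - \<phi> (ctx k l z)\<bar>)"
      by (rule Bochner_Integration.integrable_bound[where f = "\<lambda>z. \<bar>label_prob z - \<phi> (ctx k l z)\<bar>"])
         (use label_prob_int ci kl in auto)
  qed
  also have "\<dots> = expectation (\<lambda>z. \<bar>label_prob z - \<phi> (ctx k l z)\<bar>)"
    by (subst decomp[symmetric]) simp
  finally have second: "expectation (\<lambda>z. \<bar>\<phi> (ctx k l z) - cond_label k l (ctx k l z)\<bar>) \<le> e / 2"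
    using \<phi> by simp
  have "expectation (\<lambda>z. \<bar>label_prob z - cond_label k l (ctx k l z)\<bar>)
      \<le> expectation (\<lambda>z. \<bar>label_prob z - \<phi> (ctx k l z)\<bar> + \<bar>\<phi> (ctx k l z) - cond_label k l (ctx k l z)\<bar>)"
    by (rule integral_mono) (use label_prob_int ci in auto)
  also have "\<dots> \<le> e"
    using \<phi> second label_prob_int ci by simp
  finally show ?thesis using kl by blast
qed

end

section \<open>Asymptotics of the mixed loss\<close>

context quantized_ergodic_path
begin

abbreviation xs :: "(int \<Rightarrow> 'a \<times> bool) \<Rightarrow> nat \<Rightarrow> 'a" where "xs z \<equiv> \<lambda>i. fst (z (int i))"
abbreviation ys :: "(int \<Rightarrow> 'a \<times> bool) \<Rightarrow> nat \<Rightarrow> bool" where "ys z \<equiv> \<lambda>i. snd (z (int i))"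

lemma cond_label_bounds:
  assumes l: "1 \<le> l"
  shows "0 \<le> cond_label k l c" "cond_label k l c \<le> 1"
proof -
  have "0 \<le> expectation (\<lambda>z. of_bool (ctx k l z = c) * label_prob z)"
    by (rule integral_nonneg_AE) (use label_prob_bounds in auto)
  then show "0 \<le> cond_label k l c" unfolding cond_label_def ctx_prob_def by simp
  have "expectation (\<lambda>z. of_bool (ctx k l z = c) * label_prob z) \<le> expectation (\<lambda>z. of_bool (ctx k l z = c))"
    by (rule integral_mono[OF ctx_label_prob_integrable[OF l] ctx_function_integrable[OF l]])
       (use label_prob_bounds in auto)
  then show "cond_label k l c \<le> 1"
    unfolding cond_label_def ctx_prob_expectation[OF l]
    by (simp add: divide_le_eq_1 ctx_prob_def less_le)
qed

text \<open>Both counts, divided by \<open>n\<close>, converge by the ergodic theorem. The limit of the numerator is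
  computed from the orthogonality of the innovation, since having context \<open>c\<close> is an event of the
  past.\<close>

lemma false_freq_tendsto:
  assumes l: "1 \<le> l" and c: "ctx_prob k l c > 0"
  shows "AE z in P. (\<lambda>n. false_freq G k l (xs z) (ys z) c n) \<longlonglongrightarrow> 1 - cond_label k l c"
proof -
  define f1 f2 :: "(int \<Rightarrow> 'a \<times> bool) \<Rightarrow> real" where "f1 z = of_bool (ctx k l z = c)"
    and "f2 z = of_bool (ctx k l z = c \<and> \<not> snd (z 0))" for z
  note [measurable] = ctx_measurable[OF l]
  have meas [measurable]: "f1 \<in> borel_measurable P" "f2 \<in> borel_measurable P"
    unfolding f1_def f2_def by measurable
  have f1_past: "f1 \<in> borel_measurable past"
    unfolding f1_def by (rule measurable_compose[OF ctx_past[OF l]]) auto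
  have i1: "integrable P f1" "integrable P f2" "integrable P (\<lambda>z. f1 z * label_prob z)"
    "integrable P (\<lambda>z. f1 z * of_bool (snd (z 0)))"
    by (rule integrable_const_bound[of _ 1]; use label_prob_bounds in \<open>auto simp: f1_def f2_def\<close>)+
  have E1: "expectation f1 = ctx_prob k l c"
    unfolding f1_def by (rule ctx_prob_expectation[OF l])
  have "expectation (\<lambda>z. f1 z * (of_bool (snd (z 0)) - label_prob z)) = 0"
    by (rule label_prob_integral[OF f1_past, of 1]) (simp add: f1_def)
  then have "expectation (\<lambda>z. f1 z * of_bool (snd (z 0))) = cond_label k l c * ctx_prob k l c"
    using i1 cond_label_times[OF l, of k c] by (simp add: right_diff_distrib f1_def)
  moreover have "f2 = (\<lambda>z. f1 z - f1 z * of_bool (snd (z 0)))"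
    by (auto simp: f1_def f2_def)
  ultimately have E2: "expectation f2 = (1 - cond_label k l c) * ctx_prob k l c"
    using i1 E1 by (simp add: algebra_simps)
  have "AE z in P. (\<lambda>n. (\<Sum>i=1..n. f1 ((shift ^^ i) z)) / real n) \<longlonglongrightarrow> ctx_prob k l c"
    unfolding E1[symmetric] by (rule birkhoff_bounded[of _ 1]) (auto simp: f1_def)
  moreover have "AE z in P. (\<lambda>n. (\<Sum>i=1..n. f2 ((shift ^^ i) z)) / real n)
      \<longlonglongrightarrow> (1 - cond_label k l c) * ctx_prob k l c"
    unfolding E2[symmetric] by (rule birkhoff_bounded[of _ 1]) (auto simp: f2_def)
  ultimately show ?thesis
  proof eventually_elim
    case (elim z)
    define F1 F2 where "F1 n = (\<Sum>i\<in>{k<..<n}. f1 ((shift ^^ i) z))"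
      and "F2 n = (\<Sum>i\<in>{k<..<n}. f2 ((shift ^^ i) z))" for n
    have l1: "(\<lambda>n. F1 n / real n) \<longlonglongrightarrow> ctx_prob k l c"
      unfolding F1_def by (rule average_inner_interval[OF elim(1)]) (simp add: f1_def)
    have l2: "(\<lambda>n. F2 n / real n) \<longlonglongrightarrow> (1 - cond_label k l c) * ctx_prob k l c"
      unfolding F2_def by (rule average_inner_interval[OF elim(2)]) (simp add: f2_def)
    have lim: "(\<lambda>n. (F2 n / real n) / (F1 n / real n)) \<longlonglongrightarrow> 1 - cond_label k l c"
      using tendsto_divide[OF l2 l1] c by simp
    have ff: "false_freq G k l (xs z) (ys z) c n = (if n \<le> k + 1 \<or> F1 n = 0 then 1/2 else F2 n / F1 n)" for n
    proof -
      have "(\<Sum>i\<in>{k<..<n}. of_bool (local_context G k l (xs z) (ys z) i = c)) = F1 n"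
        unfolding F1_def f1_def by (intro sum.cong) (auto simp: local_context_eq_ctx)
      moreover have "(\<Sum>i\<in>{k<..<n}. of_bool (local_context G k l (xs z) (ys z) i = c \<and> \<not> ys z i)) = F2 n"
        unfolding F2_def f2_def by (intro sum.cong) (auto simp: local_context_eq_ctx funpow_shift)
      ultimately show ?thesis unfolding false_freq_def Let_def by simp
    qed
    have "\<forall>\<^sub>F n in sequentially. 0 < F1 n / real n" using order_tendstoD(1)[OF l1 c] .
    moreover have "\<forall>\<^sub>F n in sequentially. k + 1 < n" by (rule eventually_gt_at_top)
    ultimately have "\<forall>\<^sub>F n in sequentially. (F2 n / real n) / (F1 n / real n)
        = false_freq G k l (xs z) (ys z) c n"
      by eventually_elim (auto simp: ff)
    then show ?case using lim by (rule Lim_transform_eventually[rotated])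
  qed
qed

lemma context_positive:
  assumes l: "1 \<le> l"
  shows "AE z in P. \<forall>i. ctx_prob k l (ctx k l ((shift ^^ i) z)) > 0"
proof (subst AE_all_countable, rule allI)
  fix i
  have "AE z in P. \<forall>c. ctx_prob k l c = 0 \<longrightarrow> ctx k l z \<noteq> c"
  proof (subst AE_all_countable, rule allI)
    fix c
    have [measurable]: "{z. ctx k l z = c} \<in> sets P"
      using measurable_sets[OF ctx_measurable[OF l, of k], of "{c}"] by (simp add: vimage_def)
    show "AE z in P. ctx_prob k l c = 0 \<longrightarrow> ctx k l z \<noteq> c"
    proof (cases "ctx_prob k l c = 0")
      case True
      then have "AE z in P. z \<notin> {z. ctx k l z = c}"
        unfolding ctx_prob_def by (subst (asm) prob_eq_0) auto
      then show ?thesis by simp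
    qed simp
  qed
  then have "AE z in P. ctx_prob k l (ctx k l z) > 0"
  proof eventually_elim
    case (elim z)
    then have "ctx_prob k l (ctx k l z) \<noteq> 0" by blast
    then show ?case by (simp add: ctx_prob_def zero_less_measure_iff)
  qed
  then show "AE z in P. ctx_prob k l (ctx k l ((shift ^^ i) z)) > 0" by (rule AE_funpow)
qed

text \<open>There are finitely many contexts, so the convergence of the estimates is uniform over those of
  positive probability, and almost surely no other context ever occurs.\<close>

lemma context_estimate_consistent:
  assumes l: "1 \<le> l"
  shows "AE z in P. (\<lambda>i. \<bar>cond_label k l (ctx k l ((shift ^^ i) z))
      - (1 - false_freq G k l (xs z) (ys z) (local_context G k l (xs z) (ys z) i) i)\<bar>) \<longlonglongrightarrow> 0"
proof -
  have "AE z in P. \<forall>c. ctx_prob k l c > 0 \<longrightarrow>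
      (\<lambda>n. false_freq G k l (xs z) (ys z) c n) \<longlonglongrightarrow> 1 - cond_label k l c"
    unfolding AE_all_countable using false_freq_tendsto[OF l] by simp
  with context_positive[OF l, of k] show ?thesis
  proof eventually_elim
    case (elim z)
    define R where "R = {c \<in> range (ctx k l). ctx_prob k l c > 0}"
    have fin: "finite R" unfolding R_def using ctx_finite[OF l, of k] by simp
    define d where "d c n = \<bar>cond_label k l c - (1 - false_freq G k l (xs z) (ys z) c n)\<bar>" for c n
    have "(\<lambda>n. d c n) \<longlonglongrightarrow> 0" if "c \<in> R" for c
    proof -
      have "(\<lambda>n. d c n) \<longlonglongrightarrow> \<bar>cond_label k l c - (1 - (1 - cond_label k l c))\<bar>"
        unfolding d_def by (intro tendsto_intros elim(2)[rule_format]) (use that in \<open>simp add: R_def\<close>)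
      then show ?thesis by simp
    qed
    then have lim: "(\<lambda>n. \<Sum>c\<in>R. d c n) \<longlonglongrightarrow> 0" by (rule tendsto_null_sum)
    show ?case
    proof (rule Lim_null_comparison[OF _ lim])
      show "\<forall>\<^sub>F i in sequentially. norm \<bar>cond_label k l (ctx k l ((shift ^^ i) z))
          - (1 - false_freq G k l (xs z) (ys z) (local_context G k l (xs z) (ys z) i) i)\<bar> \<le> (\<Sum>c\<in>R. d c i)"
      proof (rule eventually_sequentiallyI[of "Suc k"])
        fix i assume "Suc k \<le> i"
        then have eq: "local_context G k l (xs z) (ys z) i = ctx k l ((shift ^^ i) z)"
          by (intro local_context_eq_ctx) simp
        have "ctx k l ((shift ^^ i) z) \<in> R" using elim(1) by (simp add: R_def)
        then have "d (ctx k l ((shift ^^ i) z)) i \<le> (\<Sum>c\<in>R. d c i)"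
          using fin by (intro member_le_sum) (auto simp: d_def)
        then show "norm \<bar>cond_label k l (ctx k l ((shift ^^ i) z))
          - (1 - false_freq G k l (xs z) (ys z) (local_context G k l (xs z) (ys z) i) i)\<bar> \<le> (\<Sum>c\<in>R. d c i)"
          unfolding eq d_def by simp
      qed
    qed
  qed
qed

definition bayes_risk :: real where
  "bayes_risk = expectation (\<lambda>z. min (label_prob z) (1 - label_prob z))"

lemma bayes_average:
  "AE z in P. (\<lambda>n. (\<Sum>i=1..n. min (label_prob ((shift ^^ i) z)) (1 - label_prob ((shift ^^ i) z))) / real n) \<longlonglongrightarrow> bayes_risk"
  unfolding bayes_risk_def
  by (rule birkhoff_bounded[of "\<lambda>z. min (label_prob z) (1 - label_prob z)" 1]) (use label_prob_bounds in \<open>auto simp: min_def\<close>)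

lemma unshift_coord: "unshift i z (int j) = z (int j - int i)"
  by (simp add: unshift_def)

text \<open>The loss of the expert is at most innovation plus Bayes loss plus twice the distance of
  \<open>label_prob\<close> from \<open>cond_label\<close> plus twice the estimation error. The averages of the four terms
  converge.\<close>

lemma expert_average_upper:
  assumes k: "1 \<le> k" and l: "1 \<le> l"
  shows "AE z in P. \<exists>b. b \<longlonglongrightarrow> bayes_risk + 2 * expectation (\<lambda>z. \<bar>label_prob z - cond_label k l (ctx k l z)\<bar>) \<and>
    (\<forall>n. (\<Sum>i=1..n. expert_err G (xs z) (ys z) (k, l) i) / real n \<le> b n)"
proof -
  define h where "h z i = (of_bool (expert_seq G k l (xs z) (ys z) i) :: real)" for z i
  have "(\<lambda>z. 1 - 2 * h (unshift i z) i) \<in> borel_measurable past" if "1 \<le> i" for i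
  proof -
    have [measurable]: "(\<lambda>z. expert_seq G k l (xs (unshift i z)) (ys (unshift i z)) i) \<in> past \<rightarrow>\<^sub>M count_space UNIV"
      unfolding unshift_coord
      by (rule expert_seq_measurable[where x = "\<lambda>z j. fst (z (int j - int i))" and y = "\<lambda>z j. snd (z (int j - int i))"])
         (auto intro!: G_measurable l fst_past snd_past)
    show ?thesis unfolding h_def by measurable
  qed
  then have noise: "AE z in P. (\<lambda>n. (\<Sum>i=1..n. (1 - 2 * h z i) * (of_bool (snd (z (int i))) - label_prob ((shift ^^ i) z))) / real n) \<longlonglongrightarrow> 0"
    by (rule noise_average) (auto simp: h_def)
  have D_bound: "\<bar>\<bar>label_prob z - cond_label k l (ctx k l z)\<bar>\<bar> \<le> 1" for z
    using label_prob_bounds[of z] cond_label_bounds[OF l, of k "ctx k l z"] by auto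
  have approx: "AE z in P. (\<lambda>n. (\<Sum>i=1..n. \<bar>label_prob ((shift ^^ i) z) - cond_label k l (ctx k l ((shift ^^ i) z))\<bar>) / real n)
      \<longlonglongrightarrow> expectation (\<lambda>z. \<bar>label_prob z - cond_label k l (ctx k l z)\<bar>)"
    by (rule birkhoff_bounded[of "\<lambda>z. \<bar>label_prob z - cond_label k l (ctx k l z)\<bar>" 1])
       (use D_bound l in auto)
  show ?thesis using noise approx bayes_average context_estimate_consistent[OF l, of k]
  proof eventually_elim
    case (elim z)
    define d where "d i = \<bar>cond_label k l (ctx k l ((shift ^^ i) z))
      - (1 - false_freq G k l (xs z) (ys z) (local_context G k l (xs z) (ys z) i) i)\<bar>" for i
    define u where "u i = (1 - 2 * h z i) * (of_bool (snd (z (int i))) - label_prob ((shift ^^ i) z))" for i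
    define r where "r i = min (label_prob ((shift ^^ i) z)) (1 - label_prob ((shift ^^ i) z))" for i
    define a where "a i = \<bar>label_prob ((shift ^^ i) z) - cond_label k l (ctx k l ((shift ^^ i) z))\<bar>" for i
    have pointwise: "expert_err G (xs z) (ys z) (k, l) i \<le> u i + r i + 2 * a i + 2 * d i" for i
    proof -
      let ?f = "false_freq G k l (xs z) (ys z) (local_context G k l (xs z) (ys z) i) i"
      let ?label_prob = "label_prob ((shift ^^ i) z)"
      have h: "h z i = of_bool (?f \<le> 1/2)" unfolding h_def expert_seq_iff ..
      have "expert_err G (xs z) (ys z) (k, l) i = \<bar>of_bool (snd (z (int i))) - h z i\<bar>"
        by (auto simp: expert_err_def h_def)
      also have "\<dots> = (h z i * (1 - ?label_prob) + (1 - h z i) * ?label_prob) + u i"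
        unfolding u_def by (rule mixed_loss_split) (auto simp: h_def)
      also have "\<dots> \<le> (r i + 2 * \<bar>?label_prob - (1 - ?f)\<bar>) + u i"
        unfolding h r_def by (intro add_right_mono plug_in_le_bayes)
      also have "\<bar>?label_prob - (1 - ?f)\<bar> \<le> a i + d i" unfolding a_def d_def by linarith
      finally show ?thesis by simp
    qed
    let ?b = "\<lambda>n. (\<Sum>i=1..n. u i) / real n + (\<Sum>i=1..n. r i) / real n
        + 2 * ((\<Sum>i=1..n. a i) / real n) + 2 * ((\<Sum>i=1..n. d i) / real n)"
    have "?b \<longlonglongrightarrow> 0 + bayes_risk + 2 * expectation (\<lambda>z. \<bar>label_prob z - cond_label k l (ctx k l z)\<bar>) + 2 * 0"
      using elim cesaro_null[OF elim(4)] unfolding u_def r_def a_def d_def by (intro tendsto_intros)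
    moreover have "(\<Sum>i=1..n. expert_err G (xs z) (ys z) (k, l) i) / real n \<le> ?b n" for n
    proof -
      have "(\<Sum>i=1..n. expert_err G (xs z) (ys z) (k, l) i) / real n \<le> (\<Sum>i=1..n. u i + r i + 2 * a i + 2 * d i) / real n"
        by (intro divide_right_mono sum_mono pointwise) simp
      also have "\<dots> = ?b n" by (simp add: sum.distrib sum_distrib_left add_divide_distrib)
      finally show ?thesis .
    qed
    ultimately show ?case by (intro exI[of _ ?b]) simp
  qed
qed

lemma mixed_average_lower:
  "AE z in P. \<exists>b. b \<longlonglongrightarrow> bayes_risk \<and> (\<forall>n. b n \<le> (\<Sum>i=1..n. mixed_loss G (xs z) (ys z) i) / real n)"
proof -
  have "(\<lambda>z. 1 - 2 * vote G (xs (unshift i z)) (ys (unshift i z)) i) \<in> borel_measurable past" if "1 \<le> i" for i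
  proof -
    have [measurable]: "(\<lambda>z. vote G (xs (unshift i z)) (ys (unshift i z)) i) \<in> borel_measurable past"
      unfolding unshift_coord
      by (rule vote_measurable[where x = "\<lambda>z j. fst (z (int j - int i))" and y = "\<lambda>z j. snd (z (int j - int i))"])
         (use that in \<open>auto intro!: G_measurable fst_past snd_past\<close>)
    show ?thesis by measurable
  qed
  then have noise: "AE z in P. (\<lambda>n. (\<Sum>i=1..n. (1 - 2 * vote G (xs z) (ys z) i) * (of_bool (snd (z (int i))) - label_prob ((shift ^^ i) z))) / real n) \<longlonglongrightarrow> 0"
  proof (rule noise_average)
    show "\<bar>1 - 2 * vote G (xs z) (ys z) i\<bar> \<le> 1" if "1 \<le> i" for i z
      using vote_bounds[OF that, of G "xs z" "ys z"] by auto
  qed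
  then show ?thesis using bayes_average
  proof eventually_elim
    case (elim z)
    define u where "u i = (1 - 2 * vote G (xs z) (ys z) i) * (of_bool (snd (z (int i))) - label_prob ((shift ^^ i) z))" for i
    define r where "r i = min (label_prob ((shift ^^ i) z)) (1 - label_prob ((shift ^^ i) z))" for i
    have pointwise: "u i + r i \<le> mixed_loss G (xs z) (ys z) i" if "1 \<le> i" for i
      unfolding mixed_loss_def u_def r_def
      using vote_bounds[OF that, of G "xs z" "ys z"] bayes_le_mixed[of "vote G (xs z) (ys z) i" "label_prob ((shift ^^ i) z)"]
        mixed_loss_split[of "vote G (xs z) (ys z) i" "ys z i" "label_prob ((shift ^^ i) z)"] by auto
    let ?b = "\<lambda>n. (\<Sum>i=1..n. u i) / real n + (\<Sum>i=1..n. r i) / real n"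
    have "?b \<longlonglongrightarrow> 0 + bayes_risk"
      using elim unfolding u_def r_def by (intro tendsto_intros)
    moreover have "?b n \<le> (\<Sum>i=1..n. mixed_loss G (xs z) (ys z) i) / real n" for n
    proof -
      have "?b n = (\<Sum>i=1..n. u i + r i) / real n" by (simp add: sum.distrib add_divide_distrib)
      also have "\<dots> \<le> (\<Sum>i=1..n. mixed_loss G (xs z) (ys z) i) / real n"
        by (intro divide_right_mono sum_mono pointwise) auto
      finally show ?thesis .
    qed
    ultimately show ?case by (intro exI[of _ ?b]) simp
  qed
qed

text \<open>Bounded below by the Bayes risk directly, and above by comparison with experts whose contexts
  approximate the past ever better.\<close>

theorem mixed_loss_tendsto:
  "AE z in P. (\<lambda>n. (\<Sum>i=1..n. mixed_loss G (xs z) (ys z) i) / real n) \<longlonglongrightarrow> bayes_risk"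
proof -
  have "AE z in P. \<forall>k l. 1 \<le> k \<and> 1 \<le> l \<longrightarrow>
      (\<exists>b. b \<longlonglongrightarrow> bayes_risk + 2 * expectation (\<lambda>z. \<bar>label_prob z - cond_label k l (ctx k l z)\<bar>) \<and>
        (\<forall>n. (\<Sum>i=1..n. expert_err G (xs z) (ys z) (k, l) i) / real n \<le> b n))"
    unfolding AE_all_countable using expert_average_upper by simp
  with mixed_average_lower show ?thesis
  proof eventually_elim
    case (elim z)
    define A where "A n = (\<Sum>i=1..n. mixed_loss G (xs z) (ys z) i) / real n" for n
    have "A \<longlonglongrightarrow> bayes_risk"
    proof (rule order_tendstoI)
      fix t assume t: "t < bayes_risk"
      obtain b where b: "b \<longlonglongrightarrow> bayes_risk" "\<And>n. b n \<le> A n" using elim(1) unfolding A_def by blast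
      have "\<forall>\<^sub>F n in sequentially. t < b n" by (rule order_tendstoD(1)[OF b(1) t])
      then show "\<forall>\<^sub>F n in sequentially. t < A n"
        by (rule eventually_mono) (use b(2) less_le_trans in blast)
    next
      fix t assume t: "bayes_risk < t"
      define e where "e = t - bayes_risk"
      have e: "0 < e" using t by (simp add: e_def)
      obtain k l where kl: "1 \<le> k" "1 \<le> l" "expectation (\<lambda>z. \<bar>label_prob z - cond_label k l (ctx k l z)\<bar>) \<le> e / 8"
        using cond_label_approx[of "e / 8"] e by auto
      obtain b where b: "b \<longlonglongrightarrow> bayes_risk + 2 * expectation (\<lambda>z. \<bar>label_prob z - cond_label k l (ctx k l z)\<bar>)"
        "\<And>n. (\<Sum>i=1..n. expert_err G (xs z) (ys z) (k, l) i) / real n \<le> b n"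
        using elim(2) kl by blast
      obtain C where C: "\<And>n. (\<Sum>i=1..n. mixed_loss G (xs z) (ys z) i)
          \<le> (\<Sum>i=1..n. expert_err G (xs z) (ys z) (k, l) i) + C + (e / 4) * real n"
        using regret_bound[OF kl(1,2), of "e / 4" G] e by auto
      have "(\<lambda>n. b n + C * (1 / real n) + e / 4)
          \<longlonglongrightarrow> bayes_risk + 2 * expectation (\<lambda>z. \<bar>label_prob z - cond_label k l (ctx k l z)\<bar>) + C * 0 + e / 4"
        by (intro tendsto_intros b(1) lim_1_over_n)
      moreover have "bayes_risk + 2 * expectation (\<lambda>z. \<bar>label_prob z - cond_label k l (ctx k l z)\<bar>) + C * 0 + e / 4 < t"
        using kl(3) e e_def unfolding mult_zero_right by linarith
      ultimately have "\<forall>\<^sub>F n in sequentially. b n + C * (1 / real n) + e / 4 < t"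
        by (rule order_tendstoD(2))
      moreover have "\<forall>\<^sub>F n::nat in sequentially. 1 \<le> n" by (rule eventually_ge_at_top)
      ultimately show "\<forall>\<^sub>F n in sequentially. A n < t"
      proof eventually_elim
        case (elim n)
        have "A n \<le> ((\<Sum>i=1..n. expert_err G (xs z) (ys z) (k, l) i) + C + (e / 4) * real n) / real n"
          unfolding A_def by (intro divide_right_mono C) simp
        also have "\<dots> = (\<Sum>i=1..n. expert_err G (xs z) (ys z) (k, l) i) / real n + C * (1 / real n) + e / 4"
          using elim(2) by (simp add: add_divide_distrib)
        also have "\<dots> \<le> b n + C * (1 / real n) + e / 4" using b(2)[of n] by simp
        finally show ?case using elim(1) by linarith
      qed
    qed
    then show ?case unfolding A_def .
  qed
qed

end

section \<open>Randomization\<close>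

lemma tendsto_zero_iff_nat:
  fixes f :: "nat \<Rightarrow> real"
  shows "f \<longlonglongrightarrow> 0 \<longleftrightarrow> (\<forall>m::nat. \<exists>N. \<forall>n\<ge>N. \<bar>f n\<bar> < 1 / real (Suc m))"
proof
  assume "f \<longlonglongrightarrow> 0"
  then show "\<forall>m::nat. \<exists>N. \<forall>n\<ge>N. \<bar>f n\<bar> < 1 / real (Suc m)"
    using LIMSEQ_D[of f 0] by (metis diff_zero divide_pos_pos of_nat_0_less_iff real_norm_def zero_less_Suc zero_less_one)
next
  assume *: "\<forall>m::nat. \<exists>N. \<forall>n\<ge>N. \<bar>f n\<bar> < 1 / real (Suc m)"
  show "f \<longlonglongrightarrow> 0"
  proof (rule LIMSEQ_I)
    fix e :: real assume "0 < e"
    then obtain m :: nat where "1 / real (Suc m) < e"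
      using reals_Archimedean[of e] by (auto simp: inverse_eq_divide)
    then show "\<exists>N. \<forall>n\<ge>N. norm (f n - 0) < e"
      using *[rule_format, of m] by (metis diff_zero order_less_trans real_norm_def)
  qed
qed

text \<open>Measurability of the event of convergence, needed to apply Fubini's theorem to it.\<close>

lemma tendsto_zero_sets:
  fixes f :: "nat \<Rightarrow> 'a \<Rightarrow> real"
  assumes [measurable]: "\<And>n. f n \<in> borel_measurable M"
  shows "{x\<in>space M. (\<lambda>n. f n x) \<longlonglongrightarrow> 0} \<in> sets M"
  unfolding tendsto_zero_iff_nat by measurable

context prob_space
begin

lemma uniform_prob_le:
  assumes U: "random_variable borel V" and unif: "distr M lborel V = uniform_measure lborel {0..1}"
    and q: "0 \<le> q" "q \<le> (1::real)"
  shows "expectation (\<lambda>\<omega>. of_bool (V \<omega> \<le> q)) = q"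
proof -
  have V: "V \<in> M \<rightarrow>\<^sub>M lborel" using U by simp
  have "expectation (\<lambda>\<omega>. of_bool (V \<omega> \<le> q)) = expectation (\<lambda>\<omega>. indicator {..q} (V \<omega>) :: real)"
    by (intro Bochner_Integration.integral_cong) (auto simp: indicator_def)
  also have "\<dots> = (\<integral>v. indicator {..q} v \<partial>distr M lborel V)"
    by (rule integral_distr[symmetric, OF V, where f = "indicator {..q}"]) simp
  also have "\<dots> = measure (uniform_measure lborel {0..1}) {..q}"
    unfolding unif by simp
  also have "\<dots> = measure lborel ({0..1} \<inter> {..q}) / measure lborel {0..1::real}"
    by (rule measure_uniform_measure) auto
  also have "{0..1} \<inter> {..q} = {0..q}" using q by auto
  finally show ?thesis using q by simp
qed

text \<open>For a fixed path the thresholds and signs are constants and the centred decisions are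
  independent.\<close>

lemma randomization_average_fixed:
  fixes U :: "nat \<Rightarrow> 'a \<Rightarrow> real" and q s :: "nat \<Rightarrow> real"
  assumes indep: "indep_vars (\<lambda>_. borel) U {1..}"
    and unif: "\<And>i. 1 \<le> i \<Longrightarrow> distr M lborel (U i) = uniform_measure lborel {0..1}"
    and q: "\<And>i. 1 \<le> i \<Longrightarrow> 0 \<le> q i \<and> q i \<le> 1" and s: "\<And>i. \<bar>s i\<bar> \<le> 1"
  shows "AE \<omega> in M. (\<lambda>n. (\<Sum>i=1..n. s i * (of_bool (U i \<omega> \<le> q i) - q i)) / real n) \<longlonglongrightarrow> 0"
proof -
  define D where "D i \<omega> = (if i = 0 then 0 else s i * (of_bool (U i \<omega> \<le> q i) - q i))" for i \<omega>
  have U_meas [measurable]: "random_variable borel (U i)" if "1 \<le> i" for i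
    using indep that by (auto simp: indep_vars_def)
  have D_meas [measurable]: "random_variable borel (D i)" for i
  proof (cases "i = 0")
    case True
    then show ?thesis by (simp add: D_def[abs_def])
  next
    case False
    then have [measurable]: "random_variable borel (U i)" by (intro U_meas) simp
    show ?thesis using False unfolding D_def[abs_def] by simp
  qed
  have D_bound: "\<bar>D i \<omega>\<bar> \<le> 1" for i \<omega>
  proof (cases "i = 0")
    case False
    then have "\<bar>of_bool (U i \<omega> \<le> q i) - q i\<bar> \<le> 1" using q[of i] by (auto simp: of_bool_def)
    then have "\<bar>s i\<bar> * \<bar>of_bool (U i \<omega> \<le> q i) - q i\<bar> \<le> 1 * 1" using s by (intro mult_mono) auto
    then show ?thesis using False by (simp add: D_def abs_mult)
  qed (simp add: D_def)
  have D_int: "integrable M (D i)" for i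
    by (rule integrable_const_bound[of _ 1]) (use D_bound in auto)
  have D_mean: "expectation (D i) = 0" if "1 \<le> i" for i
  proof -
    have m: "(\<lambda>\<omega>. of_bool (U i \<omega> \<le> q i) :: real) \<in> borel_measurable M"
      using U_meas[OF that] by measurable
    have "integrable M (\<lambda>\<omega>. of_bool (U i \<omega> \<le> q i) :: real)"
      by (rule integrable_const_bound[of _ 1, OF _ m]) auto
    then have "expectation (\<lambda>\<omega>. s i * (of_bool (U i \<omega> \<le> q i) - q i))
        = s i * (expectation (\<lambda>\<omega>. of_bool (U i \<omega> \<le> q i)) - q i)"
      by (simp add: prob_space)
    also have "\<dots> = 0" using uniform_prob_le[OF U_meas[OF that] unif[OF that], of "q i"] q[OF that] by simp
    finally show ?thesis using that by (simp add: D_def[abs_def])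
  qed
  have "AE \<omega> in M. (\<lambda>n. (\<Sum>i=1..n. D i \<omega>) / real n) \<longlonglongrightarrow> 0"
  proof (rule uncorrelated_SLLN[OF D_meas D_bound])
    fix i j :: nat assume ij: "1 \<le> i" "i < j"
    have "indep_vars (\<lambda>_. borel) U {i, j}" by (rule indep_vars_subset[OF indep]) (use ij in auto)
    then have "indep_vars (\<lambda>_. borel) (\<lambda>k \<omega>. s k * (of_bool (U k \<omega> \<le> q k) - q k)) {i, j}"
      by (rule indep_vars_compose2[where Y = "\<lambda>k u. s k * (of_bool (u \<le> q k) - q k)"]) measurable
    then have "indep_vars (\<lambda>_. borel) D {i, j}"
      by (rule indep_vars_cong[THEN iffD1, rotated -1]) (use ij in \<open>auto simp: D_def\<close>)
    then have "expectation (\<lambda>\<omega>. \<Prod>k\<in>{i, j}. D k \<omega>) = (\<Prod>k\<in>{i, j}. expectation (D k))"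
      by (intro indep_vars_lebesgue_integral) (auto intro: D_int)
    then show "expectation (\<lambda>\<omega>. D i \<omega> * D j \<omega>) = 0" using ij D_mean[of i] by simp
  qed
  moreover have "(\<Sum>i=1..n. D i \<omega>) = (\<Sum>i=1..n. s i * (of_bool (U i \<omega> \<le> q i) - q i))" for n \<omega>
    by (intro sum.cong) (auto simp: D_def)
  ultimately show ?thesis by simp
qed

text \<open>Since \<open>U\<close> and \<open>Z\<close> are independent, their joint law is a product, and Fubini's theorem reduces
  the claim to a fixed value of \<open>Z\<close>.\<close>

lemma randomization_average:
  fixes U :: "nat \<Rightarrow> 'a \<Rightarrow> real" and q s :: "nat \<Rightarrow> 'z \<Rightarrow> real"
  assumes indep: "indep_vars (\<lambda>_. borel) U {1..}"
    and unif: "\<And>i. 1 \<le> i \<Longrightarrow> distr M lborel (U i) = uniform_measure lborel {0..1}"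
    and Z: "Z \<in> M \<rightarrow>\<^sub>M N"
    and UZ: "indep_set
      (sets (vimage_algebra (space M) (\<lambda>\<omega>. \<lambda>i\<in>{1..}. U i \<omega>) (Pi\<^sub>M {1..} (\<lambda>_. borel))))
      (sets (vimage_algebra (space M) Z N))"
    and q: "\<And>i z. 1 \<le> i \<Longrightarrow> 0 \<le> q i z \<and> q i z \<le> 1" and s: "\<And>i z. \<bar>s i z\<bar> \<le> 1"
    and q_meas: "\<And>i. 1 \<le> i \<Longrightarrow> q i \<in> borel_measurable N"
    and s_meas: "\<And>i. 1 \<le> i \<Longrightarrow> s i \<in> borel_measurable N"
  shows "AE \<omega> in M. (\<lambda>n. (\<Sum>i=1..n. s i (Z \<omega>) * (of_bool (U i \<omega> \<le> q i (Z \<omega>)) - q i (Z \<omega>))) / real n) \<longlonglongrightarrow> 0"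
proof -
  let ?S = "Pi\<^sub>M {1..} (\<lambda>_. borel) :: (nat \<Rightarrow> real) measure"
  define W where "W \<omega> = (\<lambda>i\<in>{1..}. U i \<omega>)" for \<omega>
  have W: "W \<in> M \<rightarrow>\<^sub>M ?S"
    unfolding W_def using indep by (intro measurable_restrict) (auto simp: indep_vars_def)
  define avg where "avg n zu = (\<Sum>i=1..n. s i (fst zu) * (of_bool (snd zu i \<le> q i (fst zu)) - q i (fst zu))) / real n"
    for n and zu :: "'z \<times> (nat \<Rightarrow> real)"
  have avg_W: "avg n (z, W \<omega>) = (\<Sum>i=1..n. s i z * (of_bool (U i \<omega> \<le> q i z) - q i z)) / real n" for n z \<omega>
    unfolding avg_def by (intro arg_cong2[where f = "(/)"] sum.cong) (auto simp: W_def)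
  have avg_meas: "avg n \<in> borel_measurable (N \<Otimes>\<^sub>M ?S)" for n
  proof -
    have [measurable]: "(\<lambda>zu. s i (fst zu)) \<in> borel_measurable (N \<Otimes>\<^sub>M ?S)"
      "(\<lambda>zu. q i (fst zu)) \<in> borel_measurable (N \<Otimes>\<^sub>M ?S)"
      "(\<lambda>zu. snd zu i) \<in> borel_measurable (N \<Otimes>\<^sub>M ?S)" if "i \<in> {1..n}" for i
      using that by (auto intro!: measurable_compose[OF measurable_fst s_meas]
          measurable_compose[OF measurable_fst q_meas] measurable_compose[OF measurable_snd measurable_component_singleton])
    show ?thesis unfolding avg_def by measurable
  qed
  interpret Z: prob_space "distr M N Z" by (rule prob_space_distr[OF Z])
  interpret W: prob_space "distr M ?S W" by (rule prob_space_distr[OF W])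
  interpret pair_sigma_finite "distr M N Z" "distr M ?S W" ..
  note ZW = measurable_Pair[OF Z W]
  have joint: "distr M N Z \<Otimes>\<^sub>M distr M ?S W = distr M (N \<Otimes>\<^sub>M ?S) (\<lambda>\<omega>. (Z \<omega>, W \<omega>))"
  proof (rule pair_measure_eqI)
    fix A B assume A: "A \<in> sets (distr M N Z)" and B: "B \<in> sets (distr M ?S W)"
    have "Z -` A \<inter> space M \<in> sets (vimage_algebra (space M) Z N)"
      "W -` B \<inter> space M \<in> sets (vimage_algebra (space M) W ?S)"
      using A B by (auto intro: in_vimage_algebra)
    then have "prob ((W -` B \<inter> space M) \<inter> (Z -` A \<inter> space M)) = prob (W -` B \<inter> space M) * prob (Z -` A \<inter> space M)"
      using UZ unfolding indep_sets2_eq W_def[abs_def] by blast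
    moreover have "(\<lambda>\<omega>. (Z \<omega>, W \<omega>)) -` (A \<times> B) \<inter> space M = (W -` B \<inter> space M) \<inter> (Z -` A \<inter> space M)"
      by auto
    moreover have "emeasure (distr M N Z) A = ennreal (prob (Z -` A \<inter> space M))"
      using A by (subst emeasure_distr[OF Z]) (auto simp: emeasure_eq_measure)
    moreover have "emeasure (distr M ?S W) B = ennreal (prob (W -` B \<inter> space M))"
      using B by (subst emeasure_distr[OF W]) (auto simp: emeasure_eq_measure)
    moreover have "emeasure (distr M (N \<Otimes>\<^sub>M ?S) (\<lambda>\<omega>. (Z \<omega>, W \<omega>))) (A \<times> B)
        = ennreal (prob ((\<lambda>\<omega>. (Z \<omega>, W \<omega>)) -` (A \<times> B) \<inter> space M))"
      using A B by (subst emeasure_distr[OF ZW]) (auto simp: emeasure_eq_measure)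
    ultimately show "emeasure (distr M N Z) A * emeasure (distr M ?S W) B
        = emeasure (distr M (N \<Otimes>\<^sub>M ?S) (\<lambda>\<omega>. (Z \<omega>, W \<omega>))) (A \<times> B)"
      by (simp add: ennreal_mult[symmetric] mult.commute del: One_nat_def)
  qed (use Z.sigma_finite_measure_axioms W.sigma_finite_measure_axioms in \<open>auto cong: sets_pair_measure_cong\<close>)
  have "AE zu in distr M N Z \<Otimes>\<^sub>M distr M ?S W. (\<lambda>n. avg n zu) \<longlonglongrightarrow> 0"
  proof (rule AE_pair_measure)
    show "{zu \<in> space (distr M N Z \<Otimes>\<^sub>M distr M ?S W). (\<lambda>n. avg n zu) \<longlonglongrightarrow> 0}
        \<in> sets (distr M N Z \<Otimes>\<^sub>M distr M ?S W)"
      using avg_meas by (intro tendsto_zero_sets) (simp cong: measurable_cong_sets add: measurable_def space_pair_measure)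
    show "AE z in distr M N Z. AE u in distr M ?S W. (\<lambda>n. avg n (z, u)) \<longlonglongrightarrow> 0"
    proof (rule AE_I2)
      fix z assume "z \<in> space (distr M N Z)"
      then have z: "z \<in> space N" by simp
      have "(\<lambda>u. avg n (z, u)) \<in> borel_measurable ?S" for n
        by (rule measurable_compose[OF measurable_Pair1'[OF z] avg_meas])
      then have "{u \<in> space ?S. (\<lambda>n. avg n (z, u)) \<longlonglongrightarrow> 0} \<in> sets ?S" by (rule tendsto_zero_sets)
      moreover have "AE \<omega> in M. (\<lambda>n. avg n (z, W \<omega>)) \<longlonglongrightarrow> 0"
        unfolding avg_W by (rule randomization_average_fixed[OF indep unif]) (use q s in auto)
      ultimately show "AE u in distr M ?S W. (\<lambda>n. avg n (z, u)) \<longlonglongrightarrow> 0"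
        by (subst AE_distr_iff[OF W]) auto
    qed
  qed
  then have "AE zu in distr M (N \<Otimes>\<^sub>M ?S) (\<lambda>\<omega>. (Z \<omega>, W \<omega>)). (\<lambda>n. avg n zu) \<longlonglongrightarrow> 0"
    unfolding joint .
  from AE_distrD[OF ZW this] show ?thesis unfolding avg_W .
qed

end

section \<open>Nested partitions generate the Borel sets\<close>

lemma ediam_ge: "x \<in> S \<Longrightarrow> y \<in> S \<Longrightarrow> ennreal (norm (x - y)) \<le> ediam S"
  unfolding ediam_def
  by (rule order_trans[OF SUP_upper[of y S "\<lambda>y. ennreal (norm (x - y))"]
        SUP_upper[of x S "\<lambda>x. SUP y\<in>S. ennreal (norm (x - y))"]])

text \<open>Around a point \<open>x \<noteq> 0\<close>, the shrinking of the cells that meet the sphere of radius \<open>norm x\<close>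
  makes the cell of \<open>x\<close> fit into any given ball, so an open set without the origin is a countable
  union of cells. No sphere of positive radius contains the origin, whose cells need not shrink in
  diameter; but the intersection of its cells is \<open>{0}\<close>, because a further point would have large
  cells at every level.\<close>

lemma nested_quantizers_quantizer:
  fixes A :: "nat \<Rightarrow> nat \<Rightarrow> ('a::euclidean_space) set" and m :: "nat \<Rightarrow> nat"
  assumes partition: "\<And>l. l \<ge> 1 \<Longrightarrow> partition_on UNIV (A l ` {1..m l})"
    and distinct_cells: "\<And>l. l \<ge> 1 \<Longrightarrow> inj_on (A l) {1..m l}"
    and borel_cells: "\<And>l j. l \<ge> 1 \<Longrightarrow> j \<in> {1..m l} \<Longrightarrow> A l j \<in> sets borel"
    and nested: "\<And>l j. l \<ge> 1 \<Longrightarrow> j \<in> {1..m (l + 1)} \<Longrightarrow> \<exists>i\<in>{1..m l}. A (l + 1) j \<subseteq> A l i"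
    and shrinking: "\<And>r. r > 0 \<Longrightarrow>
      (\<lambda>l. Max {ediam (A l j) | j. j \<in> {1..m l} \<and> A l j \<inter> sphere 0 r \<noteq> {}}) \<longlonglongrightarrow> 0"
  shows "nested_quantizers (quantizer A m)"
proof -
  let ?G = "quantizer A m"
  have ex1: "\<exists>!j. j \<in> {1..m l} \<and> x \<in> A l j" if l: "l \<ge> 1" for l x
  proof -
    have "x \<in> \<Union> (A l ` {1..m l})" using partition[OF l] by (simp add: partition_on_def)
    then obtain j where j: "j \<in> {1..m l}" "x \<in> A l j" by blast
    have "i = j" if "i \<in> {1..m l}" "x \<in> A l i" for i
    proof -
      have "A l i = A l j"
        using partition[OF l] that j unfolding partition_on_def disjoint_def by blast
      then show ?thesis using distinct_cells[OF l] that j by (auto dest: inj_onD)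
    qed
    then show ?thesis using j by blast
  qed
  have G_in: "?G l x \<in> {1..m l}" "x \<in> A l (?G l x)" if "l \<ge> 1" for l x
    using theI'[OF ex1[OF that, of x]] unfolding quantizer_def by blast+
  have G_eq: "?G l x = j" if "l \<ge> 1" "j \<in> {1..m l}" "x \<in> A l j" for l x j
    using ex1[OF that(1), of x] G_in[OF that(1), of x] that by blast
  have vimage: "?G l -` {j} = (if j \<in> {1..m l} then A l j else {})" if "l \<ge> 1" for l j
    using G_in[OF that] G_eq[OF that] by auto
  have small: "\<exists>l\<ge>1. ediam (A l (?G l x)) < e" if "x \<noteq> 0" "0 < e" for x e
  proof -
    let ?D = "\<lambda>l. {ediam (A l j) | j. j \<in> {1..m l} \<and> A l j \<inter> sphere 0 (norm x) \<noteq> {}}"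
    have "\<forall>\<^sub>F l in sequentially. Max (?D l) < e"
      by (rule order_tendstoD(2)[OF shrinking]) (use that in auto)
    moreover have "\<forall>\<^sub>F l::nat in sequentially. 1 \<le> l" by (rule eventually_ge_at_top)
    ultimately have "\<forall>\<^sub>F l in sequentially. 1 \<le> l \<and> Max (?D l) < e" by eventually_elim simp
    then obtain l where l: "1 \<le> l" "Max (?D l) < e"
      unfolding eventually_sequentially by blast
    have "A l (?G l x) \<inter> sphere 0 (norm x) \<noteq> {}" using G_in(2)[OF l(1), of x] by auto
    then have "ediam (A l (?G l x)) \<in> ?D l" using G_in(1)[OF l(1), of x] by blast
    then have "ediam (A l (?G l x)) \<le> Max (?D l)" by (intro Max_ge) auto
    then show ?thesis using l by (auto intro: le_less_trans)
  qed
  let ?C = "{?G l -` {j} | l j. 1 \<le> l}"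
  have C: "?G l -` {j} \<in> sigma_sets UNIV ?C" if "1 \<le> l" for l j
    using that by (intro sigma_sets.Basic) blast
  have origin: "{0} \<in> sigma_sets UNIV ?C"
  proof -
    have "{0} = (\<Inter>l. ?G (Suc l) -` {?G (Suc l) 0})"
    proof (intro set_eqI iffI)
      fix x assume x: "x \<in> (\<Inter>l. ?G (Suc l) -` {?G (Suc l) 0})"
      show "x \<in> {0}"
      proof (rule ccontr)
        assume "x \<notin> {0}"
        then obtain l where l: "1 \<le> l" "ediam (A l (?G l x)) < ennreal (norm x)"
          using small[of x "ennreal (norm x)"] by auto
        have "?G l x = ?G l 0" using x l(1) by (cases l) auto
        then have "ennreal (norm (x - 0)) \<le> ediam (A l (?G l x))"
          using G_in(2)[OF l(1), of x] G_in(2)[OF l(1), of 0] by (intro ediam_ge) auto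
        then show False using l(2) by simp
      qed
    qed auto
    also have "\<dots> \<in> sigma_sets UNIV ?C"
      by (rule sigma_sets_Inter) (use C in auto)
    finally show ?thesis .
  qed
  have open_sets: "S \<in> sigma_sets UNIV ?C" if "open S" for S
  proof -
    define I where "I = {(l, j). 1 \<le> l \<and> ?G l -` {j} \<subseteq> S}"
    have eq: "S = (\<Union>(l, j)\<in>I. ?G l -` {j}) \<union> (S \<inter> {0})"
    proof (intro set_eqI iffI)
      fix x assume x: "x \<in> S"
      show "x \<in> (\<Union>(l, j)\<in>I. ?G l -` {j}) \<union> (S \<inter> {0})"
      proof (cases "x = 0")
        case False
        obtain e where e: "0 < e" "ball x e \<subseteq> S" using \<open>open S\<close> x by (auto simp: open_contains_ball)
        obtain l where l: "1 \<le> l" "ediam (A l (?G l x)) < ennreal e"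
          using small[OF False, of "ennreal e"] e by auto
        have "?G l -` {?G l x} \<subseteq> ball x e"
        proof
          fix y assume "y \<in> ?G l -` {?G l x}"
          then have "y \<in> A l (?G l x)" using G_in(2)[OF l(1), of y] by simp
          then have "ennreal (norm (x - y)) \<le> ediam (A l (?G l x))"
            using G_in(2)[OF l(1), of x] by (intro ediam_ge) auto
          then have "ennreal (norm (x - y)) < ennreal e" using l(2) by simp
          then show "y \<in> ball x e" using e by (simp add: ennreal_less_iff dist_norm)
        qed
        then have "(l, ?G l x) \<in> I" using l e by (auto simp: I_def)
        then show ?thesis by blast
      qed (use x in simp)
    qed (auto simp: I_def)
    have "(\<Union>(l, j)\<in>I. ?G l -` {j}) \<in> sigma_sets UNIV ?C"
    proof -
      have "(\<Union>i\<in>I. ?G (fst i) -` {snd i}) \<in> sigma_sets UNIV ?C"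
      proof (rule sigma_sets_UNION)
        fix c assume "c \<in> (\<lambda>i. ?G (fst i) -` {snd i}) ` I"
        then obtain l j where "c = ?G l -` {j}" "1 \<le> l" by (auto simp: I_def)
        then show "c \<in> sigma_sets UNIV ?C" using C by simp
      qed simp
      then show ?thesis by (simp add: case_prod_unfold)
    qed
    moreover have "S \<inter> {0} \<in> sigma_sets UNIV ?C"
      using origin by (cases "0 \<in> S") (auto intro: sigma_sets.Empty)
    ultimately have "(\<Union>(l, j)\<in>I. ?G l -` {j}) \<union> (S \<inter> {0}) \<in> sigma_sets UNIV ?C"
      by (rule sigma_sets_Un)
    then show ?thesis unfolding eq[symmetric] .
  qed
  show ?thesis
  proof
    fix l :: nat assume l: "1 \<le> l"
    show "?G l \<in> borel \<rightarrow>\<^sub>M count_space UNIV"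
      using borel_cells[OF l] by (auto simp: measurable_count_space_eq2_countable vimage[OF l])
    have "range (?G l) \<subseteq> {1..m l}" using G_in(1)[OF l] by auto
    then show "finite (range (?G l))" by (rule finite_subset) simp
    fix x x' assume eq: "?G (Suc l) x = ?G (Suc l) x'"
    obtain i where i: "i \<in> {1..m l}" "A (Suc l) (?G (Suc l) x) \<subseteq> A l i"
      using nested[OF l, of "?G (Suc l) x"] G_in(1)[of "Suc l" x] by auto
    have "x \<in> A l i" "x' \<in> A l i" using i(2) G_in(2)[of "Suc l" x] G_in(2)[of "Suc l" x'] eq by auto
    then show "?G l x = ?G l x'" using G_eq[OF l i(1)] by simp
  next
    show "sets (borel :: 'a measure) \<subseteq> sigma_sets UNIV ?C"
    proof -
      have "sets (borel :: 'a measure) = sigma_sets UNIV {S. open S}"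
        unfolding borel_def by (rule sets_measure_of) simp
      also have "\<dots> \<subseteq> sigma_sets UNIV ?C"
        by (rule sigma_sets_mono) (use open_sets in auto)
      finally show ?thesis .
    qed
  qed
qed

section \<open>Transfer from the path space\<close>

lemma ergodic_path_path_law:
  fixes Z :: "int \<Rightarrow> 'w \<Rightarrow> 'a::topological_space \<times> bool"
  assumes prob: "prob_space M"
    and stationary: "stationary_process M (borel \<Otimes>\<^sub>M count_space UNIV) Z"
    and ergodic: "ergodic_process M (borel \<Otimes>\<^sub>M count_space UNIV) Z"
  shows "(\<lambda>\<omega> i. Z i \<omega>) \<in> M \<rightarrow>\<^sub>M path_space obs_algebra" "ergodic_path (path_law M obs_algebra Z)"
proof -
  show Z: "(\<lambda>\<omega> i. Z i \<omega>) \<in> M \<rightarrow>\<^sub>M path_space obs_algebra"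
    using stationary unfolding path_space_def stationary_process_def
    by (intro measurable_PiM_single') (auto simp: space_PiM space_pair_measure)
  have sets: "sets (path_law M obs_algebra Z) = sets (path_space obs_algebra)" by (simp add: path_law_def)
  interpret P: prob_space "path_law M obs_algebra Z"
    unfolding path_law_def by (rule prob_space.prob_space_distr[OF prob Z])
  show "ergodic_path (path_law M obs_algebra Z)"
  proof
    show "distr (path_law M obs_algebra Z) (path_law M obs_algebra Z) shift = path_law M obs_algebra Z"
      using stationary distr_cong[OF refl sets, of "path_law M obs_algebra Z" shift shift]
      unfolding stationary_process_def by simp
    fix B assume "B \<in> P.events" "shift -` B = B"
    then show "P.prob B = 0 \<or> P.prob B = 1"
      using ergodic sets unfolding ergodic_process_def by auto
  qed (rule sets)
qed

text \<open>The past of the process is generated by the process as a map into path space, so conditional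
  probabilities given the past on \<open>M\<close> are those on path space evaluated along the process.\<close>

lemma optimal_loss_path:
  fixes X :: "int \<Rightarrow> 'w \<Rightarrow> 'a::topological_space" and Y :: "int \<Rightarrow> 'w \<Rightarrow> bool"
  assumes prob: "prob_space M"
    and Z: "(\<lambda>\<omega> i. (X i \<omega>, Y i \<omega>)) \<in> M \<rightarrow>\<^sub>M path_space obs_algebra"
    and path: "ergodic_path P" and P: "P = distr M (path_space obs_algebra) (\<lambda>\<omega> i. (X i \<omega>, Y i \<omega>))"
  shows "optimal_loss M X Y = (\<integral>z. min (ergodic_path.label_prob P z) (1 - ergodic_path.label_prob P z) \<partial>P)"
proof -
  interpret prob_space M by fact
  interpret P: ergodic_path P by fact
  let ?Z = "\<lambda>\<omega> i. (X i \<omega>, Y i \<omega>)"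
  let ?F = "past_algebra M X Y"
  have XY: "X i \<in> M \<rightarrow>\<^sub>M borel" "Y i \<in> M \<rightarrow>\<^sub>M count_space UNIV" for i
    using measurable_compose[OF Z measurable_component_singleton[of i UNIV "\<lambda>_. obs_algebra", folded path_space_def]]
      measurable_compose[OF _ measurable_fst] measurable_compose[OF _ measurable_snd]
    by fastforce+
  define past_map where "past_map = (\<lambda>z::int \<Rightarrow> 'a \<times> bool. (\<lambda>i\<in>{..<0}. snd (z i), \<lambda>i\<in>{..0}. fst (z i)))"
  let ?Q = "Pi\<^sub>M {..<0::int} (\<lambda>_. count_space (UNIV :: bool set)) \<Otimes>\<^sub>M Pi\<^sub>M {..0::int} (\<lambda>_. borel :: 'a measure)"
  have F: "?F = vimage_algebra (space M) (\<lambda>\<omega>. past_map (?Z \<omega>)) ?Q"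
    unfolding past_algebra_def past_map_def by simp
  have past_map_space: "past_map z \<in> space ?Q" for z by (auto simp: past_map_def space_pair_measure space_PiM)
  have sets_F: "sets ?F = {(\<lambda>\<omega>. past_map (?Z \<omega>)) -` A \<inter> space M | A. A \<in> sets ?Q}"
    unfolding F by (rule sets_vimage_algebra2) (use past_map_space in auto)
  have Z_P: "?Z \<in> M \<rightarrow>\<^sub>M P" using Z unfolding P by simp
  have F_past: "\<exists>B\<in>sets P.past. C = ?Z -` B \<inter> space M" if C_in: "C \<in> sets ?F" for C
  proof -
    obtain A where A: "A \<in> sets ?Q" "C = (\<lambda>\<omega>. past_map (?Z \<omega>)) -` A \<inter> space M"
      using C_in unfolding sets_F by auto
    have "past_map -` A \<inter> space P.past \<in> sets P.past"
      using P.past_map_measurable A(1) unfolding past_map_def by (rule measurable_sets)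
    moreover have "C = ?Z -` (past_map -` A \<inter> space P.past) \<inter> space M" using A(2) by auto
    ultimately show ?thesis by blast
  qed
  have past_map_Z: "(\<lambda>\<omega>. past_map (?Z \<omega>)) \<in> M \<rightarrow>\<^sub>M ?Q"
    unfolding past_map_def using XY by (intro measurable_Pair measurable_restrict) auto
  have sub: "subalgebra M ?F"
    using measurable_sets[OF past_map_Z] unfolding subalgebra_def sets_F by (auto simp: F)
  interpret F: finite_measure_subalgebra M ?F by unfold_locales (rule sub)
  have Z_past: "?Z \<in> ?F \<rightarrow>\<^sub>M P.past"
  proof (rule P.measurable_into_past)
    have past_map_F: "(\<lambda>\<omega>. past_map (?Z \<omega>)) \<in> ?F \<rightarrow>\<^sub>M ?Q"
      unfolding F by (rule measurable_vimage_algebra1) (use past_map_space in auto)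
    show "(\<lambda>\<omega>. snd (?Z \<omega> i)) \<in> ?F \<rightarrow>\<^sub>M count_space UNIV" if "i < 0" for i
      using measurable_compose[OF measurable_compose[OF past_map_F measurable_fst] measurable_component_singleton[of i]] that
      by (simp add: past_map_def)
    show "(\<lambda>\<omega>. fst (?Z \<omega> i)) \<in> ?F \<rightarrow>\<^sub>M borel" if "i \<le> 0" for i
      using measurable_compose[OF measurable_compose[OF past_map_F measurable_snd] measurable_component_singleton[of i]] that
      by (simp add: past_map_def)
  qed
  have cond: "AE \<omega> in M. cond_prob_label M X Y b \<omega> = (if b then P.label_prob (?Z \<omega>) else 1 - P.label_prob (?Z \<omega>))" for b
    unfolding cond_prob_label_def
  proof (rule F.real_cond_exp_charact)
    define f where "f z = of_bool (snd (z 0)) - P.label_prob z" for z :: "int \<Rightarrow> 'a \<times> bool"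
    have f_meas [measurable]: "f \<in> borel_measurable P" unfolding f_def by measurable
    have pZ [measurable]: "(\<lambda>\<omega>. P.label_prob (?Z \<omega>)) \<in> borel_measurable M"
      by (rule measurable_compose[OF Z_P P.label_prob_measurable])
    have Yb [measurable]: "{\<omega>\<in>space M. Y 0 \<omega> = b} \<in> events"
      using XY(2)[of 0] by measurable
    show int1: "integrable M (indicator {\<omega>\<in>space M. Y 0 \<omega> = b} :: _ \<Rightarrow> real)"
      by (rule integrable_const_bound[of _ 1]) auto
    show int2: "integrable M (\<lambda>\<omega>. if b then P.label_prob (?Z \<omega>) else 1 - P.label_prob (?Z \<omega>))"
      by (rule integrable_const_bound[of _ 1]) (use P.label_prob_bounds in auto)
    show "(\<lambda>\<omega>. if b then P.label_prob (?Z \<omega>) else 1 - P.label_prob (?Z \<omega>)) \<in> borel_measurable ?F"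
      using measurable_compose[OF Z_past P.label_prob_past] by measurable
    fix C assume "C \<in> sets ?F"
    then obtain B where B: "B \<in> sets P.past" "C = ?Z -` B \<inter> space M" using F_past by blast
    have C [measurable]: "C \<in> events" using \<open>C \<in> sets ?F\<close> sub by (auto simp: subalgebra_def)
    have "(\<integral>\<omega>\<in>C. indicator {\<omega>\<in>space M. Y 0 \<omega> = b} \<omega> \<partial>M) - (\<integral>\<omega>\<in>C. (if b then P.label_prob (?Z \<omega>) else 1 - P.label_prob (?Z \<omega>)) \<partial>M)
        = (\<integral>\<omega>\<in>C. indicator {\<omega>\<in>space M. Y 0 \<omega> = b} \<omega> - (if b then P.label_prob (?Z \<omega>) else 1 - P.label_prob (?Z \<omega>)) \<partial>M)"
      using integrable_mult_indicator[OF C int1] integrable_mult_indicator[OF C int2]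
      by (intro set_integral_diff(2)[symmetric]) (simp_all only: set_integrable_def)
    also have "\<dots> = (\<integral>\<omega>. (\<lambda>z. indicator B z * ((if b then 1 else - 1) * f z)) (?Z \<omega>) \<partial>M)"
      unfolding set_lebesgue_integral_def
      by (rule Bochner_Integration.integral_cong) (auto simp: B(2) f_def indicator_def)
    also have "\<dots> = (\<integral>z. indicator B z * ((if b then 1 else - 1) * f z) \<partial>P)"
      unfolding P
    proof (rule integral_distr[symmetric, OF Z])
      have [measurable]: "B \<in> sets P" using B(1) P.subalgebra_past by (auto simp: subalgebra_def)
      have "(\<lambda>z. indicator B z * ((if b then 1 else - 1) * f z)) \<in> borel_measurable P" by measurable
      then show "(\<lambda>z. indicator B z * ((if b then 1 else - 1) * f z)) \<in> borel_measurable (path_space obs_algebra)"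
        unfolding P.measurable_P_cong .
    qed
    also have "\<dots> = (if b then 1 else - 1) * (\<integral>z. indicator B z * f z \<partial>P)"
      by (cases b) auto
    also have "(\<integral>z. indicator B z * f z \<partial>P) = 0"
      unfolding f_def by (rule P.label_prob_integral[of _ 1]) (use B(1) in \<open>auto simp: indicator_def\<close>)
    finally show "(\<integral>\<omega>\<in>C. indicator {\<omega>\<in>space M. Y 0 \<omega> = b} \<omega> \<partial>M)
        = (\<integral>\<omega>\<in>C. (if b then P.label_prob (?Z \<omega>) else 1 - P.label_prob (?Z \<omega>)) \<partial>M)" by simp
  qed
  have pZ [measurable]: "(\<lambda>\<omega>. P.label_prob (?Z \<omega>)) \<in> borel_measurable M"
    by (rule measurable_compose[OF Z_P P.label_prob_measurable])
  have "optimal_loss M X Y = (\<integral>\<omega>. (\<lambda>z. min (P.label_prob z) (1 - P.label_prob z)) (?Z \<omega>) \<partial>M)"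
    unfolding optimal_loss_def
  proof (rule integral_cong_AE)
    show "(\<lambda>\<omega>. min (cond_prob_label M X Y True \<omega>) (cond_prob_label M X Y False \<omega>)) \<in> borel_measurable M"
      unfolding cond_prob_label_def by measurable
    show "AE \<omega> in M. min (cond_prob_label M X Y True \<omega>) (cond_prob_label M X Y False \<omega>)
        = min (P.label_prob (?Z \<omega>)) (1 - P.label_prob (?Z \<omega>))"
      using cond[of True] cond[of False] by eventually_elim simp
  qed measurable
  also have "\<dots> = (\<integral>z. min (P.label_prob z) (1 - P.label_prob z) \<partial>P)"
  proof -
    have "(\<lambda>z. min (P.label_prob z) (1 - P.label_prob z)) \<in> borel_measurable P" by measurable
    then have "(\<lambda>z. min (P.label_prob z) (1 - P.label_prob z)) \<in> borel_measurable (path_space obs_algebra)"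
      unfolding P.measurable_P_cong .
    from integral_distr[OF Z this] show ?thesis unfolding P[symmetric] by simp
  qed
  finally show ?thesis .
qed

section \<open>Universal consistency of the scheme\<close>

theorem theorem6:
  fixes A :: "nat \<Rightarrow> nat \<Rightarrow> (real ^ 'd) set" and m :: "nat \<Rightarrow> nat"
    and M :: "'w measure"
    and X :: "int \<Rightarrow> 'w \<Rightarrow> real ^ 'd" and Y :: "int \<Rightarrow> 'w \<Rightarrow> bool"
    and U :: "nat \<Rightarrow> 'w \<Rightarrow> real"
  assumes partition: "\<And>l. l \<ge> 1 \<Longrightarrow> partition_on UNIV (A l ` {1..m l})"
    and distinct_cells: "\<And>l. l \<ge> 1 \<Longrightarrow> inj_on (A l) {1..m l}"
    and borel_cells: "\<And>l j. l \<ge> 1 \<Longrightarrow> j \<in> {1..m l} \<Longrightarrow> A l j \<in> sets borel"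
    and nested: "\<And>l j. l \<ge> 1 \<Longrightarrow> j \<in> {1..m (l + 1)} \<Longrightarrow> \<exists>i\<in>{1..m l}. A (l + 1) j \<subseteq> A l i"
    and shrinking: "\<And>r. r > 0 \<Longrightarrow>
      (\<lambda>l. Max {ediam (A l j) | j. j \<in> {1..m l} \<and> A l j \<inter> sphere 0 r \<noteq> {}}) \<longlonglongrightarrow> 0"
    and prob: "prob_space M"
    and stationary: "stationary_process M (borel \<Otimes>\<^sub>M count_space UNIV) (\<lambda>i \<omega>. (X i \<omega>, Y i \<omega>))"
    and ergodic: "ergodic_process M (borel \<Otimes>\<^sub>M count_space UNIV) (\<lambda>i \<omega>. (X i \<omega>, Y i \<omega>))"
    and U_indep: "prob_space.indep_vars M (\<lambda>_. borel) U {1..}"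
    and U_uniform: "\<And>i. i \<ge> 1 \<Longrightarrow> distr M lborel (U i) = uniform_measure lborel {0..1}"
    and U_indep_process: "prob_space.indep_set M
      (sets (vimage_algebra (space M) (\<lambda>\<omega>. \<lambda>i\<in>{1..}. U i \<omega>) (Pi\<^sub>M {1..} (\<lambda>_. borel))))
      (sets (vimage_algebra (space M) (\<lambda>\<omega> i. (X i \<omega>, Y i \<omega>))
        (path_space (borel \<Otimes>\<^sub>M count_space UNIV))))"
  shows "AE \<omega> in M.
    (\<lambda>n. average_loss (scheme (quantizer A m))
           (\<lambda>i. X (int i) \<omega>) (\<lambda>i. Y (int i) \<omega>) (\<lambda>i. U i \<omega>) n) \<longlonglongrightarrow> optimal_loss M X Y"
proof -
  interpret prob_space M by fact
  let ?G = "quantizer A m"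
  let ?Z = "\<lambda>\<omega> i. (X i \<omega>, Y i \<omega>)"
  define P where "P = path_law M obs_algebra (\<lambda>i \<omega>. (X i \<omega>, Y i \<omega>))"
  have Z: "?Z \<in> M \<rightarrow>\<^sub>M path_space obs_algebra" and path: "ergodic_path P"
    unfolding P_def by (rule ergodic_path_path_law[OF prob stationary ergodic])+
  interpret P: ergodic_path P by (rule path)
  interpret G: nested_quantizers ?G
    by (rule nested_quantizers_quantizer[OF partition distinct_cells borel_cells nested shrinking])
  interpret quantized_ergodic_path P ?G ..
  have opt: "optimal_loss M X Y = bayes_risk"
    unfolding bayes_risk_def by (rule optimal_loss_path[OF prob Z path]) (simp add: P_def path_law_def)
  have "AE \<omega> in M. (\<lambda>n. (\<Sum>i=1..n. mixed_loss ?G (xs (?Z \<omega>)) (ys (?Z \<omega>)) i) / real n) \<longlonglongrightarrow> bayes_risk"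
    using AE_distrD[OF Z] mixed_loss_tendsto unfolding P_def path_law_def by blast
  moreover have "AE \<omega> in M. (\<lambda>n. (\<Sum>i=1..n. (1 - 2 * of_bool (ys (?Z \<omega>) i))
      * (of_bool (U i \<omega> \<le> vote ?G (xs (?Z \<omega>)) (ys (?Z \<omega>)) i) - vote ?G (xs (?Z \<omega>)) (ys (?Z \<omega>)) i)) / real n) \<longlonglongrightarrow> 0"
  proof (rule randomization_average[OF U_indep U_uniform Z U_indep_process,
        where q = "\<lambda>i z. vote ?G (xs z) (ys z) i" and s = "\<lambda>i z. 1 - 2 * of_bool (ys z i)"])
    fix i :: nat assume i: "1 \<le> i"
    have "(\<lambda>z. vote ?G (xs z) (ys z) i) \<in> borel_measurable P"
      by (rule vote_measurable[where x = xs and y = ys]) (use i G.G_measurable in auto)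
    then show "(\<lambda>z. vote ?G (xs z) (ys z) i) \<in> borel_measurable (path_space obs_algebra)"
      unfolding P.measurable_P_cong .
    have "(\<lambda>z. 1 - 2 * of_bool (ys z i) :: real) \<in> borel_measurable P" by measurable
    then show "(\<lambda>z. 1 - 2 * of_bool (ys z i) :: real) \<in> borel_measurable (path_space obs_algebra)"
      unfolding P.measurable_P_cong .
    show "0 \<le> vote ?G (xs z) (ys z) i \<and> vote ?G (xs z) (ys z) i \<le> 1" for z by (rule vote_bounds[OF i])
  qed (auto simp: of_bool_def)
  ultimately show ?thesis
  proof eventually_elim
    case (elim \<omega>)
    let ?x = "\<lambda>i. X (int i) \<omega>" and ?y = "\<lambda>i. Y (int i) \<omega>" and ?u = "\<lambda>i. U i \<omega>"
    have eq: "average_loss (scheme ?G) ?x ?y ?u n = (\<Sum>i=1..n. mixed_loss ?G ?x ?y i) / real n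
        + (\<Sum>i=1..n. (1 - 2 * of_bool (?y i)) * (of_bool (?u i \<le> vote ?G ?x ?y i) - vote ?G ?x ?y i)) / real n" for n
    proof -
      have "of_bool (scheme ?G i (segment ?y 1 (i - 1)) (segment ?x 1 i) (?u i) \<noteq> ?y i)
          = mixed_loss ?G ?x ?y i
            + (1 - 2 * of_bool (?y i)) * (of_bool (?u i \<le> vote ?G ?x ?y i) - vote ?G ?x ?y i)" if "1 \<le> i" for i
        using vote_bounds[OF that, of ?G ?x ?y]
        unfolding scheme_eq_vote mixed_loss_def by (auto simp: of_bool_def)
      then have "(\<Sum>i=1..n. of_bool (scheme ?G i (segment ?y 1 (i - 1)) (segment ?x 1 i) (?u i) \<noteq> ?y i))
          = (\<Sum>i=1..n. mixed_loss ?G ?x ?y i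
            + (1 - 2 * of_bool (?y i)) * (of_bool (?u i \<le> vote ?G ?x ?y i) - vote ?G ?x ?y i))"
        by (intro sum.cong) auto
      then show ?thesis unfolding average_loss_def by (simp only: sum.distrib add_divide_distrib)
    qed
    show ?case unfolding eq opt using tendsto_add[OF elim] by simp
  qed
qed

end
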